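(* Let $\Gamma$ be an amply regular (connected) graph with parameters $(v,k,\lambda,\mu)$ and $\mu>1$. Let $c\ge 2$ be the maximal integer such that for each vertex $x\in\Gamma$ and every pair of nonadjacent vertices $y,z$ of $\Gamma_1(x)$, there exists a $c$-coclique in $\Gamma_1(x)$ containing $y,z$. Suppose that $\Gamma$ attains equality in the $\mu$-bound, i.e. $$\mu-1=\max\left\{\frac{c'(\lambda+1)-k}{\binom{c'}{2}}\ :\ 2\le c'\le c\right\}.$$ Then $\mu=2$ and $\Gamma$ is the icosahedron, the Doro graph or the Conway--Smith graph.
   Context: All graphs are finite, undirected, without loops or multiple edges, and connected. For a vertex $u$ of a graph $\Gamma$, $\Gamma_i(u)$ is the set of vertices at distance $i$ from $u$, and also denotes the subgraph induced on this set; $\Gamma_1(u)$ is the local graph of $u$. "Nonadjacent vertices" means distinct nonadjacent vertices. A $c$-coclique is a set of $c$ pairwise nonadjacent distinct vertices. A graph $\Gamma$ is amply regular with parameters $(v,k,\lambda,\mu)$ if it has $v$ vertices, every vertex has degree $k$, any two adjacent vertices have exactly $\lambda$ common neighbours, and any two vertices at distance 2 have exactly $\mu$ common neighbours. A connected graph $\Gamma$ of diameter $d$ is distance-regular with intersection array $\{b_0,b_1,\ldots,b_{d-1};c_1,c_2,\ldots,c_d\}$ if for any two vertices $u,w$ at distance $i$ ($0\le i\le d$) there are exactly $c_i$ neighbours of $w$ in $\Gamma_{i-1}(u)$ and exactly $b_i$ neighbours of $w$ in $\Gamma_{i+1}(u)$ (where $\Gamma_{-1}(u)$ and $\Gamma_{d+1}(u)$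 are empty). The icosahedron is the unique distance-regular graph with intersection array $\{5,2,1;1,2,5\}$ (it is locally pentagon). The Doro graph is the unique distance-regular graph with intersection array $\{10,6,4;1,2,5\}$, and the Conway--Smith graph is the unique distance-regular graph with intersection array $\{10,6,4,1;1,2,6,10\}$ (both are locally the Petersen graph). *)

theory Defs
  imports "Graph_Theory.Graph_Theory"
begin

text \<open>
  A finite undirected graph without loops or multiple edges is a digraph \<open>G\<close> satisfying
  the locale predicate \<open>graph G\<close>; each edge is then represented by a pair of opposite arcs.
\<close>

definition neighbours :: "('a, 'b) pre_digraph \<Rightarrow> 'a \<Rightarrow> 'a set" where
  "neighbours G u = {w \<in> verts G. u \<rightarrow>\<^bsub>G\<^esub> w}"

text \<open>
  \<open>sphere G i u\<close> is $\Gamma_i(u)$. The library's shortest-path cost with unit arc weights is the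
  graph distance; it is extended-real valued, being infinite for unreachable vertices.
\<close>

definition sphere :: "('a, 'b) pre_digraph \<Rightarrow> nat \<Rightarrow> 'a \<Rightarrow> 'a set" where
  "sphere G i u = {w \<in> verts G. wf_digraph.\<mu> G (\<lambda>_. 1) u w = ereal (real i)}"

definition amply_regular :: "('a, 'b) pre_digraph \<Rightarrow> nat \<Rightarrow> nat \<Rightarrow> nat \<Rightarrow> nat \<Rightarrow> bool" where
  "amply_regular G v k l m \<longleftrightarrow>
     graph G \<and> card (verts G) = v \<and>
     (\<forall>u \<in> verts G. card (neighbours G u) = k) \<and>
     (\<forall>u \<in> verts G. \<forall>w \<in> neighbours G u. card (neighbours G u \<inter> neighbours G w) = l) \<and>
     (\<forall>u \<in> verts G. \<forall>w \<in> sphere G 2 u. card (neighbours G u \<inter> neighbours G w) = m)"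

definition has_diameter :: "('a, 'b) pre_digraph \<Rightarrow> nat \<Rightarrow> bool" where
  "has_diameter G d \<longleftrightarrow>
     (\<exists>u \<in> verts G. sphere G d u \<noteq> {}) \<and>
     (\<forall>u \<in> verts G. \<forall>w \<in> verts G. \<exists>i \<le> d. w \<in> sphere G i u)"

text \<open>
  The intersection array $\{b_0,\ldots,b_{d-1};c_1,\ldots,c_d\}$ is given by the lists
  \<open>bs = [b\<^sub>0, \<dots>, b\<^sub>d\<^sub>-\<^sub>1]\<close> and \<open>cs = [c\<^sub>1, \<dots>, c\<^sub>d]\<close>, so $c_i$ is \<open>cs ! (i - 1)\<close>.
  The values $c_0 = 0$ and $b_d = 0$ hold automatically, as the sets
  $\Gamma_{-1}(u)$ and $\Gamma_{d+1}(u)$ are empty.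
\<close>

definition distance_regular :: "('a, 'b) pre_digraph \<Rightarrow> nat list \<Rightarrow> nat list \<Rightarrow> bool" where
  "distance_regular G bs cs \<longleftrightarrow>
     graph G \<and> Digraph_Component.connected G \<and>
     length bs = length cs \<and> has_diameter G (length cs) \<and>
     (\<forall>i. \<forall>u \<in> verts G. \<forall>w \<in> sphere G i u.
        (1 \<le> i \<and> i \<le> length cs \<longrightarrow> card (neighbours G w \<inter> sphere G (i - 1) u) = cs ! (i - 1)) \<and>
        (i < length bs \<longrightarrow> card (neighbours G w \<inter> sphere G (i + 1) u) = bs ! i))"

text \<open>
  Each of the following three graphs is determined up to isomorphism by its intersection array
  and is defined by that array.
\<close>

definition is_icosahedron :: "('a, 'b) pre_digraph \<Rightarrow> bool" where
  "is_icosahedron G \<longleftrightarrow> distance_regular G [5, 2, 1] [1, 2, 5]"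

definition is_Doro_graph :: "('a, 'b) pre_digraph \<Rightarrow> bool" where
  "is_Doro_graph G \<longleftrightarrow> distance_regular G [10, 6, 4] [1, 2, 5]"

definition is_Conway_Smith_graph :: "('a, 'b) pre_digraph \<Rightarrow> bool" where
  "is_Conway_Smith_graph G \<longleftrightarrow> distance_regular G [10, 6, 4, 1] [1, 2, 6, 10]"

text \<open>Finiteness of \<open>S\<close> is explicit because \<open>card\<close> of an infinite set is \<open>0\<close>.\<close>

definition coclique :: "('a, 'b) pre_digraph \<Rightarrow> nat \<Rightarrow> 'a set \<Rightarrow> bool" where
  "coclique G c S \<longleftrightarrow>
     S \<subseteq> verts G \<and> finite S \<and> card S = c \<and>
     (\<forall>y \<in> S. \<forall>z \<in> S. y \<noteq> z \<longrightarrow> \<not> y \<rightarrow>\<^bsub>G\<^esub> z)"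

definition local_coclique_property :: "('a, 'b) pre_digraph \<Rightarrow> nat \<Rightarrow> bool" where
  "local_coclique_property G c \<longleftrightarrow>
     (\<forall>x \<in> verts G. \<forall>y \<in> sphere G 1 x. \<forall>z \<in> sphere G 1 x.
        y \<noteq> z \<and> \<not> y \<rightarrow>\<^bsub>G\<^esub> z \<longrightarrow>
        (\<exists>S. S \<subseteq> sphere G 1 x \<and> coclique G c S \<and> y \<in> S \<and> z \<in> S))"

end

theory Submission
  imports Defs
begin

text \<open>
  Equality in the bound is equality in the second Bonferroni inequality for the closed
  neighbourhoods, inside a local graph, of the vertices of a coclique. It forces the common neighbours of
  two vertices at distance 2 to form a clique (the graph is a Terwilliger graph) and
  \<open>k = c * (l + 1) - (c choose 2) * (\<mu> - 1)\<close>. Each local graph of a Terwilliger graph with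
  \<open>\<mu> \<ge> 2\<close> is a clique extension of a strongly regular Terwilliger graph. Applying this twice more to that
  strongly regular graph yields inequalities for its parameters which, together with the above
  equation, leave only the pentagon and the Petersen graph; the clique extension is trivial because
  these are triangle-free. So \<open>\<mu> = 2\<close>, and the distance partition is built up layer by layer. If the local graphs
  are Petersen graphs, the neighbours in \<open>\<Gamma>\<^sub>2(u)\<close> of a vertex of \<open>\<Gamma>\<^sub>3(u)\<close> induce a cycle of length
  5 or 6 in its local graph. This length does not depend on the vertex of \<open>\<Gamma>\<^sub>3(u)\<close>, nor on \<open>u\<close>,
  because the graph has 65 vertices in one case and 63 in the other.
\<close>

section \<open>Terwilliger graphs\<close>

text \<open>Regularity of the local graphs rests on an averaging argument. For nonadjacent
  \<open>y\<close>, \<open>z\<close> and a nonempty proper subset \<open>C\<close> of the clique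
  \<open>N y \<inter> N z\<close>, the difference between the numbers of common neighbours of
  \<open>insert y C\<close> and of \<open>insert z C\<close> is the mean of its values at the
  one-point enlargements of \<open>C\<close> in that clique. So it is the same for all
  \<open>C\<close>, and at a singleton it is \<open>l - l = 0\<close>. Dividing the equality by the
  size \<alpha> of the twin classes gives an equation for the quotient graph that is quadratic in
  the coclique size. Its nonnegative discriminant does most of the work; that the coclique size is
  an integer matters only against clique extensions of a pentagon with \<alpha> = 1, 4, 9. Local
  information alone does not settle the third layer: the Petersen graph contains induced pentagons
  as well as induced hexagons, so a single local graph permits both 5 and 6. The two lengths have to
  be compared between neighbouring vertices of the second layer.\<close>

lemma sum_card_swap:
  assumes "finite A" "finite B"
  shows "(\<Sum>a\<in>A. card {b \<in> B. R a b}) = (\<Sum>b\<in>B. card {a \<in> A. R a b})"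
  using sum.swap_restrict[OF assms, of "\<lambda>_ _. 1::nat" R] by simp

locale sgraph =
  fixes E :: "'a \<Rightarrow> 'a \<Rightarrow> bool"
  assumes E_sym: "E x y \<Longrightarrow> E y x" and E_irrefl: "\<not> E x x"
begin

lemma E_commute: "E x y \<longleftrightarrow> E y x"
  using E_sym by blast

definition nb :: "'a set \<Rightarrow> 'a \<Rightarrow> 'a set" where
  "nb X x = {y \<in> X. E x y}"

definition clique :: "'a set \<Rightarrow> bool" where
  "clique C \<longleftrightarrow> (\<forall>x\<in>C. \<forall>y\<in>C. x \<noteq> y \<longrightarrow> E x y)"

text \<open>Distance 2 is expressed by a nonempty set of common neighbours, and the vertex set is an
  argument, because the same relation \<open>E\<close> is later restricted to subsets of a local
  graph.\<close>

definition terwilliger :: "'a set \<Rightarrow> nat \<Rightarrow> nat \<Rightarrow> nat \<Rightarrow> bool" where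
  "terwilliger X k l m \<longleftrightarrow> finite X \<and>
     (\<forall>x\<in>X. card (nb X x) = k) \<and>
     (\<forall>x\<in>X. \<forall>y\<in>nb X x. card (nb X x \<inter> nb X y) = l) \<and>
     (\<forall>x\<in>X. \<forall>y\<in>X. x \<noteq> y \<and> \<not> E x y \<and> nb X x \<inter> nb X y \<noteq> {} \<longrightarrow>
        card (nb X x \<inter> nb X y) = m \<and> clique (nb X x \<inter> nb X y))"

text \<open>Strongly regular Terwilliger graphs that are not complete.\<close>

definition srt :: "'a set \<Rightarrow> nat \<Rightarrow> nat \<Rightarrow> nat \<Rightarrow> nat \<Rightarrow> bool" where
  "srt X v k l m \<longleftrightarrow> terwilliger X k l m \<and> card X = v \<and> 0 < m \<and>
     (\<exists>x\<in>X. \<exists>y\<in>X. x \<noteq> y \<and> \<not> E x y) \<and>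
     (\<forall>x\<in>X. \<forall>y\<in>X. x \<noteq> y \<and> \<not> E x y \<longrightarrow> card (nb X x \<inter> nb X y) = m)"

lemma nb_sub: "nb X x \<subseteq> X"
  by (auto simp: nb_def)

lemma mem_nb [simp]: "y \<in> nb X x \<longleftrightarrow> y \<in> X \<and> E x y"
  by (auto simp: nb_def)

lemma finite_nb: "finite X \<Longrightarrow> finite (nb X x)"
  using nb_sub finite_subset by blast

end

section \<open>Distance layers around a vertex\<close>

locale sgraph_on = sgraph E for E :: "'a \<Rightarrow> 'a \<Rightarrow> bool" +
  fixes X :: "'a set"
begin

primrec ball :: "'a \<Rightarrow> nat \<Rightarrow> 'a set" where
  "ball u 0 = {u}"
| "ball u (Suc i) = ball u i \<union> {w \<in> X. \<exists>v\<in>ball u i. E v w}"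

definition lay :: "'a \<Rightarrow> nat \<Rightarrow> 'a set" where
  "lay u i = (case i of 0 \<Rightarrow> {u} | Suc j \<Rightarrow> ball u i - ball u j)"

lemma lay_0 [simp]: "lay u 0 = {u}" by (simp add: lay_def)
lemma lay_Suc: "lay u (Suc i) = ball u (Suc i) - ball u i" by (simp add: lay_def)

lemma ball_mono: "i \<le> j \<Longrightarrow> ball u i \<subseteq> ball u j"
  by (rule lift_Suc_mono_le[of "ball u"]) auto

lemma ball_sub: "u \<in> X \<Longrightarrow> ball u i \<subseteq> X"
  by (induction i) auto

lemma lay_ball: "lay u i \<subseteq> ball u i"
  by (cases i) (auto simp: lay_Suc)

lemma lay_sub: "u \<in> X \<Longrightarrow> lay u i \<subseteq> X"
  using lay_ball ball_sub by blast

lemma lay_not_ball: "w \<in> lay u i \<Longrightarrow> j < i \<Longrightarrow> w \<notin> ball u j"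
  using ball_mono[of j "i - 1" u] by (cases i) (auto simp: lay_Suc)

lemma ball_lay: "w \<in> ball u i \<Longrightarrow> \<exists>j\<le>i. w \<in> lay u j"
proof (induction i)
  case (Suc i)
  show ?case
  proof (cases "w \<in> ball u i")
    case True
    then show ?thesis using Suc.IH le_SucI by blast
  next
    case False
    then have "w \<in> lay u (Suc i)" using Suc.prems by (simp add: lay_Suc)
    then show ?thesis by blast
  qed
qed simp

lemma lay_disjoint: "w \<in> lay u i \<Longrightarrow> w \<in> lay u j \<Longrightarrow> i = j"
  using lay_not_ball lay_ball by (metis linorder_neqE_nat subsetD)

lemma ball_step: "v \<in> ball u i \<Longrightarrow> w \<in> X \<Longrightarrow> E v w \<Longrightarrow> w \<in> ball u (Suc i)"
  by auto

lemma lay_step: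
  assumes "v \<in> lay u i" "v \<in> X" "w \<in> X" "E v w"
  obtains j where "w \<in> lay u j" "j \<le> Suc i" "i \<le> Suc j"
proof -
  have "w \<in> ball u (Suc i)" using ball_step assms lay_ball by blast
  then obtain j where j: "j \<le> Suc i" "w \<in> lay u j" using ball_lay by blast
  have "v \<in> ball u (Suc j)" using ball_step[of w u j v] assms j lay_ball E_sym by blast
  then have "i \<le> Suc j" using lay_not_ball[OF assms(1), of "Suc j"] by (meson not_le)
  then show ?thesis using that j by blast
qed

lemma lay_pred:
  assumes "w \<in> lay u (Suc i)"
  obtains v where "v \<in> lay u i" "E v w"
proof -
  obtain v where v: "v \<in> ball u i" "E v w" "w \<in> X" using assms by (auto simp: lay_Suc)
  obtain j where j: "j \<le> i" "v \<in> lay u j" using v ball_lay by blast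
  have "j = i"
  proof (rule ccontr)
    assume "j \<noteq> i"
    then have "w \<in> ball u i"
      using ball_step[of v u j w] v j lay_ball ball_mono[of "Suc j" i u] by fastforce
    then show False using assms by (simp add: lay_Suc)
  qed
  then show ?thesis using that v j by blast
qed

lemma lay_1: "u \<in> X \<Longrightarrow> lay u 1 = nb X u"
  using E_irrefl by (auto simp: lay_Suc)

lemma lay_1': "u \<in> X \<Longrightarrow> lay u (Suc 0) = nb X u"
  using lay_1 by simp

lemma lay_2: "u \<in> X \<Longrightarrow> w \<in> lay u 2 \<longleftrightarrow> w \<in> X \<and> w \<noteq> u \<and> \<not> E u w \<and> nb X u \<inter> nb X w \<noteq> {}"
proof -
  assume u: "u \<in> X"
  have "nb X u \<inter> nb X w \<noteq> {} \<longleftrightarrow> (\<exists>v\<in>X. E u v \<and> E v w)" using E_commute by fastforce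
  then show ?thesis using u E_irrefl by (auto simp: lay_Suc numeral_2_eq_2)
qed

lemma lay_3D:
  assumes "u \<in> X" "z \<in> lay u 3"
  shows "z \<in> X" "z \<noteq> u" "\<not> E u z" "nb X u \<inter> nb X z = {}"
proof -
  have z: "z \<in> X" using assms lay_sub by blast
  have "z \<notin> lay u 0" "z \<notin> lay u 1" "z \<notin> lay u 2"
    using lay_disjoint[OF assms(2)] by fastforce+
  then show "z \<in> X" "z \<noteq> u" "\<not> E u z" "nb X u \<inter> nb X z = {}"
    using lay_1[OF assms(1)] lay_2[OF assms(1), of z] z by auto
qed

lemma lay_3I:
  assumes "u \<in> X" "w \<in> lay u 2" "z \<in> nb X w" "\<not> E u z" "nb X u \<inter> nb X z = {}"
  shows "z \<in> lay u 3"
proof -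
  have z: "z \<in> X" "E w z" "w \<in> X" using assms lay_sub by auto
  have "z \<noteq> u" using z assms E_sym lay_2 by blast
  obtain j where j: "z \<in> lay u j" "j \<le> Suc 2" "2 \<le> Suc j"
    using lay_step[OF assms(2) z(3,1,2)] by metis
  moreover have "j \<noteq> 1" using j lay_1 assms by auto
  moreover have "j \<noteq> 2" using j lay_2 assms by auto
  ultimately have "j = 3" by linarith
  then show ?thesis using j by simp
qed

end

locale terwilliger_graph = sgraph +
  fixes X k l m
  assumes terw: "terwilliger X k l m"

sublocale terwilliger_graph \<subseteq> sgraph_on E X ..

context terwilliger_graph
begin

abbreviation N where "N \<equiv> nb X"

lemma finX [simp]: "finite X" using terw by (simp add: terwilliger_def)
lemma finN [simp]: "finite (N x)" by (simp add: finite_nb)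
lemma card_N: "x \<in> X \<Longrightarrow> card (N x) = k" using terw by (simp add: terwilliger_def)
lemma card_NN: "x \<in> X \<Longrightarrow> y \<in> X \<Longrightarrow> E x y \<Longrightarrow> card (N x \<inter> N y) = l"
  using terw by (simp add: terwilliger_def)
lemma card_M: "x \<in> X \<Longrightarrow> y \<in> X \<Longrightarrow> x \<noteq> y \<Longrightarrow> \<not> E x y \<Longrightarrow> w \<in> X \<Longrightarrow> E x w \<Longrightarrow> E y w
    \<Longrightarrow> card (N x \<inter> N y) = m"
  using terw unfolding terwilliger_def by (metis IntI empty_iff mem_nb)
lemma clique_M: "x \<in> X \<Longrightarrow> y \<in> X \<Longrightarrow> x \<noteq> y \<Longrightarrow> \<not> E x y \<Longrightarrow> clique (N x \<inter> N y)"
  using terw unfolding terwilliger_def by (metis clique_def empty_iff)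
lemma M_adj:
  assumes "x \<in> X" "y \<in> X" "x \<noteq> y" "\<not> E x y" "p \<in> X" "q \<in> X" "E x p" "E y p" "E x q" "E y q" "p \<noteq> q"
  shows "E p q"
proof -
  have "p \<in> N x \<inter> N y" "q \<in> N x \<inter> N y" using assms(5-10) by (simp_all only: Int_iff mem_nb simp_thms)
  then show ?thesis using clique_M[OF assms(1-4)] assms(11) unfolding clique_def by blast
qed

definition cn :: "'a set \<Rightarrow> 'a set" where
  "cn C = {y \<in> X. \<forall>x\<in>C. E x y}"

lemma fin_cn [simp]: "finite (cn C)" by (simp add: cn_def)
lemma cn_sub: "cn C \<subseteq> X" by (auto simp: cn_def)
lemma cn_insert: "cn (insert x C) = cn C \<inter> N x" by (auto simp: cn_def)

text \<open>Count the edges between the neighbours of \<open>y\<close> and those of \<open>z\<close> inside \<open>cn C\<close>.\<close>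

lemma cn_deviation_half:
  assumes yz: "y \<in> X" "z \<in> X" "y \<noteq> z" "\<not> E y z"
    and C: "C \<subseteq> N y \<inter> N z" "C \<noteq> {}"
  defines "F \<equiv> (N y \<inter> N z) - C"
  shows "(\<Sum>q\<in>cn (insert y C) - F. card ((cn (insert z C) - F) \<inter> N q))
       + (\<Sum>u\<in>F. card (cn (insert u (insert y C))))
       + card F = card (cn (insert y C)) * card F" (is "?e + ?s + _ = _")
proof -
  let ?M = "N y \<inter> N z" and ?U = "cn (insert y C) - F" and ?V = "cn (insert z C) - F"
  obtain x where x: "x \<in> C" using C by auto
  have cl: "clique ?M" using clique_M yz by blast
  have finF: "finite F" by (simp add: F_def)
  have finC: "finite C" using C(1) by (rule finite_subset) simp
  have Madj: "E p q" if "p \<in> ?M" "q \<in> ?M" "p \<noteq> q" for p q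
    using cl that unfolding clique_def by blast
  have "E c f" if "f \<in> F" "c \<in> C" for c f
    using Madj[of c f] C that unfolding F_def by blast
  moreover have "f \<in> X" "E y f" "E z f" if "f \<in> F" for f using that unfolding F_def by auto
  ultimately have Fcn: "F \<subseteq> cn (insert y C)" "F \<subseteq> cn (insert z C)"
    unfolding cn_def by blast+
  have le: "card F \<le> card (cn (insert y C))" by (rule card_mono[OF _ Fcn(1)]) simp
  \<comment> \<open>The pair \<open>q\<close>, \<open>z\<close> is again nonadjacent, has
    \<open>C\<close> among its common neighbours, and these form a clique. So exactly the
    \<open>m - card C\<close> of them outside \<open>C\<close> lie in
    \<open>cn (insert z C)\<close>.\<close>
  have qz: "card (cn (insert z C) \<inter> N q) = card F" if q: "q \<in> ?U" for q
  proof -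
    have q': "q \<in> X" "E y q" "\<And>c. c \<in> C \<Longrightarrow> E c q" using q by (auto simp: cn_def)
    have "q \<notin> C" using q' E_irrefl by blast
    then have "\<not> E z q" using q q' by (auto simp: F_def)
    have "q \<noteq> z" using q' yz by auto
    have xx: "x \<in> X" "E z x" "E q x" using x C q' E_commute by auto
    have cM: "card (N q \<inter> N z) = m" 
      using card_M[of q z x] xx q' yz \<open>q \<noteq> z\<close> \<open>\<not> E z q\<close> E_commute by blast
    have cM2: "card ?M = m" using card_M[of y z x] xx yz x C by auto
    have clq: "clique (N q \<inter> N z)" using clique_M[of q z] q' yz \<open>q \<noteq> z\<close> \<open>\<not> E z q\<close> E_commute by blast
    have Cs: "C \<subseteq> N q \<inter> N z" using C q' E_commute by auto
    have "cn (insert z C) \<inter> N q = (N q \<inter> N z) - C"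
    proof
      show "cn (insert z C) \<inter> N q \<subseteq> (N q \<inter> N z) - C"
        using E_irrefl by (auto simp: cn_def)
      show "(N q \<inter> N z) - C \<subseteq> cn (insert z C) \<inter> N q"
      proof
        fix r assume r: "r \<in> (N q \<inter> N z) - C"
        have "E c r" if "c \<in> C" for c
        proof -
          have "c \<in> N q \<inter> N z" "c \<noteq> r" "r \<in> N q \<inter> N z" using r that Cs by blast+
          then show ?thesis using clq unfolding clique_def by blast
        qed
        moreover have "r \<in> X" "E z r" "r \<in> N q" using r by auto
        ultimately show "r \<in> cn (insert z C) \<inter> N q" unfolding cn_def by blast
      qed
    qed
    then have "card (cn (insert z C) \<inter> N q) = m - card C"
      using cM Cs card_Diff_subset[OF finC Cs] by simp
    moreover have "card F = m - card C"
      unfolding F_def using cM2 card_Diff_subset[OF finC C(1)] by simp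
    ultimately show ?thesis by simp
  qed
  have 1: "card (?V \<inter> N q) + card {u \<in> F. E q u} = card F" if q: "q \<in> ?U" for q
  proof -
    have "cn (insert z C) \<inter> N q = (?V \<inter> N q) \<union> {u \<in> F. E q u}"
      using Fcn(2) by (auto simp: F_def)
    moreover have "(?V \<inter> N q) \<inter> {u \<in> F. E q u} = {}" by auto
    ultimately have "card (cn (insert z C) \<inter> N q) = card (?V \<inter> N q) + card {u \<in> F. E q u}"
      using finF by (simp add: card_Un_disjoint)
    then show ?thesis using qz[OF q] by simp
  qed
  have "?e + (\<Sum>q\<in>?U. card {u \<in> F. E q u}) = card ?U * card F"
    using 1 by (simp flip: sum.distrib)
  moreover have "(\<Sum>q\<in>?U. card {u \<in> F. E q u}) = (\<Sum>u\<in>F. card {q \<in> ?U. E q u})"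
    by (rule sum_card_swap) (simp_all add: finF)
  \<comment> \<open>\<open>F\<close> is a clique inside \<open>cn (insert y C)\<close>, so
    \<open>u\<close> is adjacent to the other \<open>card F - 1\<close> vertices of
    \<open>F\<close>, besides those of \<open>?U\<close>.\<close>
  moreover have "card {q \<in> ?U. E q u} + (card F - 1) = card (cn (insert u (insert y C)))" if u: "u \<in> F" for u
  proof -
    have "cn (insert u (insert y C)) = {q \<in> ?U. E q u} \<union> (F - {u})"
    proof -
      have *: "E u f" "f \<in> cn (insert y C)" if "f \<in> F - {u}" for f
        using Madj[of u f] Fcn that u unfolding F_def by blast+
      have "cn (insert u (insert y C)) = {q \<in> cn (insert y C). E q u}"
        unfolding cn_insert[of u] using cn_sub[of "insert y C"] E_commute by auto
      moreover have "E f u" if "f \<in> F - {u}" for f using * that E_sym by blast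
      ultimately show ?thesis using * u E_irrefl by blast
    qed
    moreover have "{q \<in> ?U. E q u} \<inter> (F - {u}) = {}" by auto
    ultimately show ?thesis using u finF by (simp add: card_Un_disjoint)
  qed
  then have "?s = (\<Sum>u\<in>F. card {q \<in> ?U. E q u} + (card F - 1))" by simp
  then have "?s = (\<Sum>u\<in>F. card {q \<in> ?U. E q u}) + card F * (card F - 1)"
    by (simp add: sum.distrib)
  moreover have "card ?U = card (cn (insert y C)) - card F"
    using Fcn(1) finF by (simp add: card_Diff_subset)
  ultimately have "?e + ?s + card F
      = (card (cn (insert y C)) - card F) * card F + card F * (card F - 1) + card F"
    by simp
  also have "\<dots> = card (cn (insert y C)) * card F"
    using le by (cases "card F") (auto simp: algebra_simps le_iff_add)
  finally show ?thesis .
qed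

text \<open>The number of edges in \<open>cn_deviation_half\<close> is symmetric in \<open>y\<close>
  and \<open>z\<close>. Subtracting its two versions removes the edges and the term
  \<open>card F\<close>.\<close>

lemma cn_deviation:
  assumes yz: "y \<in> X" "z \<in> X" "y \<noteq> z" "\<not> E y z" and C: "C \<subseteq> N y \<inter> N z" "C \<noteq> {}"
  defines "F \<equiv> (N y \<inter> N z) - C"
  defines "h \<equiv> \<lambda>C. int (card (cn (insert y C))) - int (card (cn (insert z C)))"
  shows "int (card F) * h C = (\<Sum>u\<in>F. h (insert u C))"
proof -
  let ?e = "\<lambda>y z. \<Sum>q\<in>cn (insert y C) - F. card ((cn (insert z C) - F) \<inter> N q)"
  let ?s = "\<lambda>y. \<Sum>u\<in>F. card (cn (insert u (insert y C)))"
  have zy: "z \<noteq> y" "\<not> E z y" "C \<subseteq> N z \<inter> N y" using yz C E_commute by auto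
  have F2: "F = (N z \<inter> N y) - C" by (auto simp: F_def)
  have *: "(cn D - F) \<inter> N q = {u \<in> cn D - F. E q u}" for D q using cn_sub[of D] by auto
  have **: "(cn D - F) \<inter> N q = {u \<in> cn D - F. E u q}" for D q
    using cn_sub[of D] E_commute by auto
  have "?e y z = ?e z y"
    unfolding *[of "insert z C"] **[of "insert y C"] by (rule sum_card_swap) simp_all
  moreover have "?e y z + ?s y + card F = card (cn (insert y C)) * card F"
    using cn_deviation_half[OF yz C] by (simp add: F_def)
  moreover have "?e z y + ?s z + card F = card (cn (insert z C)) * card F"
    using cn_deviation_half[OF yz(2,1) zy C(2)] by (simp add: F2)
  ultimately have "int (?s z) + int (card (cn (insert y C)) * card F)
      = int (?s y) + int (card (cn (insert z C)) * card F)" by linarith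
  then show ?thesis
    unfolding h_def by (simp add: sum_subtractf insert_commute algebra_simps)
qed

text \<open>Induction on the number of vertices of \<open>N y \<inter> N z\<close> missing from
  \<open>C\<close>: by \<open>cn_deviation\<close>, \<open>h C\<close> is a mean of values already
  known to equal \<open>h ?M\<close>. A singleton shows that this value is 0.\<close>

lemma cn_regular:
  assumes yz: "y \<in> X" "z \<in> X" "y \<noteq> z" "\<not> E y z" and C: "C \<subseteq> N y \<inter> N z" "C \<noteq> {}"
  shows "card (cn (insert y C)) = card (cn (insert z C))"
proof -
  let ?M = "N y \<inter> N z"
  define h where "h \<equiv> \<lambda>C. int (card (cn (insert y C))) - int (card (cn (insert z C)))"
  have main: "h C = h ?M" if "C \<subseteq> ?M" "C \<noteq> {}" for C
    using that
  proof (induction "card (?M - C)" arbitrary: C)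
    case 0
    then have "?M - C = {}" by (subst (asm) eq_commute) simp
    then show ?case using 0 by (metis Diff_eq_empty_iff subset_antisym)
  next
    case (Suc n)
    have "h (insert u C) = h ?M" if u: "u \<in> ?M - C" for u
    proof (rule Suc(1))
      have "?M - insert u C = (?M - C) - {u}" by auto
      then show "n = card (?M - insert u C)" using Suc(2) u by simp
    qed (use u Suc in auto)
    then have "(\<Sum>u\<in>?M - C. h (insert u C)) = (\<Sum>u\<in>?M - C. h ?M)"
      by (intro sum.cong refl)
    moreover have "int (card (?M - C)) * h C = (\<Sum>u\<in>?M - C. h (insert u C))"
      unfolding h_def by (rule cn_deviation[OF yz Suc(3,4)])
    ultimately have "int (card (?M - C)) * h C = int (card (?M - C)) * h ?M"
      by (simp only: sum_constant)
    then show ?case using Suc(2) by (metis Zero_neq_Suc mult_cancel_left of_nat_eq_0_iff)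
  qed
  obtain x where x: "x \<in> C" using C by auto
  have "cn {y, x} = N y \<inter> N x" "cn {z, x} = N z \<inter> N x"
    by (auto simp: cn_def)
  moreover have "card (N y \<inter> N x) = l" "card (N z \<inter> N x) = l"
    using card_NN yz x C by auto
  ultimately have "h {x} = 0" by (simp add: h_def)
  moreover have "{x} \<subseteq> ?M" using x C by blast
  ultimately have "h C = 0" using main[of C] main[of "{x}"] C by simp
  then show ?thesis by (simp add: h_def)
qed

text \<open>This is \<open>cn_regular\<close> for \<open>C = {x, w}\<close>. Seen in the local graph
  of \<open>x\<close>, the edges \<open>w y\<close> and \<open>w z\<close> lie in equally many
  triangles.\<close>

lemma triangle_regular:
  assumes "x \<in> X" "w \<in> X" "E x w" "y \<in> N x \<inter> N w" "z \<in> N x \<inter> N w" "y \<noteq> z" "\<not> E y z"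
  shows "card (N x \<inter> N w \<inter> N y) = card (N x \<inter> N w \<inter> N z)"
proof -
  have "cn {u, x, w} = N x \<inter> N w \<inter> N u" for u by (auto simp: cn_def)
  moreover have "{x, w} \<subseteq> N y \<inter> N z" using assms E_commute by auto
  ultimately show ?thesis using cn_regular[of y z "{x,w}"] assms by simp
qed

end

section \<open>Local graphs as clique extensions\<close>

context sgraph begin

text \<open>For \<open>a\<close> in the local graph of \<open>x\<close> this is its closed
  neighbourhood there. Closed neighbourhoods are taken because adjacent twins share them.\<close>

definition star :: "'a set \<Rightarrow> 'a \<Rightarrow> 'a \<Rightarrow> 'a set" where
  "star X x a = {b \<in> nb X x. b = a \<or> E a b}"

end

locale terwilliger_vertex = terwilliger_graph +
  fixes x
  assumes x: "x \<in> X" and m2: "2 \<le> m" and kl: "l + 1 < k"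
begin

abbreviation D where "D \<equiv> nb X x"
abbreviation S where "S \<equiv> star X x"

lemma mem_S: "b \<in> S a \<longleftrightarrow> b \<in> D \<and> (b = a \<or> E a b)"
  by (simp add: star_def)
lemma S_sub: "S a \<subseteq> D" by (auto simp: star_def)
lemma fin_S [simp]: "finite (S a)" by (rule finite_subset[OF S_sub]) simp
lemma S_self: "a \<in> D \<Longrightarrow> a \<in> S a" by (simp add: star_def)
lemma S_sym: "a \<in> D \<Longrightarrow> b \<in> S a \<Longrightarrow> a \<in> S b" by (auto simp: star_def E_commute)
lemma S_eq: "a \<in> D \<Longrightarrow> S a = insert a (N x \<inter> N a)" by (auto simp: star_def)
lemma card_S: "a \<in> D \<Longrightarrow> card (S a) = l + 1"
  using card_NN[OF x, of a] E_irrefl by (simp add: S_eq)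

definition f where "f a b = card (D \<inter> N a \<inter> N b)"

lemma f_commute: "f a b = f b a" by (simp add: f_def Int_ac)

text \<open>Two vertices of \<open>D\<close> are twins if they have the same \<open>S\<close>; \<open>nt\<close> means adjacent and not twins.\<close>

definition nt where "nt a b \<longleftrightarrow> a \<in> D \<and> b \<in> D \<and> E a b \<and> S a \<noteq> S b"

lemma nt_sym: "nt a b \<Longrightarrow> nt b a" unfolding nt_def using E_sym by blast

text \<open>All closed neighbourhoods have size \<open>l + 1\<close>, so different ones are
  incomparable.\<close>

lemma nt_witness:
  assumes "nt a b"
  obtains z where "z \<in> D \<inter> N a" "z \<noteq> b" "\<not> E b z"
proof -
  have ab: "a \<in> D" "b \<in> D" "E a b" "S a \<noteq> S b" using assms by (auto simp: nt_def)
  have "\<not> S a \<subseteq> S b"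
    using card_subset_eq[of "S b" "S a"] ab card_S by auto
  then obtain z where z: "z \<in> S a" "z \<notin> S b" by auto
  have "z \<noteq> a" using z ab E_sym by (auto simp: mem_S)
  then show ?thesis using z ab by (intro that[of z]) (auto simp: mem_S)
qed

text \<open>By \<open>triangle_regular\<close>, \<open>f a\<close> agrees at nonadjacent vertices of
  \<open>D \<inter> N a\<close>, so it suffices to connect \<open>b\<close> and \<open>c\<close> in
  the complement. With non-neighbours \<open>y\<close> of \<open>b\<close> and \<open>z\<close> of
  \<open>c\<close>, one of \<open>b y c\<close>, \<open>b z c\<close>, \<open>b y z c\<close> is a
  path there, unless \<open>b\<close> and \<open>c\<close> are themselves equal or
  nonadjacent.\<close>

lemma f_const_at:
  assumes "nt a b" "nt a c"
  shows "f a b = f a c"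
proof -
  have tr: "f a p = f a q" if "p \<in> D \<inter> N a" "q \<in> D \<inter> N a" "p \<noteq> q" "\<not> E p q" for p q
    using triangle_regular[of x a p q] that assms x unfolding f_def nt_def by simp
  have bc: "b \<in> D \<inter> N a" "c \<in> D \<inter> N a" using assms by (auto simp: nt_def)
  obtain y where y: "y \<in> D \<inter> N a" "y \<noteq> b" "\<not> E b y" using nt_witness[OF assms(1)] .
  obtain z where z: "z \<in> D \<inter> N a" "z \<noteq> c" "\<not> E c z" using nt_witness[OF assms(2)] .
  have fy: "f a b = f a y" using tr[of b y] y bc by simp
  have fz: "f a c = f a z" using tr[of c z] z bc by simp
  show ?thesis
  proof (cases "b = c \<or> \<not> E b c")
    case True then show ?thesis using tr[of b c] bc by auto
  next
    case False
    then have ne: "y \<noteq> c" "z \<noteq> b" using y z E_commute by auto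
    show ?thesis
    proof (cases "E y c \<and> E z b")
      case True
      then have "y \<noteq> z" using y E_commute by auto
      \<comment> \<open>Otherwise \<open>c\<close> and \<open>z\<close> would be common neighbours
        of the nonadjacent vertices \<open>b\<close>, \<open>y\<close>, hence adjacent.\<close>
      have "\<not> E y z"
      proof
        assume "E y z"
        then have "E c z" using M_adj[of b y c z] True False y z bc E_commute ne by auto
        then show False using z by simp
      qed
      then show ?thesis using tr[of y z] y z fy fz \<open>y \<noteq> z\<close> by simp
    next
      case False
      then show ?thesis using tr[of y c] tr[of z b] y z bc fy fz ne by auto
    qed
  qed
qed

text \<open>As \<open>m \<ge> 2\<close>, there is a common neighbour other than \<open>x\<close>; it
  lies in \<open>D\<close> because common neighbours form a clique.\<close>

lemma nonadjacent_witness: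
  assumes "a \<in> D" "b \<in> D" "a \<noteq> b" "\<not> E a b"
  obtains w where "nt a w" "nt b w"
proof -
  have ab: "a \<in> X" "b \<in> X" "E x a" "E x b" using assms by auto
  have "card (N a \<inter> N b) = m" using card_M[of a b x] ab assms x E_commute by auto
  then have "\<not> N a \<inter> N b \<subseteq> {x}" using m2 card_mono[of "{x}" "N a \<inter> N b"] by auto
  then obtain w where w: "w \<in> N a \<inter> N b" "w \<noteq> x" by blast
  then have "E x w" using M_adj[of a b x w] ab assms x E_commute by auto
  then have "w \<in> D" using w by auto
  have "b \<in> S w" "a \<in> S w" "b \<notin> S a" "a \<notin> S b"
    using w assms \<open>w \<in> D\<close> E_commute by (auto simp: mem_S)
  then show ?thesis using w \<open>w \<in> D\<close> assms by (intro that[of w]) (auto simp: nt_def)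
qed

lemma f_const:
  assumes "nt a b" "nt c d"
  shows "f a b = f c d"
proof -
  have ac: "a \<in> D" "c \<in> D" using assms by (auto simp: nt_def)
  consider "S a = S c" | "nt a c" | "a \<noteq> c" "\<not> E a c" using ac by (auto simp: nt_def)
  then show ?thesis
  proof cases
    case 1
    have ab: "b \<in> D" "E a b" "S a \<noteq> S b" using assms(1) by (simp_all add: nt_def)
    have "b \<in> S a" using ab by (simp add: mem_S del: mem_nb)
    then have "b \<in> S c" using 1 by simp
    moreover have "S c \<noteq> S b" using 1 ab by simp
    ultimately have "nt c b" using ac ab unfolding nt_def by (auto simp only: mem_S)
    then show ?thesis
      by (metis assms f_commute f_const_at nt_sym)
  next
    case 2
    then show ?thesis by (metis assms f_commute f_const_at nt_sym)
  next
    case 3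
    obtain w where "nt a w" "nt c w" using nonadjacent_witness[OF ac 3] .
    then show ?thesis by (metis assms f_commute f_const_at nt_sym)
  qed
qed

lemma nonadjacent_ex:
  assumes "a \<in> D"
  obtains z where "z \<in> D" "z \<noteq> a" "\<not> E a z"
proof -
  have "\<not> D \<subseteq> S a"
    using card_mono[OF fin_S, of D a] card_S[OF assms] card_N[OF x] kl by auto
  then obtain z where "z \<in> D" "z \<notin> S a" by blast
  then show ?thesis using that by (simp add: mem_S)
qed

lemma D_nonempty: "D \<noteq> {}" using card_N[OF x] kl by auto

text \<open>The common value of \<open>f\<close> on non-twin edges. In \<open>twin_count\<close> it
  is multiplied by the number of non-twins of \<open>a\<close> in \<open>S a\<close>, so an
  arbitrary value is harmless if there are none.\<close>

definition \<tau> where "\<tau> = (SOME t. \<exists>a b. nt a b \<and> t = f a b)"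

lemma f_tau:
  assumes "nt a b"
  shows "f a b = \<tau>"
proof -
  have "\<exists>c d. nt c d \<and> \<tau> = f c d" unfolding \<tau>_def by (rule someI_ex) (use assms in blast)
  then show ?thesis using f_const[OF assms] by metis
qed

lemma S_Int_card:
  assumes "nt a b"
  shows "card (S a \<inter> S b) = \<tau> + 2"
proof -
  have ab: "a \<in> D" "b \<in> D" "E a b" "E b a" "a \<noteq> b" using assms E_sym E_irrefl by (auto simp: nt_def)
  have "S a \<inter> S b = insert a (insert b (D \<inter> N a \<inter> N b))"
    using ab by (auto simp: star_def)
  moreover have "card (D \<inter> N a \<inter> N b) = \<tau>" using f_tau[OF assms] by (simp add: f_def)
  ultimately show ?thesis using ab E_irrefl by simp
qed

lemma S_Int_card_nonadj:
  assumes "a \<in> D" "b \<in> D" "a \<noteq> b" "\<not> E a b"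
  shows "S a \<inter> S b = N a \<inter> N b - {x}" "card (S a \<inter> S b) = m - 1"
proof -
  have ab: "a \<in> X" "b \<in> X" "E a x" "E b x" using assms E_commute by auto
  have "\<not> E b a" using assms E_commute by blast
  have "w \<in> D" if "w \<in> N a \<inter> N b - {x}" for w
    using M_adj[of a b x w] that ab assms x by auto
  then show *: "S a \<inter> S b = N a \<inter> N b - {x}"
    using assms(1-4) \<open>\<not> E b a\<close> E_irrefl[of x] by (auto simp: star_def)
  have "card (N a \<inter> N b) = m" using card_M[of a b x] ab assms x by auto
  then show "card (S a \<inter> S b) = m - 1" unfolding * using ab x by (simp add: card_Diff_singleton)
qed

definition tw where "tw a = {b \<in> D. S b = S a}"

lemma tw_sub: "a \<in> D \<Longrightarrow> tw a \<subseteq> S a"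
  using S_self by (auto simp: tw_def)

lemma fin_tw [simp]: "finite (tw a)" by (simp add: tw_def)

text \<open>Edges between \<open>S a\<close> and \<open>D - S a\<close>, counted from both sides. A
  twin of \<open>a\<close> sends none, a non-twin \<open>q\<close> sends all of \<open>S q\<close>
  except the \<open>\<tau> + 2\<close> vertices shared with \<open>S a\<close>, and each outer
  vertex receives \<open>m - 1\<close>.\<close>

lemma twin_count:
  assumes a: "a \<in> D"
  shows "(l + 1 - card (tw a)) * (l + 1 - (\<tau> + 2)) = (k - (l + 1)) * (m - 1)"
proof -
  have "(\<Sum>q\<in>S a. card {z \<in> D - S a. E q z}) = (\<Sum>z\<in>D - S a. card {q \<in> S a. E q z})"
    by (rule sum_card_swap) simp_all
  moreover have "card {q \<in> S a. E q z} = m - 1" if "z \<in> D - S a" for z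
  proof -
    have z: "z \<in> D" "z \<noteq> a" "\<not> E a z" using that a by (auto simp: mem_S)
    have "{q \<in> S a. E q z} = S a \<inter> S z" using z a by (auto simp: mem_S E_commute)
    then show ?thesis using S_Int_card_nonadj(2)[of a z] z a by auto
  qed
  moreover have "card {z \<in> D - S a. E q z} = l + 1 - (\<tau> + 2)" if "q \<in> S a - tw a" for q
  proof -
    have nt: "nt q a"
    proof -
      have "S q \<noteq> S a" "q \<in> D" using that by (auto simp: tw_def mem_S)
      moreover from this have "q \<noteq> a" by auto
      ultimately show ?thesis using that a E_sym by (auto simp: nt_def mem_S)
    qed
    have "{z \<in> D - S a. E q z} = S q - (S q \<inter> S a)" using that by (auto simp: mem_S)
    moreover have "card (S q - (S q \<inter> S a)) = card (S q) - card (S q \<inter> S a)"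
      by (rule card_Diff_subset) simp_all
    ultimately show ?thesis using S_Int_card[OF nt] nt card_S[of q] by (simp add: nt_def)
  qed
  moreover have "card {z \<in> D - S a. E q z} = 0" if "q \<in> tw a" for q
  proof -
    have "{z \<in> D - S a. E q z} = {}" using that by (auto simp: tw_def mem_S set_eq_iff)
    then show ?thesis by (metis card.empty)
  qed
  moreover have "(\<Sum>q\<in>S a. card {z \<in> D - S a. E q z})
      = (\<Sum>q\<in>tw a. card {z \<in> D - S a. E q z}) + (\<Sum>q\<in>S a - tw a. card {z \<in> D - S a. E q z})"
    using sum.subset_diff[OF tw_sub[OF a] fin_S, of "\<lambda>q. card {z \<in> D - S a. E q z}"] by linarith
  moreover have "card (S a - tw a) = l + 1 - card (tw a)"
    using card_S[OF a] tw_sub[OF a] by (simp add: card_Diff_subset)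
  moreover have "card (D - S a) = k - (l + 1)"
    using card_S[OF a] S_sub card_N[OF x] by (simp add: card_Diff_subset)
  ultimately show ?thesis by simp
qed

text \<open>In \<open>twin_count\<close> the right side is positive and, like the second factor on
  the left, independent of \<open>a\<close>.\<close>

lemma tw_card_const:
  assumes "a \<in> D" "b \<in> D"
  shows "card (tw a) = card (tw b)"
proof -
  have le: "card (tw c) \<le> l + 1" if "c \<in> D" for c
    using card_mono[OF fin_S tw_sub[OF that]] card_S[OF that] by simp
  have "0 < (k - (l + 1)) * (m - 1)" using m2 kl by simp
  then have "l + 1 - card (tw a) = l + 1 - card (tw b)"
  proof -
    have "A = B" if "A * C = P" "B * C = P" "0 < P" for A B C P :: nat
      using that by auto
    from this[OF twin_count[OF assms(1)] twin_count[OF assms(2)]] show ?thesis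
      using \<open>0 < _\<close> by blast
  qed
  then show ?thesis using le[OF assms(1)] le[OF assms(2)] by linarith
qed

text \<open>A function of \<open>S a\<close> alone, so that twins get the same
  representative.\<close>

definition rep where "rep a = (SOME b. b \<in> D \<and> S b = S a)"

lemma rep: "a \<in> D \<Longrightarrow> rep a \<in> D \<and> S (rep a) = S a"
  unfolding rep_def by (rule someI2[of _ a]) auto

lemma rep_cong: "S a = S b \<Longrightarrow> rep a = rep b" by (simp add: rep_def)

definition T where "T = rep ` D"

lemma T_sub: "T \<subseteq> D" using rep by (auto simp: T_def)

lemma T_inj: "s \<in> T \<Longrightarrow> t \<in> T \<Longrightarrow> S s = S t \<Longrightarrow> s = t"
  using rep rep_cong unfolding T_def by (metis imageE)

text \<open>\<open>Y\<close> is a union of twin classes; these have equal size, and \<open>T\<close>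
  meets each of them once.\<close>

lemma card_transversal:
  assumes Y: "Y \<subseteq> D" "\<And>b c. b \<in> Y \<Longrightarrow> c \<in> D \<Longrightarrow> S c = S b \<Longrightarrow> c \<in> Y" and a: "a \<in> D"
  shows "card Y = card (tw a) * card (Y \<inter> T)"
proof -
  have "Y = (\<Union>t\<in>Y \<inter> T. tw t)"
  proof
    show "Y \<subseteq> (\<Union>t\<in>Y \<inter> T. tw t)"
    proof
      fix b assume b: "b \<in> Y"
      then have "b \<in> D" using Y by auto
      then have "rep b \<in> Y \<inter> T" "b \<in> tw (rep b)" using rep[of b] Y(2)[OF b] by (auto simp: T_def tw_def)
      then show "b \<in> (\<Union>t\<in>Y \<inter> T. tw t)" by blast
    qed
    show "(\<Union>t\<in>Y \<inter> T. tw t) \<subseteq> Y" using Y(2) by (auto simp: tw_def)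
  qed
  moreover have "card (\<Union>t\<in>Y \<inter> T. tw t) = (\<Sum>t\<in>Y \<inter> T. card (tw t))"
  proof (rule card_UN_disjoint)
    show "finite (Y \<inter> T)" using Y(1) finite_subset finN by blast
    show "\<forall>i\<in>Y \<inter> T. \<forall>j\<in>Y \<inter> T. i \<noteq> j \<longrightarrow> tw i \<inter> tw j = {}"
      using T_inj by (auto simp: tw_def)
  qed simp
  moreover have "(\<Sum>t\<in>Y \<inter> T. card (tw t)) = (\<Sum>t\<in>Y \<inter> T. card (tw a))"
    by (intro sum.cong refl tw_card_const a) (use T_sub in blast)
  ultimately show ?thesis by simp
qed

text \<open>The quotient by twins is realised as the subgraph induced on the representatives.
  \<open>D\<close>, \<open>S t\<close> and \<open>S s \<inter> S t\<close> are unions of twin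
  classes, so all relevant counts scale by \<open>\<alpha>\<close>. The last conjunct keeps the link
  between the local graph and \<open>T\<close> for the later proof that
  \<open>\<alpha> = 1\<close>.\<close>

lemma local_structure:
  "\<exists>\<alpha> T v k' l' m'. 0 < \<alpha> \<and> T \<subseteq> nb X x \<and> srt T v k' l' m' \<and>
     k = \<alpha> * v \<and> l + 1 = \<alpha> * (k' + 1) \<and> m = \<alpha> * m' + 1 \<and>
     (\<forall>a\<in>nb X x. \<exists>t\<in>T. star X x a = star X x t)"
proof -
  obtain a where a: "a \<in> D" using D_nonempty by blast
  define \<alpha> where "\<alpha> = card (tw a)"
  have "a \<in> tw a" using a by (simp add: tw_def)
  then have pos: "0 < \<alpha>" unfolding \<alpha>_def by (metis card_gt_0_iff empty_iff fin_tw)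
  have ct: "card Y = \<alpha> * card (Y \<inter> T)"
    if "Y \<subseteq> D" "\<And>b c. b \<in> Y \<Longrightarrow> c \<in> D \<Longrightarrow> S c = S b \<Longrightarrow> c \<in> Y" for Y
    using card_transversal[OF that a] by (simp add: \<alpha>_def)
  have Sclosed: "c \<in> S t" if "b \<in> S t" "t \<in> D" "c \<in> D" "S c = S b" for b c t
    by (metis that S_sym)
  have finT: "finite T" using T_sub finite_subset finN by blast
  have nbT: "nb T t = S t \<inter> T - {t}" if "t \<in> T" for t
    using that T_sub E_irrefl by (auto simp: mem_S)
  have cS: "l + 1 = \<alpha> * card (S t \<inter> T)" if "t \<in> D" for t
    using ct[of "S t"] S_sub Sclosed that card_S[OF that] by metis
  have cSS: "card (S s \<inter> S t) = \<alpha> * card (S s \<inter> S t \<inter> T)" if "s \<in> D" "t \<in> D" for s t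
    by (rule ct) (use S_sub Sclosed that in blast)+
  \<comment> \<open>Counts are made with closed neighbourhoods and divided by
    \<open>\<alpha>\<close>. The outer corrections 1 and 2 remove the vertices \<open>t\<close>,
    respectively \<open>s\<close> and \<open>t\<close>; in \<open>m - 1\<close> it is
    \<open>x\<close> that is removed.\<close>
  define k' where "k' = (l + 1) div \<alpha> - 1"
  define l' where "l' = (\<tau> + 2) div \<alpha> - 2"
  define m' where "m' = (m - 1) div \<alpha>"
  have k': "card (nb T t) = k'" if "t \<in> T" for t
  proof -
    have "t \<in> D" using that T_sub by auto
    then have "card (S t \<inter> T) = (l + 1) div \<alpha>" using cS[of t] pos by (metis nonzero_mult_div_cancel_left not_gr0)
    moreover have "t \<in> S t \<inter> T" using that \<open>t \<in> D\<close> S_self by auto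
    ultimately show ?thesis by (simp add: nbT[OF that] k'_def)
  qed
  have l': "card (nb T s \<inter> nb T t) = l'" if st: "s \<in> T" "t \<in> T" "E s t" for s t
  proof -
    have D: "s \<in> D" "t \<in> D" using st T_sub by auto
    have "s \<noteq> t" using st E_irrefl by auto
    then have "nt s t" using D st T_inj by (auto simp: nt_def)
    then have "card (S s \<inter> S t \<inter> T) = (\<tau> + 2) div \<alpha>"
      using cSS[OF D] S_Int_card[of s t] pos by (metis nonzero_mult_div_cancel_left not_gr0)
    moreover have "nb T s \<inter> nb T t = S s \<inter> S t \<inter> T - {s, t}" using nbT st by auto
    moreover have "{s, t} \<subseteq> S s \<inter> S t \<inter> T" using st D E_sym by (auto simp: mem_S)
    ultimately show ?thesis using \<open>s \<noteq> t\<close> by (simp add: l'_def card_Diff_subset)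
  qed
  have m': "nb T s \<inter> nb T t \<subseteq> N s \<inter> N t" "card (nb T s \<inter> nb T t) = m'" "m - 1 = \<alpha> * m'"
    if st: "s \<in> T" "t \<in> T" "s \<noteq> t" "\<not> E s t" for s t
  proof -
    have D: "s \<in> D" "t \<in> D" using st T_sub by auto
    show "nb T s \<inter> nb T t \<subseteq> N s \<inter> N t" using T_sub by auto
    have c: "m - 1 = \<alpha> * card (S s \<inter> S t \<inter> T)"
      using cSS[OF D] S_Int_card_nonadj[OF D st(3,4)] by simp
    then have c2: "card (S s \<inter> S t \<inter> T) = m'"
      unfolding m'_def using pos by (metis nonzero_mult_div_cancel_left not_gr0)
    have "nb T s \<inter> nb T t = S s \<inter> S t \<inter> T" using nbT st E_commute by (auto simp: mem_S)
    then show "card (nb T s \<inter> nb T t) = m'" using c2 by simp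
    show "m - 1 = \<alpha> * m'" using c c2 by simp
  qed
  obtain z where z: "z \<in> D" "z \<noteq> a" "\<not> E a z" using nonadjacent_ex[OF a] .
  have ra: "rep a \<in> T" "rep z \<in> T" using a z by (auto simp: T_def)
  have "rep z \<notin> S (rep a)"
    using z a rep[of a] rep[of z] by (metis S_sym mem_S)
  then have nonadj: "rep a \<noteq> rep z" "\<not> E (rep a) (rep z)"
    using rep[of a] rep[of z] a z by (auto simp: mem_S)
  have mm: "m - 1 = \<alpha> * m'" using m'(3)[OF ra nonadj] .
  then have "0 < m'" using m2 by (cases m') auto
  have "clique (nb T s \<inter> nb T t)" if "s \<in> T" "t \<in> T" "s \<noteq> t" "\<not> E s t" for s t
  proof -
    have "clique (N s \<inter> N t)" using clique_M that T_sub nb_sub by blast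
    then show ?thesis using m'(1)[OF that] unfolding clique_def by blast
  qed
  then have "terwilliger T k' l' m'"
    unfolding terwilliger_def using finT k' l' m'(2) by (simp add: Ball_def)
  then have "srt T (card T) k' l' m'"
    unfolding srt_def using \<open>0 < m'\<close> ra nonadj m'(2) by blast
  moreover have "k = \<alpha> * card T"
    using ct[of D] card_N[OF x] T_sub by (simp add: Int_absorb1)
  moreover have "l + 1 = \<alpha> * (k' + 1)"
  proof -
    have "1 \<le> (l + 1) div \<alpha>"
      using cS[OF a] pos by (metis One_nat_def Suc_leI add_is_0 bot_nat_0.not_eq_extremum mult_is_0 nonzero_mult_div_cancel_left one_neq_zero)
    then show ?thesis using cS[OF a] pos by (simp add: k'_def)
  qed
  moreover have "m = \<alpha> * m' + 1" using mm m2 by simp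
  moreover have "\<forall>a\<in>D. \<exists>t\<in>T. S a = S t" using rep by (metis T_def image_eqI)
  ultimately show ?thesis using pos T_sub by blast
qed

end

section \<open>Strongly regular Terwilliger graphs\<close>

locale srt_graph = sgraph +
  fixes X v k l m
  assumes srt: "srt X v k l m"

sublocale srt_graph \<subseteq> terwilliger_graph
  by unfold_locales (use srt srt_def in blast)

context srt_graph
begin

lemma card_X: "card X = v" and m_pos: "0 < m"
  using srt by (simp_all add: srt_def)

lemma card_M_srt: "x \<in> X \<Longrightarrow> y \<in> X \<Longrightarrow> x \<noteq> y \<Longrightarrow> \<not> E x y \<Longrightarrow> card (N x \<inter> N y) = m"
  using srt unfolding srt_def by blast

lemma nonadj_ex:
  obtains x y where "x \<in> X" "y \<in> X" "x \<noteq> y" "\<not> E x y" "\<not> E y x"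
  using srt E_sym unfolding srt_def by metis

lemma card_star: "x \<in> X \<Longrightarrow> card (insert x (N x)) = k + 1"
  using card_N E_irrefl by simp

text \<open>Edges between the neighbours and the non-neighbours of one vertex, counted from both
  sides.\<close>

lemma edge_count: "int k * (int k - 1 - int l) = int m * (int v - 1 - int k)" and k_less_v: "k + 1 < v"
proof -
  obtain x y where xy: "x \<in> X" "y \<in> X" "x \<noteq> y" "\<not> E x y" using nonadj_ex by metis
  let ?Z = "X - insert x (N x)"
  have ss: "insert x (N x) \<subseteq> X" using xy nb_sub by auto
  have Z: "int (card ?Z) = int v - 1 - int k"
    using card_star[OF xy(1)] card_X ss card_mono[OF finX ss] by (simp add: card_Diff_subset)
  have "y \<in> ?Z" using xy by auto
  then have "card ?Z \<noteq> 0" by (metis card_0_eq empty_iff finX finite_Diff)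
  then show "k + 1 < v" using Z by linarith
  have "(\<Sum>q\<in>N x. card {z \<in> ?Z. E q z}) = (\<Sum>z\<in>?Z. card {q \<in> N x. E q z})"
    by (rule sum_card_swap) simp_all
  moreover have "card {q \<in> N x. E q z} = m" if "z \<in> ?Z" for z
  proof -
    have "{q \<in> N x. E q z} = N x \<inter> N z" using that E_commute by auto
    then show ?thesis using card_M_srt[of x z] that xy by auto
  qed
  moreover have "card {z \<in> ?Z. E q z} = k - (l + 1)" if "q \<in> N x" for q
  proof -
    have q: "q \<in> X" "E x q" "E q x" using that E_sym by auto
    have "{z \<in> ?Z. E q z} = N q - insert x (N x \<inter> N q)" using q by auto
    moreover have "insert x (N x \<inter> N q) \<subseteq> N q" using q xy by auto
    moreover have "card (insert x (N x \<inter> N q)) = l + 1"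
      using card_NN[of x q] q xy E_irrefl by simp
    ultimately show ?thesis using card_N[of q] q by (simp add: card_Diff_subset)
  qed
  ultimately have e: "k * (k - (l + 1)) = card ?Z * m" using card_N xy by simp
  have "l + 1 \<le> k"
    using e \<open>card ?Z \<noteq> 0\<close> m_pos by (cases "l + 1 \<le> k") auto
  then have "int (k - (l + 1)) = int k - 1 - int l" by simp
  moreover have "int k * int (k - (l + 1)) = int (card ?Z) * int m"
    using e by (metis of_nat_mult)
  ultimately show "int k * (int k - 1 - int l) = int m * (int v - 1 - int k)"
    using Z by (simp add: mult.commute)
qed

lemma l_less_k: "l + 1 < k"
proof -
  have "0 < int m * (int v - 1 - int k)" using k_less_v m_pos by simp
  then have "0 < int k * (int k - 1 - int l)" using edge_count by simp
  then show ?thesis by (simp add: zero_less_mult_iff)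
qed

text \<open>The closed neighbourhoods of two nonadjacent vertices overlap in \<open>m\<close>
  vertices. The slack in this bound is the number \<open>e\<close> of
  \<open>no_larger_mu\<close>.\<close>

lemma v_ge: "2 * (k + 1) \<le> v + m"
proof -
  obtain x y where xy: "x \<in> X" "y \<in> X" "x \<noteq> y" "\<not> E x y" "\<not> E y x" using nonadj_ex .
  have "insert x (N x) \<inter> insert y (N y) = N x \<inter> N y" using xy by auto
  then have "card (insert x (N x) \<union> insert y (N y)) + m = 2 * (k + 1)"
    using card_Un_Int[of "insert x (N x)" "insert y (N y)"] card_star card_M_srt xy by simp
  moreover have "card (insert x (N x) \<union> insert y (N y)) \<le> v"
    unfolding card_X[symmetric] using xy by (intro card_mono) auto
  ultimately show ?thesis by linarith
qed

lemma common_nb_ex: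
  assumes "x \<in> X" "y \<in> X" "x \<noteq> y" "\<not> E x y"
  obtains w where "w \<in> X" "E x w" "E y w"
proof -
  have "N x \<inter> N y \<noteq> {}" using card_M_srt[OF assms] m_pos by (metis card.empty less_irrefl)
  then show ?thesis using that by auto
qed

text \<open>The same packing in the local graph of a common neighbour \<open>w\<close>: two closed
  neighbourhoods of size \<open>l + 1\<close> there share at most \<open>m - 1\<close> vertices,
  since \<open>w\<close> itself is left out.\<close>

lemma k_ge_l: "2 * l + 3 \<le> k + m"
proof -
  obtain y z where yz: "y \<in> X" "z \<in> X" "y \<noteq> z" "\<not> E y z" "\<not> E z y" using nonadj_ex .
  obtain w where w: "w \<in> X" "E y w" "E z w" "E w y" "E w z"
    using common_nb_ex[OF yz(1-4)] E_sym by metis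
  let ?A = "insert y (N w \<inter> N y)" and ?B = "insert z (N w \<inter> N z)"
  have "card ?A = l + 1" "card ?B = l + 1" using card_NN w yz E_irrefl by simp_all
  moreover have "card (?A \<inter> ?B) \<le> m - 1"
  proof -
    have "?A \<inter> ?B \<subseteq> (N y \<inter> N z) - {w}" using yz E_irrefl by auto
    then have "card (?A \<inter> ?B) \<le> card ((N y \<inter> N z) - {w})" by (rule card_mono[rotated]) simp
    then show ?thesis using card_M_srt[OF yz(1-4)] w by (simp add: card_Diff_singleton)
  qed
  moreover have "card (?A \<union> ?B) \<le> k"
    unfolding card_N[OF w(1), symmetric] using yz w by (intro card_mono) auto
  moreover have "card ?A + card ?B = card (?A \<union> ?B) + card (?A \<inter> ?B)"
    by (rule card_Un_Int) simp_all
  ultimately show ?thesis using m_pos by linarith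
qed

text \<open>
  With \<open>M = N y \<inter> N z\<close>, an average neighbour \<open>q\<close> of \<open>y\<close> outside \<open>M\<close> is adjacent to fewer than half of
  \<open>M\<close>, so the cliques \<open>M\<close> and \<open>N q \<inter> N z\<close> have a large union inside \<open>N z\<close>.
\<close>

lemma k_ge_m: "2 * m \<le> k"
proof -
  obtain y z where yz: "y \<in> X" "z \<in> X" "y \<noteq> z" "\<not> E y z" "\<not> E z y" using nonadj_ex .
  define M where "M = N y \<inter> N z"
  define U where "U = N y - M"
  have M: "card M = m" "finite M" unfolding M_def using card_M_srt yz by simp_all
  have Madj: "E p q" if "p \<in> M" "q \<in> M" "p \<noteq> q" for p q
    using clique_M[OF yz(1-4)] that unfolding M_def clique_def by blast
  have "M \<subseteq> N y" unfolding M_def by blast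
  then have U: "card U + m = k" "finite U"
    unfolding U_def using card_N[OF yz(1)] M card_mono[OF finN \<open>M \<subseteq> N y\<close>]
    by (simp_all add: card_Diff_subset)
  have cu: "card {q \<in> U. E q u} + m = l + 1" if u: "u \<in> M" for u
  proof -
    have uX: "u \<in> X" "E y u" "E z u" using u by (auto simp: M_def)
    have **: "q \<in> X" "E q u" "E y q" if "q \<in> N y \<inter> N u" for q using that E_sym by auto
    have "N y \<inter> N u = {q \<in> U. E q u} \<union> (M - {u})"
    proof
      show "N y \<inter> N u \<subseteq> {q \<in> U. E q u} \<union> (M - {u})"
      proof
        fix q assume q: "q \<in> N y \<inter> N u"
        show "q \<in> {q \<in> U. E q u} \<union> (M - {u})"
          using **[OF q] q E_irrefl unfolding U_def by blast
      qed
      show "{q \<in> U. E q u} \<union> (M - {u}) \<subseteq> N y \<inter> N u"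
      proof
        fix q assume "q \<in> {q \<in> U. E q u} \<union> (M - {u})"
        then have "q \<in> N y" "E u q" using Madj[OF u, of q] E_sym unfolding U_def M_def by blast+
        then show "q \<in> N y \<inter> N u" by simp
      qed
    qed
    moreover have "{q \<in> U. E q u} \<inter> (M - {u}) = {}" by (auto simp: U_def)
    ultimately have "card (N y \<inter> N u) = card {q \<in> U. E q u} + (m - 1)"
      using u M U(2) by (simp add: card_Un_disjoint)
    then show ?thesis using card_NN[of y u] yz uX m_pos by simp
  qed
  have lm: "m \<le> l + 1"
  proof -
    obtain u where "u \<in> M" using M m_pos by fastforce
    then show ?thesis using cu[of u] by simp
  qed
  \<comment> \<open>If every \<open>q\<close> in \<open>U\<close> saw at least half of
    \<open>M\<close>, double counting would give \<open>card U \<le> 2 * (l + 1 - m)\<close>,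
    against \<open>k_ge_l\<close>.\<close>
  have "\<exists>q\<in>U. 2 * card {u \<in> M. E q u} < m"
  proof (rule ccontr)
    assume "\<not> ?thesis"
    then have "m \<le> 2 * card {u \<in> M. E q u}" if "q \<in> U" for q using that by force
    then have "(\<Sum>q\<in>U. m) \<le> (\<Sum>q\<in>U. 2 * card {u \<in> M. E q u})" by (rule sum_mono)
    also have "\<dots> = 2 * (\<Sum>u\<in>M. card {q \<in> U. E q u})"
      unfolding sum_distrib_left[symmetric] using sum_card_swap[OF U(2) M(2), of E] by simp
    also have "(\<Sum>u\<in>M. card {q \<in> U. E q u}) = (\<Sum>u\<in>M. l + 1 - m)"
      using cu by (intro sum.cong refl) (metis add_diff_cancel_right')
    finally have "m * card U \<le> m * (2 * (l + 1 - m))" using M by (simp add: algebra_simps)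
    then have "card U \<le> 2 * (l + 1 - m)" using m_pos by simp
    then show False using k_ge_l lm U by linarith
  qed
  then obtain q where q: "q \<in> U" and W: "2 * card {u \<in> M. E q u} < m" by blast
  define W where "W = {u \<in> M. E q u}"
  have q': "q \<in> X" "E y q" using q by (auto simp: U_def)
  have qz: "q \<noteq> z" "\<not> E q z" using q yz q' E_sym by (auto simp: U_def M_def)
  let ?Q = "N q \<inter> N z"
  have Q: "card ?Q = m" using card_M_srt qz q' yz by blast
  have MQ: "M \<inter> ?Q = W" by (auto simp: M_def W_def)
  have un: "card (M \<union> ?Q) + card W = 2 * m" using card_Un_Int[of M ?Q] M Q MQ by simp
  show ?thesis
  proof (cases "W = {}")
    case True
    have "card (M \<union> ?Q) \<le> k"
      unfolding card_N[OF yz(2), symmetric] by (intro card_mono) (auto simp: M_def)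
    then show ?thesis using un True by simp
  next
    case False
    then obtain w where w: "w \<in> W" by blast
    have w': "w \<in> M" "E q w" using w by (auto simp: W_def)
    then have wX: "w \<in> X" "E z w" by (auto simp: M_def)
    \<comment> \<open>Both cliques contain \<open>w\<close>, so the rest of their union consists of
      common neighbours of \<open>z\<close> and \<open>w\<close>.\<close>
    have "M \<union> ?Q - {w} \<subseteq> N z \<inter> N w"
    proof
      fix r assume r: "r \<in> M \<union> ?Q - {w}"
      then have rX: "r \<in> X" "E z r" by (auto simp: M_def)
      have "E w r"
      proof (cases "r \<in> M")
        case True then show ?thesis using Madj[of w r] w' r by blast
      next
        case False
        then show ?thesis using M_adj[of q z w r] r rX q' yz qz wX w' by auto
      qed
      then show "r \<in> N z \<inter> N w" using rX by simp
    qed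
    then have "card (M \<union> ?Q - {w}) \<le> l"
      using card_NN[of z w] wX yz card_mono[of "N z \<inter> N w"] by simp
    then have "card (M \<union> ?Q) \<le> l + 1" using w' by (simp add: card_Diff_singleton_if)
    then show ?thesis using un W k_ge_l unfolding W_def[symmetric] by linarith
  qed
qed

lemma vertex_ex: obtains x where "x \<in> X"
  using nonadj_ex by metis

text \<open>Allows a descent: the quotient of a local graph is again of the kind considered,
  \<open>l_less_k\<close> ensuring that the local graph is not complete.\<close>

lemma local_srt:
  assumes "2 \<le> m" "x \<in> X"
  obtains \<alpha> T v' k' l' m' where "0 < \<alpha>" "srt T v' k' l' m'"
    "k = \<alpha> * v'" "l + 1 = \<alpha> * (k' + 1)" "m = \<alpha> * m' + 1"
proof -
  interpret terwilliger_vertex E X k l m x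
    by unfold_locales (use assms l_less_k in auto)
  show ?thesis using local_structure that by blast
qed

text \<open>For the local quotient, \<open>v_ge\<close> and \<open>k_ge_m\<close> give
  \<open>v' \<ge> 3 * m' + 2\<close>; multiplication by \<open>\<alpha>\<close> translates this into
  \<open>k\<close> and \<open>m\<close>.\<close>

lemma k_ge_3m:
  assumes "2 \<le> m"
  shows "3 * m \<le> k + 1"
proof -
  obtain x where "x \<in> X" by (rule vertex_ex)
  obtain \<alpha> T v' k' l' m' where *: "0 < \<alpha>" "srt T v' k' l' m'"
    "k = \<alpha> * v'" "l + 1 = \<alpha> * (k' + 1)" "m = \<alpha> * m' + 1"
    using local_srt[OF assms \<open>x \<in> X\<close>] .
  interpret T: srt_graph E T v' k' l' m' by unfold_locales (rule *(2))
  have "3 * m' + 2 \<le> v'" using T.v_ge T.k_ge_m by simp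
  then have "\<alpha> * (3 * m' + 2) \<le> k" unfolding *(3) by (rule mult_le_mono2)
  then show ?thesis using *(1,5) by (simp add: algebra_simps)
qed

text \<open>For \<mu> = 1 every edge lies in a unique maximal clique, the line \<open>L y z\<close>
  with \<open>l + 2\<close> points. The neighbours of a point are partitioned by its
  \<open>r\<close> lines, and the second equation counts incident pairs of a point and one of the
  \<open>n\<close> lines.\<close>

lemma lines:
  assumes m1: "m = 1"
  obtains r n where "k = r * (l + 1)" "v * r = n * (l + 2)"
proof -
  define L where "L = (\<lambda>y z. insert y (insert z (N y \<inter> N z)))"
  define LL where "LL = {L y z | y z. y \<in> X \<and> z \<in> X \<and> E y z}"
  have cadj: "E p q" if "y \<in> X" "z \<in> X" "p \<in> X" "q \<in> X" "E y z"
    "E p y" "E p z" "E q y" "E q z" "p \<noteq> q" for y z p q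
  proof (rule ccontr)
    assume "\<not> E p q"
    then have "card (N p \<inter> N q) = 1" using card_M_srt that m1 by blast
    moreover have "{y, z} \<subseteq> N p \<inter> N q" using that by simp
    then have "card {y, z} \<le> card (N p \<inter> N q)" by (rule card_mono[rotated]) simp
    moreover have "y \<noteq> z" using that E_irrefl by blast
    ultimately show False by simp
  qed
  have Lcard: "card (L y z) = l + 2" if "y \<in> X" "z \<in> X" "E y z" for y z
  proof -
    have "y \<noteq> z" "z \<notin> N y \<inter> N z" "y \<notin> N y \<inter> N z" using that E_irrefl by auto
    then show ?thesis using card_NN[OF that] by (simp add: L_def)
  qed
  have LX: "L y z \<subseteq> X" if "y \<in> X" "z \<in> X" for y z using that by (auto simp: L_def)
  have Ladj: "E p q" if "y \<in> X" "z \<in> X" "E y z" "p \<in> L y z" "q \<in> L y z" "p \<noteq> q" for y z p q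
  proof -
    have "E z y" using that E_sym by blast
    have "E p y \<or> p = y" "E p z \<or> p = z" "E q y \<or> q = y" "E q z \<or> q = z"
      using that(3-5) \<open>E z y\<close> E_sym unfolding L_def by auto
    moreover have "p \<in> X" "q \<in> X" using that LX by blast+
    ultimately show ?thesis using cadj[of y z p q] that E_sym by blast
  qed
  have Leq: "L p q = L y z" if "y \<in> X" "z \<in> X" "E y z" "p \<in> L y z" "q \<in> L y z" "p \<noteq> q" for y z p q
  proof -
    have pq: "p \<in> X" "q \<in> X" "E p q" using Ladj[OF that] LX that by blast+
    have "L y z \<subseteq> L p q"
    proof
      fix r assume r: "r \<in> L y z"
      then have "r \<in> X" "r = p \<or> E p r" "r = q \<or> E q r"
        using LX Ladj[of y z p r] Ladj[of y z q r] that by blast+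
      then show "r \<in> L p q" by (auto simp: L_def)
    qed
    moreover have "finite (L p q)" by (simp add: L_def)
    ultimately show ?thesis using card_subset_eq[of "L p q" "L y z"] Lcard that pq by simp
  qed
  have finLL: "finite LL"
  proof -
    have "LL \<subseteq> (\<lambda>(y, z). L y z) ` (X \<times> X)" unfolding LL_def by auto
    then show ?thesis by (rule finite_subset) simp
  qed
  have LLcard: "card b = l + 2" "finite b" if "b \<in> LL" for b
    using that Lcard unfolding LL_def by (auto simp: L_def)
  have LLeq: "L p q = b" "E p q" "p \<in> X" "q \<in> X" if "b \<in> LL" "p \<in> b" "q \<in> b" "p \<noteq> q" for b p q
  proof -
    note b = that
    obtain y z where yz: "b = L y z" "y \<in> X" "z \<in> X" "E y z" using b(1) unfolding LL_def by blast
    show "L p q = b" using Leq[of y z p q] that yz by blast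
    show "E p q" using Ladj[of y z p q] that yz by blast
    show "p \<in> X" "q \<in> X" using LX[of y z] that yz by blast+
  qed
  have deg: "k = card {b \<in> LL. y \<in> b} * (l + 1)" if y: "y \<in> X" for y
  proof -
    have "N y = (\<Union>b\<in>{b \<in> LL. y \<in> b}. b - {y})"
    proof
      show "N y \<subseteq> (\<Union>b\<in>{b \<in> LL. y \<in> b}. b - {y})"
      proof
        fix z assume "z \<in> N y"
        then have "L y z \<in> LL" "y \<in> L y z" "z \<in> L y z - {y}"
          using y E_irrefl unfolding LL_def L_def by auto
        then show "z \<in> (\<Union>b\<in>{b \<in> LL. y \<in> b}. b - {y})" by blast
      qed
      show "(\<Union>b\<in>{b \<in> LL. y \<in> b}. b - {y}) \<subseteq> N y"
        using LLeq[of _ y] by fastforce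
    qed
    moreover have "card (\<Union>b\<in>{b \<in> LL. y \<in> b}. b - {y}) = (\<Sum>b\<in>{b \<in> LL. y \<in> b}. card (b - {y}))"
    proof (rule card_UN_disjoint)
      show "\<forall>i\<in>{b \<in> LL. y \<in> b}. \<forall>j\<in>{b \<in> LL. y \<in> b}. i \<noteq> j \<longrightarrow> (i - {y}) \<inter> (j - {y}) = {}"
      proof (intro ballI impI, rule ccontr)
        fix i j assume ij: "i \<in> {b \<in> LL. y \<in> b}" "j \<in> {b \<in> LL. y \<in> b}" "i \<noteq> j"
          "(i - {y}) \<inter> (j - {y}) \<noteq> {}"
        then obtain q where "q \<in> i" "q \<in> j" "y \<noteq> q" by blast
        then have "L y q = i" "L y q = j" using LLeq(1)[of _ y q] ij by blast+
        then show False using ij by simp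
      qed
    qed (use finLL LLcard in auto)
    moreover have "card (b - {y}) = l + 1" if "b \<in> {b \<in> LL. y \<in> b}" for b
      using that LLcard[of b] by simp
    ultimately show ?thesis using card_N[OF y] by simp
  qed
  obtain y0 where y0: "y0 \<in> X" by (rule vertex_ex)
  let ?r = "card {b \<in> LL. y0 \<in> b}"
  have r: "card {b \<in> LL. y \<in> b} = ?r" if "y \<in> X" for y
    using deg[OF that] deg[OF y0] by (metis add_is_0 mult_cancel2 one_neq_zero)
  have "(\<Sum>y\<in>X. card {b \<in> LL. y \<in> b}) = (\<Sum>b\<in>LL. card {y \<in> X. y \<in> b})"
    by (rule sum_card_swap) (simp_all add: finLL)
  moreover have "card {y \<in> X. y \<in> b} = l + 2" if "b \<in> LL" for b
  proof -
    have "b \<subseteq> X" using that LX unfolding LL_def by blast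
    then have "{y \<in> X. y \<in> b} = b" by blast
    then show ?thesis using LLcard that by simp
  qed
  ultimately have "v * ?r = card LL * (l + 2)" using r card_X by simp
  then show ?thesis using that deg[OF y0] by blast
qed

end

text \<open>The second assumption is the quadratic equation
  \<open>m c^2 - (2k + 2 + m) c + 2v = 0\<close> for \<open>c\<close>. After eliminating
  \<open>v\<close> by the edge count, its discriminant is
  \<open>(m - 2)^2 - 4k(k - 4 - 2l + m)\<close>, which must be a square.\<close>

lemma coclique_discriminant:
  fixes v k l m c :: int
  assumes "k * (k - 1 - l) = m * (v - 1 - k)" "2 * v + c * (c - 1) * m = 2 * c * (k + 1)"
  shows "4 * k * (k - 4 - 2 * l + m) \<le> (m - 2)\<^sup>2"
proof -
  have "4 * k * (k - 4 - 2 * l + m) = (m - 2)\<^sup>2 - (2 * m * c - (2 * k + 2 + m))\<^sup>2"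
    using assms by algebra
  then show ?thesis by simp
qed

text \<open>\<open>v1, k1, l1, m1\<close> belong to the quotient of a local graph of the graph with
  parameters \<open>v, k, l, m\<close>. Since \<open>k - 4 - 2l + m = \<alpha> e - 1\<close>, the
  discriminant condition \<open>I\<close> keeps the slack \<open>e\<close> small, whereas the edge
  count \<open>II\<close> of the quotient makes it large.\<close>

lemma no_larger_mu:
  fixes \<alpha> v k l m c v1 k1 l1 m1 :: int
  assumes pos: "1 \<le> \<alpha>" "1 \<le> m1"
    and lift: "k = \<alpha> * v1" "l + 1 = \<alpha> * (k1 + 1)" "m = \<alpha> * m1 + 1"
    and E1: "k * (k - 1 - l) = m * (v - 1 - k)"
    and eq: "2 * v + c * (c - 1) * m = 2 * c * (k + 1)"
    and E2: "k1 * (k1 - 1 - l1) = m1 * (v1 - 1 - k1)"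
    and v1: "2 * (k1 + 1) \<le> v1 + m1" and l1: "2 * l1 + 3 \<le> k1 + m1"
    and k1: "2 * m1 \<le> k1" and k1': "2 \<le> m1 \<Longrightarrow> 3 * m1 \<le> k1 + 1"
  shows False
proof -
  define e where "e = v1 - 2 * (k1 + 1) + m1"
  define n where "n = k1 + 1 - m1"
  have e0: "0 \<le> e" using v1 by (simp add: e_def)
  have v1e: "v1 = 2 * (k1 + 1) - m1 + e" by (simp add: e_def)
  have "k - 4 - 2 * l + m = \<alpha> * e - 1"
    using lift unfolding e_def by (simp add: algebra_simps)
  moreover have "m - 2 = \<alpha> * m1 - 1" using lift by simp
  ultimately have I: "4 * (\<alpha> * v1) * (\<alpha> * e - 1) \<le> (\<alpha> * m1 - 1)\<^sup>2"
    using coclique_discriminant[OF E1 eq] lift(1) by simp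
  have E2': "k1 * (k1 - 1 - l1) = m1 * (n + e)" using E2 by (simp add: e_def n_def algebra_simps)
  have II: "n * (k1 - 2 * m1) \<le> 2 * m1 * e"
  proof -
    have "k1 * n \<le> k1 * (2 * (k1 - 1 - l1))" using l1 k1 pos by (intro mult_left_mono) (auto simp: n_def)
    also have "\<dots> = 2 * (m1 * (n + e))" using E2' by (metis mult.left_commute)
    finally show ?thesis by (simp add: algebra_simps)
  qed
  \<comment> \<open>In the first case \<open>II\<close> gives \<open>e \<ge> m1 - 1\<close>, and the
    left side of \<open>I\<close> becomes at least \<open>5 (\<alpha> m1)^2\<close>. What escapes
    this estimate is \<open>\<alpha> = 1, m1 = 2\<close> and \<open>m1 = 1\<close>.\<close>
  consider "2 \<le> m1" "2 \<le> \<alpha> * (m1 - 1)" | "2 \<le> m1" "\<alpha> * (m1 - 1) < 2" | "m1 = 1" using pos by linarith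
  then show False
  proof cases
    case 1
    have k: "3 * m1 \<le> k1 + 1" using k1' 1 by simp
    have "2 * m1 * (m1 - 1) \<le> n * (k1 - 2 * m1)"
      using k 1 by (intro mult_mono) (auto simp: n_def)
    then have "2 * m1 * (m1 - 1) \<le> 2 * m1 * e" using II by linarith
    then have "m1 - 1 \<le> e" using 1 by (simp only: mult_le_cancel_left_pos)
    then have ae: "\<alpha> * (m1 - 1) \<le> \<alpha> * e" using pos by (intro mult_left_mono) auto
    have a2: "\<alpha> * m1 \<le> 2 * (\<alpha> * (m1 - 1))"
    proof -
      have "\<alpha> * m1 \<le> \<alpha> * (2 * (m1 - 1))" using 1 pos by (intro mult_left_mono) auto
      then show ?thesis by (simp add: algebra_simps)
    qed
    have am: "0 < \<alpha> * m1" using pos by simp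
    have "5 * m1 \<le> v1" using v1e e0 k 1 by (simp add: algebra_simps)
    then have "\<alpha> * (5 * m1) \<le> \<alpha> * v1" using pos by (intro mult_left_mono) auto
    then have "5 * (\<alpha> * m1) \<le> \<alpha> * v1" by simp
    moreover have "\<alpha> * m1 \<le> 4 * (\<alpha> * e - 1)" using a2 ae 1 unfolding right_diff_distrib by linarith
    moreover have "5 * P * P \<le> V * Q" if "5 * P \<le> V" "P \<le> Q" "0 < P" for P V Q :: int
      using that by (intro mult_mono) auto
    ultimately have "5 * (\<alpha> * m1) * (\<alpha> * m1) \<le> \<alpha> * v1 * (4 * (\<alpha> * e - 1))"
      using am by blast
    then have "5 * (\<alpha> * m1)\<^sup>2 \<le> (\<alpha> * m1 - 1)\<^sup>2" using I by (simp add: power2_eq_square mult_ac)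
    moreover have "(\<alpha> * m1 - 1)\<^sup>2 \<le> (\<alpha> * m1)\<^sup>2" using am by (intro power_mono) (use am in linarith)+
    ultimately show False using zero_less_power[OF am, of 2] by linarith
  next
    case 2
    have "\<alpha> = 1" "m1 = 2"
    proof -
      have "1 * (m1 - 1) \<le> \<alpha> * (m1 - 1)" using pos 2 by (intro mult_right_mono) auto
      then have "m1 - 1 < 2" unfolding mult_1 using 2 by linarith
      then show "m1 = 2" using 2 by simp
      then show "\<alpha> = 1" using 2 pos by simp
    qed
    have k: "5 \<le> k1" using k1' \<open>m1 = 2\<close> by simp
    then have n4: "4 \<le> n" unfolding n_def \<open>m1 = 2\<close> by simp
    have "n * 1 \<le> n * (k1 - 4)" using k n4 by (intro mult_left_mono) auto
    moreover have II': "n * (k1 - 4) \<le> 4 * e" using II \<open>m1 = 2\<close> by simp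
    ultimately have "1 \<le> e" using n4 by linarith
    have "v1 * (e - 1) \<le> 0" using I \<open>\<alpha> = 1\<close> \<open>m1 = 2\<close> by simp
    moreover have "0 < v1" using v1 k \<open>m1 = 2\<close> by simp
    ultimately have "e = 1" using \<open>1 \<le> e\<close> by (simp add: mult_le_0_iff)
    have "k1 = 5"
    proof (rule ccontr)
      assume "k1 \<noteq> 5"
      then have "5 * 2 \<le> n * (k1 - 4)" using k unfolding n_def \<open>m1 = 2\<close> by (intro mult_mono) auto
      then show False using II' \<open>e = 1\<close> by linarith
    qed
    then have "k = 11" "l = 5" "m = 3" using lift v1e \<open>e = 1\<close> \<open>m1 = 2\<close> \<open>\<alpha> = 1\<close> by simp_all
    \<comment> \<open>\<open>E1\<close> now reads \<open>55 = 3 * (v - 12)\<close>.\<close>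
    then show False using E1 by simp presburger
  next
    case 3
    have n: "n = k1" using 3 by (simp add: n_def)
    have v5: "2 * k1 + 1 \<le> v1" "2 \<le> k1" using v1 k1 3 by simp_all
    show False
    proof (cases "e = 0")
      case True
      have "k1 * (k1 - 2) \<le> 0" using II n 3 True by simp
      then have "k1 = 2" using v5 by (simp add: mult_le_0_iff)
      then have "v1 = 5" using v1e True 3 by simp
      have p: "k = 5 * \<alpha>" "l = 3 * \<alpha> - 1" "m = \<alpha> + 1" using lift \<open>k1 = 2\<close> \<open>v1 = 5\<close> 3 by simp_all
      \<comment> \<open>The quotient has the parameters of a pentagon. \<open>E1\<close> reads
        \<open>10 \<alpha>^2 = (\<alpha> + 1)(v - 1 - 5 \<alpha>)\<close>, and
        \<open>10 \<alpha>^2\<close> is congruent to 10 modulo \<open>\<alpha> + 1\<close>.\<close>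
      have "10 = (\<alpha> + 1) * (v - 1 - 15 * \<alpha> + 10)"
        using E1 unfolding p by (simp add: algebra_simps power2_eq_square)
      then have "\<alpha> + 1 dvd 10" by (rule dvdI)
      then have "\<alpha> + 1 \<le> 10" by (simp add: zdvd_imp_le)
      then have "\<alpha> \<in> {1,2,3,4,5,6,7,8,9}" using pos by auto
      then have "\<alpha> = 1 \<or> \<alpha> = 4 \<or> \<alpha> = 9" using \<open>\<alpha> + 1 dvd 10\<close> by auto
      \<comment> \<open>The values 1, 4, 9 of \<open>\<alpha>\<close> lead to \<open>v\<close> = 11,
        53, 127. The equation for \<open>c\<close> has no integer root: for 1 and 9 by parity, for 4
        because its discriminant is 89.\<close>
      then show False
      proof (elim disjE)
        assume a: "\<alpha> = 1"
        then have "11 + c * (c - 1) = 6 * c" using E1 eq p by simp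
        moreover have "even (c * (c - 1))" by simp
        then obtain d where "c * (c - 1) = 2 * d" by (rule evenE)
        ultimately show False by presburger
      next
        assume a: "\<alpha> = 4"
        then have "106 + c * (c - 1) * 5 = 42 * c" using E1 eq p by simp
        then have "(10 * c - 47)\<^sup>2 = 89" by algebra
        have "\<bar>10 * c - 47\<bar> \<le> 9 \<or> 10 \<le> \<bar>10 * c - 47\<bar>" by linarith
        then show False
        proof
          assume "\<bar>10 * c - 47\<bar> \<le> 9"
          then have "\<bar>10 * c - 47\<bar>\<^sup>2 \<le> 9\<^sup>2" by (intro power_mono) auto
          then show False using \<open>(10 * c - 47)\<^sup>2 = 89\<close> by simp
        next
          assume "10 \<le> \<bar>10 * c - 47\<bar>"
          then have "10\<^sup>2 \<le> \<bar>10 * c - 47\<bar>\<^sup>2" by (intro power_mono) auto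
          then show False using \<open>(10 * c - 47)\<^sup>2 = 89\<close> by simp
        qed
      next
        assume a: "\<alpha> = 9"
        then have "127 + c * (c - 1) * 5 = 46 * c" using E1 eq p by simp
        moreover have "even (c * (c - 1))" by simp
        then obtain d where "c * (c - 1) = 2 * d" by (rule evenE)
        ultimately show False by presburger
      qed
    next
      case False
      then have e1: "1 \<le> e" using e0 by simp
      have "\<alpha> = 1"
      proof (rule ccontr)
        assume "\<alpha> \<noteq> 1"
        then have a: "2 \<le> \<alpha>" using pos by simp
        have ae: "\<alpha> * 1 \<le> \<alpha> * e" using pos e1 by (intro mult_left_mono) auto
        have "\<alpha> * 1 \<le> \<alpha> * v1" using pos v5 by (intro mult_left_mono) auto
        then have "4 * \<alpha> * (\<alpha> - 1) \<le> 4 * (\<alpha> * v1) * (\<alpha> * e - 1)"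
          by (intro mult_mono) (use ae a in linarith)+
        then have "4 * \<alpha> * (\<alpha> - 1) \<le> (\<alpha> - 1) * (\<alpha> - 1)" using I 3 by (simp add: power2_eq_square)
        then have "4 * \<alpha> \<le> \<alpha> - 1" using a by (simp add: mult_le_cancel_right)
        then show False using a by simp
      qed
      then have "v1 * (e - 1) \<le> 0" using I 3 by simp
      then have "e = 1" using v5 e1 by (simp add: mult_le_0_iff)
      have "k1 = 2"
      proof (rule ccontr)
        assume "k1 \<noteq> 2"
        then have "3 * 1 \<le> k1 * (k1 - 2)" using v5 by (intro mult_mono) auto
        then show False using II n 3 \<open>e = 1\<close> by simp
      qed
      then have "2 * (1 - l1) = 3" using E2' n 3 \<open>e = 1\<close> by simp
      then show False by presburger
    qed
  qed
qed

context srt_graph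
begin

text \<open>For \<open>m \<ge> 2\<close> a further descent leads to \<open>no_larger_mu\<close>. For
  \<open>m = 1\<close> the discriminant gives \<open>k \<le> 2 * l + 3\<close>, so that
  \<open>k = r * (l + 1)\<close> leaves only two or three lines on a point; divisibility settles the
  first case.\<close>

lemma parameters:
  assumes eq: "2 * int v + c * (c - 1) * int m = 2 * c * (int k + 1)"
  shows "m = 1 \<and> l = 0 \<and> (k = 2 \<and> v = 5 \<or> k = 3 \<and> v = 10)"
proof (cases "m = 1")
  case False
  then have m2: "2 \<le> m" using m_pos by simp
  obtain x where "x \<in> X" by (rule vertex_ex)
  obtain \<alpha> T v1 k1 l1 m1 where *: "0 < \<alpha>" "srt T v1 k1 l1 m1"
    "k = \<alpha> * v1" "l + 1 = \<alpha> * (k1 + 1)" "m = \<alpha> * m1 + 1"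
    using local_srt[OF m2 \<open>x \<in> X\<close>] .
  interpret T: srt_graph E T v1 k1 l1 m1 by unfold_locales (rule *(2))
  have False
  proof (rule no_larger_mu[of "int \<alpha>" "int m1" "int k" "int v1" "int l" "int k1" "int m" "int v" c "int l1"])
    show "1 \<le> int \<alpha>" using *(1) by simp
    show "1 \<le> int m1" using T.m_pos by simp
    show "int k = int \<alpha> * int v1" using *(3) by simp
    show "int l + 1 = int \<alpha> * (int k1 + 1)" using arg_cong[OF *(4), of int] by (simp add: algebra_simps)
    show "int m = int \<alpha> * int m1 + 1" using *(5) by simp
    show "2 * (int k1 + 1) \<le> int v1 + int m1" using T.v_ge by simp
    show "2 * int l1 + 3 \<le> int k1 + int m1" using T.k_ge_l by linarith
    show "2 * int m1 \<le> int k1" using T.k_ge_m by linarith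
    show "3 * int m1 \<le> int k1 + 1" if "2 \<le> int m1" using T.k_ge_3m that by linarith
  qed (rule edge_count eq T.edge_count)+
  then show ?thesis ..
next
  case True
  obtain r n where rn: "k = r * (l + 1)" "v * r = n * (l + 2)" using lines[OF True] .
  have E1: "int k * (int k - 1 - int l) = int v - 1 - int k" using edge_count True by simp
  have "4 * int k * (int k - 3 - 2 * int l) \<le> 1"
    using coclique_discriminant[OF edge_count eq] True by (simp add: algebra_simps)
  then have "int k * (int k - 3 - 2 * int l) \<le> 0" by linarith
  then have kl: "k \<le> 2 * l + 3" using l_less_k by (simp add: mult_le_0_iff)
  have "2 \<le> r"
  proof (rule ccontr)
    assume "\<not> 2 \<le> r"
    then have "r = 0 \<or> r = 1" by auto
    then show False using rn l_less_k by auto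
  qed
  moreover have "r \<le> 3"
  proof (rule ccontr)
    assume "\<not> r \<le> 3"
    then have "4 * (l + 1) \<le> k" unfolding rn(1) by (intro mult_le_mono1) simp
    then show False using kl by simp
  qed
  ultimately consider "r = 2" | "r = 3" by linarith
  then show ?thesis
  proof cases
    case 1
    have k: "k = 2 * (l + 1)" using rn 1 by simp
    have v: "int v = 1 + 2 * (int l + 1) + 2 * (int l + 1) * (int l + 1)"
      using E1 unfolding k by (simp add: algebra_simps)
    have "2 * int v = int n * (int l + 2)"
      using arg_cong[OF rn(2), of int] 1 by (simp add: algebra_simps)
    \<comment> \<open>\<open>2 * v\<close> is congruent to 2 modulo \<open>l + 2\<close>.\<close>
    then have "2 = (int l + 2) * (int n - 4 * (int l + 1))" unfolding v by (simp add: algebra_simps)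
    then have "int l + 2 dvd 2" by (metis dvd_triv_left)
    then have "l = 0" using zdvd_imp_le[of "int l + 2" 2] by linarith
    then show ?thesis using True k v by simp
  next
    case 2
    then have "l = 0" using rn kl by simp
    then have "k = 3" using rn 2 by simp
    then show ?thesis using True \<open>l = 0\<close> E1 by simp
  qed
qed

end

section \<open>Triviality of the clique extension\<close>

text \<open>\<open>eq\<close> is the equality in the bound with its denominator cleared.
  \<open>c\<close> is an integer so that the subtractions are exact.\<close>

locale coclique_equality = terwilliger_graph +
  fixes c :: int
  assumes m2: "2 \<le> m" and kl: "l + 1 < k"
    and eq: "2 * int k + c * (c - 1) * (int m - 1) = 2 * c * (int l + 1)"
begin

text \<open>\<open>k\<close>, \<open>l + 1\<close> and \<open>m - 1\<close> all carry the factor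
  \<open>\<alpha>\<close>, so cancelling it from \<open>eq\<close> gives the hypothesis of
  \<open>parameters\<close> for the quotient. As \<open>m' = 1\<close> results,
  \<open>\<alpha>\<close> is \<open>m - 1\<close>.\<close>

lemma local_params:
  assumes "x \<in> X"
  obtains T k' v' where "T \<subseteq> N x" "srt T v' k' 0 1" "k = (m - 1) * v'" "l + 1 = (m - 1) * (k' + 1)"
    "k' = 2 \<and> v' = 5 \<or> k' = 3 \<and> v' = 10" "\<forall>a\<in>N x. \<exists>t\<in>T. star X x a = star X x t"
proof -
  interpret V: terwilliger_vertex E X k l m x
    by unfold_locales (use assms m2 kl in auto)
  obtain \<alpha> T v' k' l' m' where *: "0 < \<alpha>" "T \<subseteq> N x" "srt T v' k' l' m'" "k = \<alpha> * v'"
    "l + 1 = \<alpha> * (k' + 1)" "m = \<alpha> * m' + 1" "\<forall>a\<in>N x. \<exists>t\<in>T. star X x a = star X x t"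
    using V.local_structure by blast
  interpret T: srt_graph E T v' k' l' m' by unfold_locales (rule *(3))
  have li: "int l + 1 = int \<alpha> * (int k' + 1)" using arg_cong[OF *(5), of int] by (simp add: algebra_simps)
  have mi: "int m - 1 = int \<alpha> * int m'" using *(6) by simp
  have "int \<alpha> * (2 * int v' + c * (c - 1) * int m') = int \<alpha> * (2 * c * (int k' + 1))"
    using eq unfolding li mi *(4) by (simp add: algebra_simps)
  then have "2 * int v' + c * (c - 1) * int m' = 2 * c * (int k' + 1)" using *(1) by simp
  then have p: "m' = 1 \<and> l' = 0 \<and> (k' = 2 \<and> v' = 5 \<or> k' = 3 \<and> v' = 10)" by (rule T.parameters)
  show ?thesis by (rule that[of T v' k']) (use * p in auto)
qed

lemma star_diff: "star X x a = (insert a (N a) \<inter> insert x (N x)) - {x}" if "a \<in> N x"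
  using that E_irrefl by (auto simp: star_def)

text \<open>For each edge the two closed neighbourhoods meet in \<open>l + 2\<close> vertices, and
  the last assumption puts the intersection for \<open>a d\<close> inside the one for
  \<open>a b\<close>. So two vertices of a triangle being twins in the local graph of the third is a
  property of the whole triangle.\<close>

lemma triple_eq:
  assumes "a \<in> X" "b \<in> X" "d \<in> X" "E a b" "E a d" "E b d"
    and "insert a (N a) \<inter> insert d (N d) = insert b (N b) \<inter> insert d (N d)"
  shows "insert a (N a) \<inter> insert b (N b) = insert a (N a) \<inter> insert d (N d)"
proof -
  have card: "card (insert p (N p) \<inter> insert q (N q)) = l + 2" if "p \<in> X" "q \<in> X" "E p q" for p q
  proof -
    have "insert p (N p) \<inter> insert q (N q) = insert p (insert q (N p \<inter> N q))"
      using that E_sym by auto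
    moreover have "p \<noteq> q" using that E_irrefl by blast
    ultimately show ?thesis using card_NN[OF that] E_irrefl by simp
  qed
  have "insert a (N a) \<inter> insert d (N d) \<subseteq> insert a (N a) \<inter> insert b (N b)"
    using assms(7) by blast
  then have "insert a (N a) \<inter> insert d (N d) = insert a (N a) \<inter> insert b (N b)"
    by (rule card_subset_eq[rotated]) (simp_all only: card[OF assms(1,3,5)] card[OF assms(1,2,4)] finite_Int finite_insert finN simp_thms)
  then show ?thesis ..
qed

text \<open>Representatives of three pairwise adjacent non-twins would form a triangle in
  \<open>T\<close>, which has none since its third parameter is 0.\<close>

lemma star_triangle:
  assumes y: "y \<in> X" and abd: "a \<in> N y" "b \<in> N y" "d \<in> N y" "E a b" "E a d" "E b d"
    and ne: "star X y a \<noteq> star X y b" "star X y a \<noteq> star X y d" "star X y b \<noteq> star X y d"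
  shows False
proof -
  obtain T k' v' where T: "T \<subseteq> N y" "srt T v' k' 0 1" "k = (m - 1) * v'" "l + 1 = (m - 1) * (k' + 1)"
    "k' = 2 \<and> v' = 5 \<or> k' = 3 \<and> v' = 10" "\<forall>a\<in>N y. \<exists>t\<in>T. star X y a = star X y t"
    using local_params[OF y] .
  interpret T: srt_graph E T v' k' 0 1 by unfold_locales (rule T(2))
  have adj: "E s t" if "p \<in> N y" "q \<in> N y" "E p q" "s \<in> T" "t \<in> T" "star X y p = star X y s"
    "star X y q = star X y t" "star X y p \<noteq> star X y q" for p q s t
  proof -
    have st: "s \<in> N y" "t \<in> N y" using that T(1) by auto
    have "q \<in> star X y p" unfolding star_def using that(2,3) by simp
    then have "q \<in> star X y s" using that(6) by simp
    then have "s \<in> star X y q" using st(1) that(2) E_sym unfolding star_def by auto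
    then have "s \<in> star X y t" using that by simp
    then have "s = t \<or> E t s" by (simp add: star_def)
    then show ?thesis using that E_sym by auto
  qed
  obtain s t u where stu: "s \<in> T" "t \<in> T" "u \<in> T" "star X y a = star X y s" "star X y b = star X y t"
    "star X y d = star X y u" using T(6) abd by meson
  have st: "E s t" by (rule adj[OF abd(1,2,4) stu(1,2,4,5) ne(1)])
  have su: "E s u" by (rule adj[OF abd(1,3,5) stu(1,3,4,6) ne(2)])
  have tu: "E t u" by (rule adj[OF abd(2,3,6) stu(2,3,5,6) ne(3)])
  have "u \<in> nb T s \<inter> nb T t" using su tu stu by simp
  then show False using T.card_NN[OF stu(1,2) st] by (metis T.finN card_0_eq empty_iff finite_Int)
qed

text \<open>If \<open>m - 1\<close>, the size of the twin classes, exceeds 1, some \<open>z\<close>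
  has a twin \<open>z'\<close> in the local graph of \<open>x\<close>; let \<open>y\<close> be a
  neighbour of both there that is not their twin. In the local graph of \<open>y\<close>, the
  triangle \<open>x, z, z'\<close> contains twins by \<open>star_triangle\<close>. Whichever pair it
  is, \<open>triple_eq\<close> makes \<open>y\<close> and \<open>z\<close> twins at
  \<open>x\<close>.\<close>

lemma m_eq_2:
  assumes x: "x \<in> X"
  shows "m = 2"
proof (rule ccontr)
  assume "m \<noteq> 2"
  then have m: "2 \<le> m - 1" using m2 by simp
  obtain T k' v' where T: "T \<subseteq> N x" "srt T v' k' 0 1" "k = (m - 1) * v'" "l + 1 = (m - 1) * (k' + 1)"
    "k' = 2 \<and> v' = 5 \<or> k' = 3 \<and> v' = 10" "\<forall>a\<in>N x. \<exists>t\<in>T. star X x a = star X x t"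
    using local_params[OF x] .
  interpret T: srt_graph E T v' k' 0 1 by unfold_locales (rule T(2))
  have "v' < k" using mult_le_mono1[OF m, of v'] T(3,5) by linarith
  then have "T \<noteq> N x" using T.card_X card_N[OF x] by auto
  then obtain z' where z': "z' \<in> N x" "z' \<notin> T" using T(1) by blast
  then obtain z where z: "z \<in> T" "star X x z' = star X x z" using T(6) by blast
  have zN: "z \<in> N x" using z T(1) by blast
  have self: "a \<in> star X x a" if "a \<in> N x" for a using that by (simp add: star_def)
  \<comment> \<open>The second neighbour \<open>w\<close> is a witness that \<open>y\<close> and
    \<open>z\<close> have different stars: otherwise \<open>y, z, w\<close> would be a triangle of
    \<open>T\<close>.\<close>
  have "2 \<le> card (T.N z)" using T.card_N[OF z(1)] T(5) by auto
  then obtain y w where yw: "y \<in> T.N z" "w \<in> T.N z" "y \<noteq> w"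
    by (metis card_le_Suc0_iff_eq not_less_eq_eq numeral_2_eq_2 T.finN)
  have y: "y \<in> T" "E z y" "y \<in> N x" "E y z" using yw T(1) E_sym by auto
  have ne: "star X x y \<noteq> star X x z"
  proof
    assume eq: "star X x y = star X x z"
    have "w \<in> star X x z" using yw T(1) by (auto simp: star_def)
    then have "w = y \<or> E y w" unfolding eq[symmetric] by (simp add: star_def)
    then have "w \<in> T.N z \<inter> T.N y" using yw by simp
    then show False using T.card_NN[OF z(1) y(1,2)] by (metis T.finN card_0_eq empty_iff finite_Int)
  qed
  have "z' \<noteq> y" using ne z by auto
  have "y \<in> star X x z" using y by (simp add: star_def)
  then have "y \<in> star X x z'" using z by simp
  then have z'y: "E z' y" using \<open>z' \<noteq> y\<close> by (simp add: star_def)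
  have "z' \<in> star X x z" using self[OF z'(1)] z by simp
  then have zz': "E z z'" using z z' by (auto simp: star_def)
  have X: "y \<in> X" "z \<in> X" "z' \<in> X" "E x y" "E x z" "E x z'" using y zN z' by auto
  have adj: "E y x" "E y z" "E y z'" "E z x" "E z' x" "E z' z" using X E_sym z'y zz' y by blast+
  let ?P = "\<lambda>a b. insert a (N a) \<inter> insert b (N b)"
  have P: "?P a d = ?P b d" if "star X d a = star X d b" "a \<in> N d" "b \<in> N d" "d \<in> X" for a b d
  proof -
    have "d \<in> insert a (N a)" if "a \<in> N d" for a using that \<open>d \<in> X\<close> E_sym by simp
    then have "?P a d = insert d (star X d a)" if "a \<in> N d" for a
      using star_diff[OF that] that by blast
    then show ?thesis using that by simp
  qed
  have A: "?P z x = ?P z' x" using P[of x z z'] z z' zN x by simp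
  then have A2: "?P z z' = ?P z x" using triple_eq[of z z' x] X x adj zz' by blast
  have main: "?P y x \<noteq> ?P z x" using ne star_diff y(3) zN by metis
  have N: "x \<in> N y" "z \<in> N y" "z' \<in> N y" using x X adj by auto
  consider "star X y x = star X y z" | "star X y x = star X y z'" | "star X y z = star X y z'"
    using star_triangle[of y x z z'] X N zz' by blast
  then show False
  proof cases
    case 1
    then have "?P x y = ?P z y" using P N X by blast
    then have "?P x z = ?P x y" using triple_eq[of x z y] x X adj z'y y by blast
    then show False using main by (simp add: Int_commute)
  next
    case 2
    then have "?P x y = ?P z' y" using P N X by blast
    then have "?P x z' = ?P x y" using triple_eq[of x z' y] x X adj z'y y by blast
    then show False using main A by (simp add: Int_commute)
  next
    case 3
    then have "?P z y = ?P z' y" using P N X by blast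
    then have "?P z z' = ?P z y" using triple_eq[of z z' y] x X adj zz' z'y y by blast
    then have "?P y z = ?P x z" using A2 by (simp add: Int_commute)
    then have "?P y x = ?P y z" using triple_eq[of y x z] x X adj by blast
    then show False using main \<open>?P y z = ?P x z\<close> by (simp add: Int_commute)
  qed
qed

text \<open>With \<open>m = 2\<close> the twin classes are singletons, so \<open>T\<close> is the
  whole local graph and inherits nothing but the two parameter sets.\<close>

lemma small_parameters:
  assumes x: "x \<in> X"
  shows "m = 2" "k = 5 \<and> l = 2 \<or> k = 10 \<and> l = 3"
    and "y \<in> N x \<Longrightarrow> z \<in> N x \<Longrightarrow> E y z \<Longrightarrow> N x \<inter> N y \<inter> N z = {}"
proof -
  show m: "m = 2" using m_eq_2[OF x] .
  obtain T k' v' where T: "T \<subseteq> N x" "srt T v' k' 0 1" "k = (m - 1) * v'" "l + 1 = (m - 1) * (k' + 1)"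
    "k' = 2 \<and> v' = 5 \<or> k' = 3 \<and> v' = 10" "\<forall>a\<in>N x. \<exists>t\<in>T. star X x a = star X x t"
    using local_params[OF x] .
  interpret T: srt_graph E T v' k' 0 1 by unfold_locales (rule T(2))
  show "k = 5 \<and> l = 2 \<or> k = 10 \<and> l = 3" using T(3-5) m by auto
  have "T = N x" using card_subset_eq[OF finN T(1)] T.card_X card_N[OF x] T(3) m by simp
  then have "N x \<inter> N y \<inter> N z = T.N y \<inter> T.N z" for y z by auto
  moreover have "T.N y \<inter> T.N z = {}" if "y \<in> N x" "z \<in> N x" "E y z"
  proof -
    have "card (T.N y \<inter> T.N z) = 0" using T.card_NN[of y z] that \<open>T = N x\<close> by simp
    then show ?thesis by (metis T.finN card_0_eq finite_Int)
  qed
  ultimately show "y \<in> N x \<Longrightarrow> z \<in> N x \<Longrightarrow> E y z \<Longrightarrow> N x \<inter> N y \<inter> N z = {}" by simp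
qed

end

section \<open>Layers of locally pentagon and locally Petersen graphs\<close>

context terwilliger_graph
begin

lemma finite_lay: "u \<in> X \<Longrightarrow> finite (lay u i)"
  using lay_sub finX finite_subset by blast

end

text \<open>The pentagon and the Petersen graph enter only as triangle-free graphs of degree
  \<open>l\<close> on \<open>k\<close> vertices in which nonadjacent vertices have one common
  neighbour; no isomorphism is constructed.\<close>

locale small_terwilliger = terwilliger_graph E X k l 2 for E :: "'a \<Rightarrow> 'a \<Rightarrow> bool" and X k l +
  assumes no_K4: "x \<in> X \<Longrightarrow> y \<in> X \<Longrightarrow> z \<in> X \<Longrightarrow> w \<in> X \<Longrightarrow>
      E x y \<Longrightarrow> E x z \<Longrightarrow> E x w \<Longrightarrow> E y z \<Longrightarrow> E y w \<Longrightarrow> E z w \<Longrightarrow> False"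
    and kl: "k = 5 \<and> l = 2 \<or> k = 10 \<and> l = 3"
begin

lemma pairD:
  assumes "N u \<inter> N w = {a, b}"
  shows "a \<in> X \<and> b \<in> X \<and> E u a \<and> E a u \<and> E u b \<and> E b u \<and> E w a \<and> E a w \<and> E w b \<and> E b w"
proof -
  have "a \<in> N u \<inter> N w" "b \<in> N u \<inter> N w" unfolding assms by simp_all
  then show ?thesis using E_sym by simp
qed

lemma pair_cases:
  assumes "N u \<inter> N w = {a, b}" "r \<in> X" "E u r" "E w r"
  shows "r = a \<or> r = b"
proof -
  have "r \<in> N u \<inter> N w" using assms(2-4) by simp
  then show ?thesis unfolding assms(1) by simp
qed

lemma M3:
  assumes "x \<in> X" "y \<in> X" "x \<noteq> y" "\<not> E x y" "p \<in> X" "q \<in> X" "r \<in> X"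
    "E x p" "E x q" "E x r" "E y p" "E y q" "E y r" "p \<noteq> q" "p \<noteq> r" "q \<noteq> r"
  shows False
proof -
  have "{p, q, r} \<subseteq> N x \<inter> N y" using assms by simp
  then have "card {p, q, r} \<le> card (N x \<inter> N y)" by (rule card_mono[rotated]) simp
  moreover have "card (N x \<inter> N y) = 2" using card_M assms by blast
  ultimately show False using assms by simp
qed

lemma common_pair:
  assumes "x \<in> X" "y \<in> X" "x \<noteq> y" "\<not> E x y" "p \<in> N x \<inter> N y"
  obtains q where "q \<in> N x \<inter> N y" "q \<noteq> p" "N x \<inter> N y = {p, q}" "E p q"
proof -
  have "card (N x \<inter> N y) = 2" using card_M[of x y p] assms by auto
  then obtain c d where cd: "N x \<inter> N y = {c, d}" "c \<noteq> d" by (auto simp: card_2_iff)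
  then have "p = c \<or> p = d" using assms(5) by (simp only: insert_iff empty_iff) simp
  then obtain q where q: "N x \<inter> N y = {p, q}" "q \<noteq> p" using cd by blast
  then have "q \<in> N x \<inter> N y" by blast
  moreover have "E p q" using M_adj[of x y p q] assms q(2) \<open>q \<in> _\<close> by (simp only: Int_iff mem_nb) blast
  ultimately show ?thesis using that q by blast
qed

lemma local_common:
  assumes "x \<in> X" "y \<in> N x" "z \<in> N x" "y \<noteq> z" "\<not> E y z"
  obtains w where "w \<in> N x" "E w y" "E w z" "N x \<inter> N y \<inter> N z = {w}"
proof -
  have "x \<in> N y \<inter> N z" using assms E_sym by auto
  then obtain w where w: "w \<in> N y \<inter> N z" "w \<noteq> x" "N y \<inter> N z = {x, w}" "E x w"
    using common_pair[of y z x] assms by auto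
  have "N x \<inter> N y \<inter> N z = N x \<inter> {x, w}" using w(3) by blast
  moreover have "w \<in> X" using w(1) by simp
  ultimately have "N x \<inter> N y \<inter> N z = {w}" using w(4) E_irrefl by auto
  then show ?thesis using that[of w] w E_sym by auto
qed

text \<open>By \<open>local_common\<close> the local graph has diameter at most 2, hence is
  connected.\<close>

lemma local_closed:
  assumes "x \<in> X" "Y \<subseteq> N x" "Y \<noteq> {}" "\<And>w. w \<in> Y \<Longrightarrow> N x \<inter> N w \<subseteq> Y"
  shows "Y = N x"
proof (rule subset_antisym[OF assms(2)], rule subsetI, rule ccontr)
  fix q assume q: "q \<in> N x" "q \<notin> Y"
  obtain w where w: "w \<in> Y" using assms(3) by blast
  then have wN: "w \<in> N x" using assms(2) by blast
  have wq: "w \<noteq> q" "\<not> E w q" using assms(4)[OF w] w q by auto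
  obtain r where r: "r \<in> N x" "E r w" "E r q"
    using local_common[OF assms(1) wN q(1) wq] .
  have "r \<in> N x \<inter> N w" using r E_sym by simp
  then have "r \<in> Y" using assms(4)[OF w] by blast
  moreover have "q \<in> N x \<inter> N r" using r q by simp
  ultimately show False using assms(4)[of r] q by blast
qed

lemma lay_2_pair:
  assumes "u \<in> X" "w \<in> lay u 2"
  obtains a b where "N u \<inter> N w = {a, b}" "a \<noteq> b" "E a b"
  using common_pair[of u w] assms lay_2[OF assms(1), of w] by (metis all_not_in_conv)

lemma lay_2_mem:
  assumes "u \<in> X" "w \<in> lay u 2"
  shows "w \<in> X" "w \<noteq> u" "\<not> E u w" "\<not> E w u"
  using assms lay_2 E_sym by blast+

lemma lay_2I: "u \<in> X \<Longrightarrow> w \<in> X \<Longrightarrow> w \<noteq> u \<Longrightarrow> \<not> E u w \<Longrightarrow> a \<in> N u \<Longrightarrow> E a w \<Longrightarrow> w \<in> lay u 2"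
  using lay_2 E_sym by fastforce

text \<open>Suppose the pairs \<open>{a, b}\<close> and \<open>{a', b'}\<close> of neighbours of
  \<open>w\<close> and \<open>t\<close> in \<open>N u\<close> are disjoint. All neighbours of
  \<open>a\<close> in \<open>N u\<close> but one, \<open>a2\<close>, turn out to be nonadjacent to
  \<open>a'\<close> and \<open>b'\<close>. So \<open>a2\<close> is the common neighbour of
  \<open>a\<close> with either of them in \<open>N u\<close>, and \<open>u, a', b', a2\<close> are
  pairwise adjacent.\<close>

lemma pentagon_center:
  assumes u: "u \<in> X" and w: "w \<in> lay u 2" and t: "t \<in> lay u 2" and wt: "E w t"
  obtains a where "a \<in> N u" "E a w" "E a t"
proof -
  note wm = lay_2_mem[OF u w] and tm = lay_2_mem[OF u t]
  obtain a b where ab: "N u \<inter> N w = {a, b}" "a \<noteq> b" "E a b" using lay_2_pair[OF u w] .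
  obtain a' b' where ab': "N u \<inter> N t = {a', b'}" "a' \<noteq> b'" "E a' b'" using lay_2_pair[OF u t] .
  have am: "a \<in> X" "b \<in> X" "E u a" "E u b" "E a u" "E b u" "E w a" "E w b" "E a w" "E b w" "E b a"
    using pairD[OF ab(1)] E_sym[OF ab(3)] by simp_all
  have am': "a' \<in> X" "b' \<in> X" "E u a'" "E u b'" "E a' u" "E b' u" "E t a'" "E t b'" "E a' t" "E b' t"
    using pairD[OF ab'(1)] by simp_all
  show ?thesis
  proof (rule ccontr)
    assume no: "\<not> thesis"
    have ta: "\<not> E t a" "\<not> E t b" "\<not> E a t" "\<not> E b t" using that[of a] that[of b] am no E_sym by auto
    have aw': "\<not> E a' w" "\<not> E b' w" "\<not> E w a'" "\<not> E w b'"
      using that[of a'] that[of b'] am' no E_sym by auto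
    have tne: "t \<noteq> a" "t \<noteq> b" using tm am by auto
    \<comment> \<open>Otherwise \<open>q\<close> and \<open>t\<close> would be common neighbours of
      the nonadjacent \<open>p\<close> and \<open>w'\<close>, hence adjacent. Besides
      \<open>w\<close>, also the vertex \<open>s\<close> below takes the place of
      \<open>w'\<close>.\<close>
    have far: "\<not> E p q" if p: "p \<in> N u" "E p t" "\<not> E p w'" and q: "q \<in> N u" "E q w'" "\<not> E q t"
      and w': "w' \<in> X" "E w' t" "p \<noteq> w'" for p q w'
    proof
      assume "E p q"
      moreover have "q \<noteq> t" using q tm by auto
      ultimately have "E q t" using M_adj[of p w' q t] that tm E_sym by auto
      then show False using q by simp
    qed
    have ne: "a' \<noteq> w" "b' \<noteq> w" using wm am' by auto
    have fa: "\<not> E a' a" "\<not> E a' b" "\<not> E b' a" "\<not> E b' b"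
      using far[of a' w a] far[of a' w b] far[of b' w a] far[of b' w b] am am' aw' ta wm wt ne by auto
    have ne2: "a' \<noteq> a" "b' \<noteq> a" "a' \<noteq> b" "b' \<noteq> b" using am am' ta by auto
    obtain S where S: "S \<subseteq> N u \<inter> N a" "b \<in> S" "card S + 1 = l"
      "\<And>q. q \<in> S \<Longrightarrow> \<not> E a' q \<and> \<not> E b' q"
    proof (cases "l = 2")
      case True
      then show ?thesis using that[of "{b}"] am fa ab by auto
    next
      case False
      then have l3: "l = 3" using kl by simp
      \<comment> \<open>\<open>S\<close> needs a second vertex besides \<open>b\<close>. It is the
        other common neighbour \<open>a1\<close> of \<open>u\<close> and \<open>s\<close>, where
        \<open>s\<close> links \<open>t\<close> and \<open>a\<close> in the local graph of
        \<open>w\<close>.\<close>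
      obtain s where s: "s \<in> N w" "E s t" "E s a"
        using local_common[of w t a] wm tm am wt ta tne by auto
      have sX: "s \<in> X" "E w s" "E a s" "E t s" "E s w" using s E_sym by auto
      have "\<not> E u s"
      proof
        assume "E u s"
        then have "s \<in> N u \<inter> N w" using sX by simp
        then have "s = b" using ab s E_irrefl by auto
        then show False using s ta E_sym by blast
      qed
      moreover have "s \<noteq> u" using wm sX E_sym by blast
      ultimately obtain a1 where a1: "a1 \<in> N u \<inter> N s" "a1 \<noteq> a" "N u \<inter> N s = {a, a1}" "E a a1"
        using common_pair[of u s a] u sX am s by auto
      have a1m: "a1 \<in> X" "E u a1" "E s a1" "E a1 s" using a1 E_sym by auto
      have "a1 \<noteq> b"
        using no_K4[of w a b s] wm am sX ab a1m E_sym by blast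
      then have a1w: "\<not> E a1 w" "\<not> E w a1" using ab a1 a1m E_sym by auto
      have st: "s \<noteq> t" "s \<noteq> a" using s E_irrefl by auto
      have "a1 \<noteq> w" using a1m wm by auto
      have "\<not> E a1 t"
        using M3[of a1 w a s t] a1m wm a1w am sX tm wt a1 st tne E_sym \<open>a1 \<noteq> w\<close> by blast
      have s': "\<not> E a' s" "\<not> E b' s"
        using pair_cases[OF a1(3), of a'] pair_cases[OF a1(3), of b'] am' ne2 \<open>\<not> E a1 t\<close>
          E_commute[of s] by auto
      have "a' \<noteq> s" "b' \<noteq> s" using sX aw' by auto
      then have "\<not> E a' a1" "\<not> E b' a1"
        using far[of a' s a1] far[of b' s a1] am' a1m s' \<open>\<not> E a1 t\<close> sX s by auto
      moreover have "{b, a1} \<subseteq> N u \<inter> N a" "card {b, a1} + 1 = l"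
        using am ab(3) a1m a1(4) \<open>a1 \<noteq> b\<close> l3 by auto
      ultimately show ?thesis using that[of "{b, a1}"] fa by blast
    qed
    obtain a2 where a2: "N u \<inter> N a = insert a2 S" "a2 \<notin> S"
    proof -
      have "finite S" using S(1) by (rule finite_subset) simp
      have "card (N u \<inter> N a - S) = 1"
        using S card_NN[OF u am(1,3)] \<open>finite S\<close> by (simp add: card_Diff_subset)
      then obtain r where "N u \<inter> N a - S = {r}" by (auto simp: card_1_singleton_iff)
      then show ?thesis using that[of r] S(1) by blast
    qed
    have "E q a2" if q: "q \<in> N u" "q \<noteq> a" "\<not> E q a" "\<And>r. r \<in> S \<Longrightarrow> \<not> E q r" for q
    proof -
      obtain r where r: "r \<in> N u" "E r q" "E r a"
        using local_common[OF u q(1) _ q(2,3)] am by (metis mem_nb)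
      then have "r \<in> N u \<inter> N a" using E_sym by auto
      then have "r = a2" using a2 q(4) r E_sym by auto
      then show ?thesis using r E_sym by blast
    qed
    then have "E a' a2" "E b' a2" using am' fa ne2 S(4) by auto
    moreover have "a2 \<in> X" "E u a2" using a2 by auto
    ultimately show False using no_K4[of u a' b' a2] u am' ab' by auto
  qed
qed

text \<open>By \<open>pentagon_center\<close>, a neighbour of \<open>w\<close> in the second layer
  shares with \<open>w\<close> a neighbour in \<open>N u\<close>, which can only be \<open>a\<close>
  or \<open>b\<close>.\<close>

lemma lay_2_nb:
  assumes u: "u \<in> X" and w: "w \<in> lay u 2" and ab: "N u \<inter> N w = {a, b}" and t: "t \<in> N w"
  shows "t \<in> lay u 3 \<longleftrightarrow> \<not> E t a \<and> \<not> E t b"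
proof
  have am: "a \<in> N u" "b \<in> N u" using ab by blast+
  show "t \<in> lay u 3 \<Longrightarrow> \<not> E t a \<and> \<not> E t b"
    using lay_3D[OF u, of t] am by auto
  assume no: "\<not> E t a \<and> \<not> E t b"
  have tm: "t \<in> X" "E w t" using t by auto
  have abD: "a \<in> X" "b \<in> X" "E u a" "E w a" "E u b" "E w b" using pairD[OF ab] by simp_all
  have "E a b \<or> a = b" using M_adj[of u w a b] abD lay_2_mem[OF u w] u by blast
  have nu: "\<not> E u t"
  proof
    assume "E u t"
    then have "t = a \<or> t = b" using pair_cases[OF ab] tm by blast
    moreover have "a \<noteq> b"
      using common_pair[of u w a] ab u lay_2_mem[OF u w] by (metis insertI1 insert_absorb2 insertCI singletonD)
    ultimately show False using no \<open>E a b \<or> a = b\<close> E_sym by blast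
  qed
  have "t \<noteq> u" using tm lay_2_mem[OF u w] by auto
  have "t \<notin> lay u 2"
  proof
    assume "t \<in> lay u 2"
    then obtain c where "c \<in> N u" "E c w" "E c t" using pentagon_center[OF u w _ tm(2)] by blast
    then show False using pair_cases[OF ab, of c] no E_commute by auto
  qed
  then have "N u \<inter> N t = {}" using lay_2[OF u] tm nu \<open>t \<noteq> u\<close> by auto
  then show "t \<in> lay u 3" using lay_3I[OF u w t nu] by simp
qed

text \<open>By \<open>lay_2_nb\<close>, \<open>N w\<close> loses the neighbours of \<open>a\<close>
  and those of \<open>b\<close>, \<open>l\<close> each; by \<open>no_K4\<close> none is counted
  twice.\<close>

lemma card_b2:
  assumes u: "u \<in> X" and w: "w \<in> lay u 2"
  shows "card (N w \<inter> lay u 3) = k - 2 * l"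
proof -
  obtain a b where ab: "N u \<inter> N w = {a, b}" "a \<noteq> b" "E a b" using lay_2_pair[OF u w] .
  have am: "a \<in> X" "b \<in> X" "E w a" "E w b" using pairD[OF ab(1)] by simp_all
  note wm = lay_2_mem[OF u w]
  have "N w \<inter> lay u 3 = N w - ((N w \<inter> N a) \<union> (N w \<inter> N b))"
    using lay_2_nb[OF u w ab(1)] E_commute by auto
  moreover have "(N w \<inter> N a) \<inter> (N w \<inter> N b) = {}"
    using no_K4[of w a b] wm am ab by auto
  then have "card ((N w \<inter> N a) \<union> (N w \<inter> N b)) = 2 * l"
    using card_NN[of w a] card_NN[of w b] wm am by (simp add: card_Un_disjoint)
  moreover have "card (N w - ((N w \<inter> N a) \<union> (N w \<inter> N b)))
      = card (N w) - card ((N w \<inter> N a) \<union> (N w \<inter> N b))"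
    by (rule card_Diff_subset) auto
  ultimately show ?thesis using card_N[of w] wm by simp
qed

definition Y where "Y u z = N z \<inter> lay u 2"

lemma mem_Y: "u \<in> X \<Longrightarrow> w \<in> Y u z \<longleftrightarrow> w \<in> lay u 2 \<and> E z w"
  using lay_sub by (auto simp: Y_def)

text \<open>By \<open>lay_2_nb\<close> a neighbour of \<open>w\<close> in the second layer is
  adjacent to \<open>a\<close> or \<open>b\<close>, and in the local graph of \<open>w\<close> each
  of these has exactly one common neighbour with \<open>z\<close>. Thus the two neighbours of
  \<open>w\<close> on the cycle are attached to \<open>a\<close> and \<open>b\<close>.\<close>

lemma Y_nb:
  assumes u: "u \<in> X" and z: "z \<in> lay u 3" and w: "w \<in> Y u z" and ab: "N u \<inter> N w = {a, b}" "a \<noteq> b"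
  obtains s t where "s \<noteq> t" "s \<in> Y u z" "t \<in> Y u z" "E w s" "E w t" "Y u z \<inter> N w = {s, t}"
    "N w \<inter> N z \<inter> N a = {s}" "N w \<inter> N z \<inter> N b = {t}"
proof -
  note zm = lay_3D[OF u z]
  have wl: "w \<in> lay u 2" "E z w" using w mem_Y u by auto
  note wm = lay_2_mem[OF u wl(1)]
  have am: "a \<in> N w" "b \<in> N w" "a \<in> N u" "b \<in> N u" using ab by blast+
  have zw: "z \<in> N w" using zm wl E_sym by simp
  have za: "\<not> E z a" "\<not> E z b" "z \<noteq> a" "z \<noteq> b" using zm am by auto
  obtain s where s: "s \<in> N w" "E s z" "E s a" "N w \<inter> N z \<inter> N a = {s}"
    using local_common[OF wm(1) zw am(1)] za by blast
  obtain t where t: "t \<in> N w" "E t z" "E t b" "N w \<inter> N z \<inter> N b = {t}"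
    using local_common[OF wm(1) zw am(2)] za by blast
  have "E a b" using M_adj[of u w a b] u wm am ab(2) E_sym by simp
  have "s \<noteq> t" using no_K4[of w a b s] wm am s t \<open>E a b\<close> E_sym by auto
  have lay: "r \<in> lay u 2" if "r \<in> N w" "E r z" "E r c" "c \<in> N u" for r c
  proof (rule lay_2I[OF u _ _ _ that(4)])
    show "r \<in> X" using that by simp
    show "r \<noteq> u" using wm that by auto
    show "\<not> E u r" using zm(4) that E_sym by auto
    show "E c r" using that E_sym by blast
  qed
  have sl: "s \<in> lay u 2" "t \<in> lay u 2" using lay s t am by blast+
  have "Y u z \<inter> N w \<subseteq> {s, t}"
  proof
    fix r assume "r \<in> Y u z \<inter> N w"
    then have r: "r \<in> N w" "r \<in> N z" "r \<in> lay u 2" using mem_Y[OF u] by auto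
    then have "r \<notin> lay u 3" using lay_disjoint[of r u 2 3] by auto
    then have "E r a \<or> E r b" using lay_2_nb[OF u wl(1) ab(1) r(1)] by blast
    then show "r \<in> {s, t}" using s(4) t(4) r E_sym by auto
  qed
  moreover have "{s, t} \<subseteq> Y u z \<inter> N w" using sl s t mem_Y[OF u] E_sym by auto
  ultimately have "Y u z \<inter> N w = {s, t}" by (rule subset_antisym)
  then show ?thesis using that[of s t] \<open>s \<noteq> t\<close> sl s t mem_Y[OF u] E_sym by auto
qed

lemma card_Y_nb:
  assumes "u \<in> X" "z \<in> lay u 3" "w \<in> Y u z"
  shows "card (Y u z \<inter> N w) = 2"
proof -
  have "w \<in> lay u 2" using assms mem_Y by blast
  then obtain a b where "N u \<inter> N w = {a, b}" "a \<noteq> b" "E a b" using lay_2_pair[OF assms(1)] by blast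
  then show ?thesis using Y_nb[OF assms] by (metis card_2_iff)
qed

lemma Y_nonempty:
  assumes "u \<in> X" "z \<in> lay u 3"
  shows "Y u z \<noteq> {}"
proof -
  have "z \<in> lay u (Suc 2)" using assms by simp
  then obtain w where "w \<in> lay u 2" "E w z" by (rule lay_pred)
  then show ?thesis using mem_Y[OF assms(1)] E_sym by blast
qed

text \<open>All degrees in the local graph are 2 already, so \<open>Y u z\<close> is closed under
  adjacency there.\<close>

lemma icosahedron_Y:
  assumes "k = 5" "u \<in> X" "z \<in> lay u 3"
  shows "Y u z = N z"
proof (rule local_closed)
  note zm = lay_3D[OF assms(2,3)]
  show "z \<in> X" using zm by simp
  show "Y u z \<subseteq> N z" by (simp add: Y_def)
  show "Y u z \<noteq> {}" using Y_nonempty assms by blast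
  fix w assume w: "w \<in> Y u z"
  then have "w \<in> X" "E z w" using mem_Y lay_sub assms by blast+
  then have "card (N z \<inter> N w) = 2" using card_NN[of z w] zm kl assms by simp
  moreover have "Y u z \<inter> N w \<subseteq> N z \<inter> N w" by (auto simp: Y_def)
  ultimately have "Y u z \<inter> N w = N z \<inter> N w"
    using card_subset_eq[of "N z \<inter> N w" "Y u z \<inter> N w"] card_Y_nb[OF assms(2,3) w] by simp
  then show "N z \<inter> N w \<subseteq> Y u z" by blast
qed

end

section \<open>Induced 2-regular subgraphs of the Petersen graph\<close>

context small_terwilliger
begin

context
  fixes z Q
  assumes petersen: "k = 10" and z: "z \<in> X" and Q: "Q \<subseteq> N z" "Q \<noteq> {}"
    and reg: "\<And>w. w \<in> Q \<Longrightarrow> card (Q \<inter> N w) = 2"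
begin

lemma l3: "l = 3" using kl petersen by simp

lemma finQ [simp]: "finite Q" using Q(1) by (rule finite_subset) simp

lemma degree_3: "h \<in> N z \<Longrightarrow> card (N z \<inter> N h) = 3"
  using card_NN[OF z] l3 by simp

lemma card_Q_nb_le: "h \<in> N z \<Longrightarrow> card (Q \<inter> N h) \<le> 3"
  using card_mono[of "N z \<inter> N h" "Q \<inter> N h"] Q(1) degree_3 by fastforce

lemma three_le_card: "3 \<le> card Q"
proof -
  obtain w where w: "w \<in> Q" using Q(2) by blast
  have "card (insert w (Q \<inter> N w)) = 3" using reg[OF w] E_irrefl by simp
  moreover have "insert w (Q \<inter> N w) \<subseteq> Q" using w by blast
  ultimately show ?thesis using card_mono[of Q "insert w (Q \<inter> N w)"] by simp
qed

text \<open>A vertex of \<open>Q\<close> has degree 3 in \<open>N z\<close> and two neighbours in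
  \<open>Q\<close>, hence one outside.\<close>

lemma sum_outer: "(\<Sum>r\<in>N z - Q. card (Q \<inter> N r)) = card Q"
proof -
  have 1: "Q \<inter> N r = {q \<in> Q. E r q}" for r using Q(1) by auto
  have "(\<Sum>r\<in>N z - Q. card (Q \<inter> N r)) = (\<Sum>q\<in>Q. card {r \<in> N z - Q. E r q})"
    unfolding 1 by (rule sum_card_swap) simp_all
  also have "\<dots> = (\<Sum>q\<in>Q. 1)"
  proof (rule sum.cong[OF refl])
    fix q assume q: "q \<in> Q"
    have "N z \<inter> N q = (Q \<inter> N q) \<union> {r \<in> N z - Q. E r q}" using Q(1) E_commute by auto
    moreover have "(Q \<inter> N q) \<inter> {r \<in> N z - Q. E r q} = {}" by blast
    ultimately have "card (N z \<inter> N q) = card (Q \<inter> N q) + card {r \<in> N z - Q. E r q}"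
      by (simp add: card_Un_disjoint)
    moreover have "card (N z \<inter> N q) = 3" using degree_3 q Q(1) by blast
    ultimately show "card {r \<in> N z - Q. E r q} = 1" using reg[OF q] by simp
  qed
  finally show ?thesis by simp
qed

text \<open>Ordered nonadjacent pairs in \<open>Q\<close>, sorted by their unique common neighbour
  \<open>h\<close> in \<open>N z\<close>. An \<open>h\<close> in \<open>Q\<close> accounts for the
  two orderings of its neighbours in \<open>Q\<close>, whence the term
  \<open>2 * card Q\<close>.\<close>

lemma sum_outer_pairs:
  "(\<Sum>r\<in>N z - Q. card (Q \<inter> N r) * (card (Q \<inter> N r) - 1)) + 2 * card Q = card Q * (card Q - 3)"
proof -
  define B where "B = (SIGMA p:Q. Q - {p} - N p)"
  have cB: "card B = card Q * (card Q - 3)"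
  proof -
    have "card (Q - {p} - N p) = card Q - 3" if p: "p \<in> Q" for p
    proof -
      have "Q - {p} - N p = Q - insert p (Q \<inter> N p)" by blast
      moreover have "card (Q - insert p (Q \<inter> N p)) = card Q - card (insert p (Q \<inter> N p))"
        by (rule card_Diff_subset) (use p in auto)
      moreover have "card (insert p (Q \<inter> N p)) = 3" using reg[OF p] E_irrefl by simp
      ultimately show ?thesis by simp
    qed
    then show ?thesis unfolding B_def by (subst card_SigmaI) simp_all
  qed
  have "(\<Sum>h\<in>N z. card {b \<in> B. E h (fst b) \<and> E h (snd b)})
      = (\<Sum>b\<in>B. card {h \<in> N z. E h (fst b) \<and> E h (snd b)})"
    by (rule sum_card_swap) (simp_all add: B_def)
  also have "\<dots> = (\<Sum>b\<in>B. 1)"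
  proof (rule sum.cong[OF refl])
    fix b assume b: "b \<in> B"
    have pq: "fst b \<in> N z" "snd b \<in> N z" "fst b \<noteq> snd b" "\<not> E (fst b) (snd b)"
      using b Q(1) unfolding B_def by auto
    obtain w where "N z \<inter> N (fst b) \<inter> N (snd b) = {w}" using local_common[OF z pq] .
    moreover have "{h \<in> N z. E h (fst b) \<and> E h (snd b)} = N z \<inter> N (fst b) \<inter> N (snd b)"
      using E_commute by auto
    ultimately show "card {h \<in> N z. E h (fst b) \<and> E h (snd b)} = 1" by simp
  qed
  also have "\<dots> = card Q * (card Q - 3)" using cB by simp
  also have "(\<Sum>h\<in>N z. card {b \<in> B. E h (fst b) \<and> E h (snd b)})
      = (\<Sum>h\<in>N z. card (Q \<inter> N h) * (card (Q \<inter> N h) - 1))"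
  proof (rule sum.cong[OF refl])
    fix h assume h: "h \<in> N z"
    have non: "\<not> E p q" if "p \<in> Q \<inter> N h" "q \<in> Q \<inter> N h" for p q
    proof
      assume "E p q"
      moreover have "p \<in> N z" "q \<in> N z" using that Q(1) by blast+
      ultimately show False using no_K4[of z h p q] z h that by simp
    qed
    have "{b \<in> B. E h (fst b) \<and> E h (snd b)} = (SIGMA p:Q \<inter> N h. Q \<inter> N h - {p})"
    proof
      show "{b \<in> B. E h (fst b) \<and> E h (snd b)} \<subseteq> (SIGMA p:Q \<inter> N h. Q \<inter> N h - {p})"
        using Q(1) unfolding B_def by auto
      show "(SIGMA p:Q \<inter> N h. Q \<inter> N h - {p}) \<subseteq> {b \<in> B. E h (fst b) \<and> E h (snd b)}"
      proof
        fix b assume "b \<in> (SIGMA p:Q \<inter> N h. Q \<inter> N h - {p})"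
        then obtain p q where b: "b = (p, q)" "p \<in> Q \<inter> N h" "q \<in> Q \<inter> N h" "p \<noteq> q" by blast
        then show "b \<in> {b \<in> B. E h (fst b) \<and> E h (snd b)}" using non[OF b(2,3)] unfolding B_def by simp
      qed
    qed
    then show "card {b \<in> B. E h (fst b) \<and> E h (snd b)} = card (Q \<inter> N h) * (card (Q \<inter> N h) - 1)"
      by (simp add: card_SigmaI)
  qed
  also have "\<dots> = (\<Sum>h\<in>N z - Q. card (Q \<inter> N h) * (card (Q \<inter> N h) - 1))
      + (\<Sum>h\<in>Q. card (Q \<inter> N h) * (card (Q \<inter> N h) - 1))"
    by (rule sum.subset_diff[OF Q(1)]) simp
  also have "(\<Sum>h\<in>Q. card (Q \<inter> N h) * (card (Q \<inter> N h) - 1)) = 2 * card Q"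
    using reg by simp
  finally show ?thesis .
qed

lemma card_outer: "card (N z - Q) + card Q = 10"
  using card_N[OF z] petersen card_Diff_subset[OF finQ Q(1)] card_mono[OF finN Q(1)] by simp

text \<open>Let \<open>d\<close> be the number of neighbours in \<open>Q\<close>. Summing
  \<open>0 \<le> d (d - 1) \<le> 2 d\<close> over the outer vertices bounds
  \<open>card Q - 3\<close> by 2 and 4. Size 7 would force \<open>d\<close> to be 0 or 3 throughout,
  although the sum is 7.\<close>

lemma card_cases: "card Q = 5 \<or> card Q = 6"
proof -
  let ?d = "\<lambda>r. card (Q \<inter> N r)"
  let ?R = "N z - Q"
  obtain n where n: "card Q = n + 3" using three_le_card by (metis add.commute le_iff_add)
  have le: "?d r * (?d r - 1) \<le> 2 * ?d r" if "r \<in> ?R" for r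
  proof -
    have "?d r * (?d r - 1) \<le> ?d r * 2" using card_Q_nb_le[of r] that by (intro mult_le_mono2) auto
    then show ?thesis by simp
  qed
  have "(\<Sum>r\<in>?R. ?d r * (?d r - 1)) \<le> (\<Sum>r\<in>?R. 2 * ?d r)" by (rule sum_mono) (rule le)
  also have "\<dots> = 2 * card Q" using sum_outer by (simp flip: sum_distrib_left)
  finally have "card Q * (card Q - 3) \<le> card Q * 4" using sum_outer_pairs by linarith
  then have "card Q - 3 \<le> 4" using three_le_card by (subst (asm) mult_le_cancel1) simp
  then have n4: "n \<le> 4" using n by simp
  have "card Q * 2 \<le> card Q * (card Q - 3)" using sum_outer_pairs by linarith
  then have "2 \<le> card Q - 3" using three_le_card by (subst (asm) mult_le_cancel1) simp
  then have n2: "2 \<le> n" using n by simp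
  have "n \<noteq> 4"
  proof
    assume n4: "n = 4"
    have "(\<Sum>r\<in>?R. ?d r * (?d r - 1)) = (\<Sum>r\<in>?R. 2 * ?d r)"
      using sum_outer sum_outer_pairs n n4 by (simp flip: sum_distrib_left)
    then have "?d r * (?d r - 1) = 2 * ?d r" if "r \<in> ?R" for r
      using sum_mono_inv[of "\<lambda>r. ?d r * (?d r - 1)" ?R "\<lambda>r. 2 * ?d r" r] le that by simp
    then have "3 dvd ?d r" if "r \<in> ?R" for r
      using that by (cases "?d r") fastforce+
    then have "3 dvd (\<Sum>r\<in>?R. ?d r)" by (rule dvd_sum)
    then show False using sum_outer n n4 by simp
  qed
  then show ?thesis using n n2 n4 by linarith
qed

text \<open>For size 5 the sum over pairs vanishes, so each of the five outer vertices has at most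
  one neighbour in \<open>Q\<close>; the total is 5.\<close>

lemma pentagon_outer:
  assumes n: "card Q = 5" and r: "r \<in> N z - Q"
  shows "card (Q \<inter> N r) = 1"
proof -
  let ?d = "\<lambda>r. card (Q \<inter> N r)"
  let ?R = "N z - Q"
  have "(\<Sum>r\<in>?R. ?d r * (?d r - 1)) = 0" using sum_outer_pairs n by simp
  then have zero: "\<forall>r\<in>?R. ?d r * (?d r - 1) = 0" by (subst (asm) sum_eq_0_iff) simp_all
  have "?d r \<le> 1" if "r \<in> ?R" for r
  proof -
    have "?d r = 0 \<or> ?d r - 1 = 0" using zero that by (simp only: mult_is_0)
    then show ?thesis by linarith
  qed
  moreover have "(\<Sum>r\<in>?R. ?d r) = (\<Sum>r\<in>?R. 1)" using sum_outer card_outer n by simp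
  ultimately show ?thesis using sum_mono_inv[of ?d ?R "\<lambda>_. 1" r] r by simp
qed

text \<open>Over the four outer vertices both \<open>d\<close> and \<open>d (d - 1)\<close> sum to
  6. A vertex with \<open>d = 3\<close> would use up the second sum and leave the other three as a
  triangle. So the values are 0, 2, 2, 2, and the vertex with value 0 is adjacent to the other
  three.\<close>

lemma hexagon_outer:
  assumes n: "card Q = 6"
  obtains r0 where "r0 \<in> N z - Q" "Q \<inter> N r0 = {}" "N z \<inter> N r0 = N z - Q - {r0}"
    "\<And>r. r \<in> N z - Q - {r0} \<Longrightarrow> card (Q \<inter> N r) = 2"
proof -
  let ?d = "\<lambda>r. card (Q \<inter> N r)"
  let ?R = "N z - Q"
  have s1: "(\<Sum>r\<in>?R. ?d r) = 6" using sum_outer n by simp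
  have s2: "(\<Sum>r\<in>?R. ?d r * (?d r - 1)) = 6" using sum_outer_pairs n by simp
  have cR: "card ?R = 4" using card_outer n by simp
  have d2: "?d r \<le> 2" if r: "r \<in> ?R" for r
  proof (rule ccontr)
    assume "\<not> ?d r \<le> 2"
    then have d3: "?d r = 3" using card_Q_nb_le[of r] r by auto
    have s1': "(\<Sum>r\<in>?R - {r}. ?d r) = 3" using s1 d3 r by (simp add: sum.remove)
    have "(\<Sum>r\<in>?R - {r}. ?d r * (?d r - 1)) = 0"
      using s2 d3 sum.remove[of ?R r "\<lambda>r. ?d r * (?d r - 1)"] r by simp
    then have zero: "\<forall>q\<in>?R - {r}. ?d q * (?d q - 1) = 0" by (subst (asm) sum_eq_0_iff) simp_all
    have le: "?d q \<le> 1" if "q \<in> ?R - {r}" for q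
    proof -
      have "?d q = 0 \<or> ?d q - 1 = 0" using zero that by (simp only: mult_is_0)
      then show ?thesis by linarith
    qed
    have c3: "card (?R - {r}) = 3" using cR r by simp
    have d1: "?d q = 1" if "q \<in> ?R - {r}" for q
      using sum_mono_inv[of ?d "?R - {r}" "\<lambda>_. 1" q] le s1' c3 that by simp
    have "N z \<inter> N r = Q \<inter> N r"
    proof -
      have "Q \<inter> N r \<subseteq> N z \<inter> N r" using Q(1) by blast
      moreover have "card (N z \<inter> N r) = 3" using degree_3 r by blast
      ultimately show ?thesis using card_subset_eq[of "N z \<inter> N r" "Q \<inter> N r"] d3 by simp
    qed
    then have nr: "\<not> E r q" if "q \<in> ?R" for q using that by auto
    have nbq: "N z \<inter> N q - Q = ?R - {r} - {q}" if q: "q \<in> ?R - {r}" for q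
    proof (rule card_subset_eq)
      show "finite (?R - {r} - {q})" by simp
      show "N z \<inter> N q - Q \<subseteq> ?R - {r} - {q}"
      proof
        fix p assume p: "p \<in> N z \<inter> N q - Q"
        then have "p \<noteq> r" using nr[of q] q E_sym by auto
        moreover have "p \<noteq> q" using p E_irrefl by auto
        ultimately show "p \<in> ?R - {r} - {q}" using p by blast
      qed
      have "card (N z \<inter> N q - Q) = card (N z \<inter> N q - (Q \<inter> N q))"
        by (rule arg_cong[of _ _ card]) blast
      also have "\<dots> = card (N z \<inter> N q) - card (Q \<inter> N q)"
        by (rule card_Diff_subset) (use Q(1) in auto)
      also have "\<dots> = 2" using d1[OF q] degree_3[of q] q by simp
      also have "2 = card (?R - {r} - {q})" using q c3 by simp
      finally show "card (N z \<inter> N q - Q) = card (?R - {r} - {q})" .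
    qed
    obtain p q s where pqs: "?R - {r} = {p, q, s}" "p \<noteq> q" "p \<noteq> s" "q \<noteq> s"
      using c3 by (auto simp: card_3_iff)
    have "q \<in> ?R - {r} - {p}" "s \<in> ?R - {r} - {p}" "s \<in> ?R - {r} - {q}" using pqs by auto
    then have "q \<in> N z \<inter> N p - Q" "s \<in> N z \<inter> N p - Q" "s \<in> N z \<inter> N q - Q"
      using nbq[of p] nbq[of q] pqs(1) by blast+
    moreover have "p \<in> N z" using pqs by blast
    ultimately show False using no_K4[of z p q s] z by simp
  qed
  have d02: "?d r = 0 \<or> ?d r = 2" if "r \<in> ?R" for r
  proof -
    have "(\<Sum>r\<in>?R. ?d r * (?d r - 1)) = (\<Sum>r\<in>?R. ?d r)" using s1 s2 by simp
    moreover have "?d r * (?d r - 1) \<le> ?d r" if "r \<in> ?R" for r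
    proof -
      have "?d r * (?d r - 1) \<le> ?d r * 1" using d2[OF that] by (intro mult_le_mono2) auto
      then show ?thesis by simp
    qed
    ultimately have "?d r * (?d r - 1) = ?d r"
      using sum_mono_inv[of "\<lambda>r. ?d r * (?d r - 1)" ?R ?d r] that by simp
    then show ?thesis by (cases "?d r") auto
  qed
  have "\<exists>r0\<in>?R. ?d r0 = 0"
  proof (rule ccontr)
    assume "\<not> ?thesis"
    then have "(\<Sum>r\<in>?R. ?d r) = (\<Sum>r\<in>?R. 2)" using d02 by (intro sum.cong) auto
    then show False using s1 cR by simp
  qed
  then obtain r0 where r0: "r0 \<in> ?R" "?d r0 = 0" by blast
  have e: "Q \<inter> N r0 = {}" using r0(2) by simp
  have nb: "N z \<inter> N r0 = ?R - {r0}"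
  proof (rule card_subset_eq)
    show "N z \<inter> N r0 \<subseteq> ?R - {r0}" using e E_irrefl by auto
    show "card (N z \<inter> N r0) = card (?R - {r0})" using degree_3[of r0] r0(1) cR by simp
  qed simp
  have "?d r = 2" if r: "r \<in> ?R - {r0}" for r
  proof (rule ccontr)
    assume "?d r \<noteq> 2"
    then have "?d r = 0" using d02[of r] r by blast
    then have "(\<Sum>r\<in>?R - {r0} - {r}. ?d r) = 6"
      using s1 r0 sum.remove[of ?R r0 ?d] sum.remove[of "?R - {r0}" r ?d] r by simp
    moreover have "(\<Sum>r\<in>?R - {r0} - {r}. ?d r) \<le> (\<Sum>r\<in>?R - {r0} - {r}. 2)"
      by (rule sum_mono) (use d2 in blast)
    ultimately show False using cR r r0 by simp
  qed
  then show ?thesis using that r0 e nb by blast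
qed

end

end

section \<open>Constancy of the cycle length\<close>

lemma card_2_other:
  assumes "card A = 2" "x \<in> A"
  shows "\<exists>y. y \<noteq> x \<and> A = {x, y}"
proof -
  obtain c d where cd: "A = {c, d}" "c \<noteq> d" using assms(1) unfolding card_2_iff by blast
  then consider "x = c" | "x = d" using assms(2) by blast
  then show ?thesis using cd by cases (metis insert_commute)+
qed

context small_terwilliger
begin

lemma Y_mem:
  assumes "u \<in> X" "z \<in> lay u 3" "w \<in> Y u z"
  shows "w \<in> X" "w \<in> lay u 2" "E z w" "E w z" "\<not> E u w" "w \<noteq> u"
proof -
  show "w \<in> lay u 2" "E z w" using assms mem_Y by simp_all
  then show "w \<in> X" "\<not> E u w" "w \<noteq> u" using lay_2_mem[OF assms(1)] by simp_all
  show "E w z" using \<open>E z w\<close> by (rule E_sym)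
qed

lemma Y_triangle_free:
  assumes "u \<in> X" "z \<in> lay u 3" "p \<in> Y u z" "q \<in> Y u z" "r \<in> Y u z" "E p q" "E q r" "E p r"
  shows False
  using no_K4[of z p q r] lay_3D(1)[OF assms(1,2)] Y_mem[OF assms(1,2,3)] Y_mem[OF assms(1,2,4)]
    Y_mem[OF assms(1,2,5)] assms(6-8) by simp

text \<open>\<open>z\<close> and \<open>q\<close> are already the two common neighbours of
  \<open>p\<close> and \<open>r\<close>.\<close>

lemma Y_far:
  assumes "u \<in> X" "z \<in> lay u 3" "p \<in> Y u z" "q \<in> Y u z" "r \<in> Y u z"
    and "p \<noteq> r" "\<not> E p r" "E q p" "E q r" "c \<in> N u" "E c p"
  shows "\<not> E c r"
proof
  assume "E c r"
  note zm = lay_3D[OF assms(1,2)] and pm = Y_mem[OF assms(1,2,3)] and qm = Y_mem[OF assms(1,2,4)]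
    and rm = Y_mem[OF assms(1,2,5)]
  have c: "c \<in> X" "E u c" using assms(10) by simp_all
  have "z \<noteq> q" using qm E_irrefl by metis
  moreover have "z \<noteq> c" using zm c by metis
  moreover have "q \<noteq> c" using qm c by metis
  ultimately show False
    using M3[of p r z q c] zm(1) pm qm rm assms(6,7) E_sym[OF assms(8)] E_sym[OF assms(9)]
      E_sym[OF assms(11)] E_sym[OF \<open>E c r\<close>] c by simp
qed

lemma Y_shared:
  assumes "u \<in> X" "z \<in> lay u 3" "p \<in> Y u z" "q \<in> Y u z" "E p q" "N u \<inter> N p = {c, d}"
  shows "E c q \<or> E d q"
proof -
  obtain e where e: "e \<in> N u" "E e p" "E e q"
    using pentagon_center[OF assms(1) Y_mem(2)[OF assms(1,2,3)] Y_mem(2)[OF assms(1,2,4)] assms(5)] .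
  have "E p e" using e(2) by (rule E_sym)
  then have "e = c \<or> e = d" using pair_cases[OF assms(6), of e] e(1) by simp
  then show ?thesis using e(3) by blast
qed

lemma Y_other:
  assumes "u \<in> X" "z \<in> lay u 3" "p \<in> Y u z" "q \<in> Y u z" "E p q"
  obtains r where "r \<in> Y u z" "E p r" "r \<noteq> q" "Y u z \<inter> N p = {q, r}"
proof -
  have "q \<in> Y u z \<inter> N p" using assms(4,5) Y_mem(1)[OF assms(1,2,4)] by simp
  moreover have "card (Y u z \<inter> N p) = 2" by (rule card_Y_nb[OF assms(1,2,3)])
  ultimately obtain r where r: "Y u z \<inter> N p = {q, r}" "r \<noteq> q"
    using card_2_other by metis
  have "r \<in> Y u z \<inter> N p" unfolding r(1) by simp
  then show ?thesis using that[OF _ _ r(2,1)] by simp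
qed

lemma Y_nb_iff:
  assumes "u \<in> X" "z \<in> lay u 3" "Y u z \<inter> N p = {q, r}" "s \<in> Y u z"
  shows "E p s \<longleftrightarrow> s = q \<or> s = r"
proof -
  have "E p s \<longleftrightarrow> s \<in> Y u z \<inter> N p" using assms(4) Y_mem(1)[OF assms(1,2,4)] by simp
  then show ?thesis unfolding assms(3) by simp
qed

lemma finite_Y: "finite (Y u z)" by (simp add: Y_def)

lemma card_Y:
  assumes "k = 10" "u \<in> X" "z \<in> lay u 3"
  shows "card (Y u z) = 5 \<or> card (Y u z) = 6"
  using card_cases[OF assms(1) lay_3D(1)[OF assms(2,3)] _ Y_nonempty[OF assms(2,3)] card_Y_nb[OF assms(2,3)]]
  by (simp add: Y_def)

text \<open>
  Following the edges of \<open>Y u z\<close> traces a cycle in the Petersen graph \<open>N u\<close>; the path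
  \<open>a1, a, b\<close> extended by \<open>p\<close> and \<open>b1\<close> closes up after five steps iff \<open>p\<close> and \<open>b1\<close> are adjacent.
\<close>

lemma pentagon_iff:
  assumes k: "k = 10" and u: "u \<in> X" and z: "z \<in> lay u 3"
    and w: "w \<in> Y u z" and s: "s \<in> Y u z" and ws: "E w s"
    and sh: "N u \<inter> N w = {a, b}" "E a b" "N u \<inter> N s = {a, a1}" "E a a1" "E b b1" "E a1 p"
      "N u \<inter> N t = {b, b1}" "N u \<inter> N y = {a1, p}"
    and t: "t \<in> Y u z" "Y u z \<inter> N w = {s, t}" "s \<noteq> t"
    and y: "y \<in> Y u z" "Y u z \<inter> N s = {w, y}" "w \<noteq> y"
  shows "card (Y u z) = 5 \<longleftrightarrow> E p b1"
proof -
  let ?Q = "Y u z"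
  note zm = lay_3D[OF u z]
  note wm = Y_mem[OF u z w] and sm = Y_mem[OF u z s] and tm = Y_mem[OF u z t(1)] and ym = Y_mem[OF u z y(1)]
  note nw = Y_nb_iff[OF u z t(2)] and ns = Y_nb_iff[OF u z y(2)]
  note Dw = pairD[OF sh(1)] and Ds = pairD[OF sh(3)] and Dt = pairD[OF sh(7)] and Dy = pairD[OF sh(8)]
  have adj: "E w t" "E t w" "E s y" "E y s" "E s w"
    using nw[OF t(1)] ns[OF y(1)] E_sym ws by blast+
  have nwy: "\<not> E w y" "\<not> E y w"
    using Y_triangle_free[OF u z w s y(1) ws adj(3)] E_sym by blast+
  have nst: "\<not> E s t" "\<not> E t s"
    using Y_triangle_free[OF u z s w t(1) adj(5) adj(1)] E_sym by blast+
  have yt: "y \<noteq> t" using adj nst by blast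
  have nyt: "\<not> E y t" "\<not> E t y"
  proof -
    show "\<not> E y t"
    proof
      assume "E y t"
      moreover have "z \<noteq> s" "z \<noteq> t" using sm(3) tm(3) E_irrefl by metis+
      ultimately show False
        using M3[of w y z s t] zm wm ym sm tm nwy adj ws y(3) t(3) by blast
    qed
    then show "\<not> E t y" using E_sym by blast
  qed
  \<comment> \<open>\<open>v\<close> and \<open>v'\<close> prolong the path
    \<open>t, w, s, y\<close> of the cycle at its two ends; the length is 5 exactly if they
    coincide.\<close>
  obtain v where v: "v \<in> ?Q" "E y v" "v \<noteq> s" "?Q \<inter> N y = {s, v}"
    using Y_other[OF u z y(1) s adj(4)] .
  obtain v' where v': "v' \<in> ?Q" "E t v'" "v' \<noteq> w" "?Q \<inter> N t = {w, v'}"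
    using Y_other[OF u z t(1) w adj(2)] .
  note vm = Y_mem[OF u z v(1)] and vm' = Y_mem[OF u z v'(1)]
  note ny = Y_nb_iff[OF u z v(4)] and nt = Y_nb_iff[OF u z v'(4)]
  have ne: "v \<noteq> w" "v \<noteq> t" "v \<noteq> y" "v' \<noteq> s" "v' \<noteq> y" "v' \<noteq> t" "w \<noteq> s" "w \<noteq> t" "s \<noteq> y"
    using v v' nwy nyt nst adj ws E_irrefl by metis+
  have nv: "\<not> E s v" "\<not> E w v" "\<not> E s v'" "\<not> E w v'"
    using ns[OF v(1)] nw[OF v(1)] ns[OF v'(1)] nw[OF v'(1)] ne v v' by blast+
  have ca1: "\<not> E a1 v"
    by (rule Y_far[OF u z s y(1) v(1) _ nv(1) adj(4) v(2)]) (use v Ds in simp_all)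
  have cb: "\<not> E b v'"
    by (rule Y_far[OF u z w t(1) v'(1) _ nv(4) adj(2) v'(2)]) (use v' Dw in simp_all)
  have pv: "E p v" using Y_shared[OF u z y(1) v(1) v(2) sh(8)] ca1 by blast
  have bv: "E b1 v'" using Y_shared[OF u z t(1) v'(1) v'(2) sh(7)] cb by blast
  have ay: "\<not> E a y"
    by (rule Y_far[OF u z w s y(1) y(3) nwy(1) adj(5) adj(3)]) (use Dw in simp_all)
  have a1b: "a1 \<noteq> b"
  proof
    assume "a1 = b"
    then show False using no_K4[of w s a b] wm sm Dw Ds sh ws by blast
  qed
  \<comment> \<open>Equality would close the quadrangle \<open>a, a1, p, b\<close> in
    \<open>N u\<close>.\<close>
  have pb1: "p \<noteq> b1"
  proof
    assume pb: "p = b1"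
    have "a \<noteq> p" using ay Dy by blast
    have "\<not> E a p" using no_K4[of u a a1 p] u Dw Ds Dy sh by blast
    have "E p b" "E p a1" "u \<noteq> a1" "u \<noteq> b"
      using E_sym[OF sh(5)] E_sym[OF sh(6)] pb Ds Dw E_irrefl by metis+
    then show False
      using M3[of a p u a1 b] u Dw Ds Dy sh \<open>a \<noteq> p\<close> \<open>\<not> E a p\<close> a1b by blast
  qed
  show ?thesis
  proof (cases "v = v'")
    case True
    have "E p b1"
      using M_adj[of u v p b1] u vm Dy Dt pb1 E_sym[OF pv] E_sym[OF bv] True by blast
    \<comment> \<open>The five vertices have used up their two neighbours each, so a sixth one would
      be isolated in \<open>Y u z\<close>.\<close>
    moreover have "card ?Q = 5"
    proof (rule ccontr)
      assume "card ?Q \<noteq> 5"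
      then have c6: "card ?Q = 6" using card_Y[OF k u z] by blast
      let ?C = "{w, s, y, t, v}"
      have "card ?C = 5" using ne y(3) t(3) yt v(3) by simp
      moreover have CQ: "?C \<subseteq> ?Q" using w s y(1) t(1) v(1) by simp
      ultimately have "card (?Q - ?C) = 1" using c6 by (simp add: card_Diff_subset)
      then obtain q where q: "?Q - ?C = {q}" by (auto simp: card_1_singleton_iff)
      then have qQ: "q \<in> ?Q" "q \<notin> ?C" by blast+
      have "?Q \<inter> N v = {y, t}"
      proof -
        have "{y, t} \<subseteq> ?Q \<inter> N v" using v v' True y(1) t(1) ym tm E_sym by simp
        moreover have "card {y, t} = card (?Q \<inter> N v)" using card_Y_nb[OF u z v(1)] yt by simp
        ultimately show ?thesis using card_subset_eq[of "?Q \<inter> N v" "{y, t}"] finite_Y by simp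
      qed
      then have vq: "\<not> E v q" using Y_nb_iff[OF u z _ qQ(1)] qQ(2) by blast
      have notC: "\<not> E q c" if "c \<in> ?C" for c
        using that nw[OF qQ(1)] ns[OF qQ(1)] ny[OF qQ(1)] nt[OF qQ(1)] vq qQ(2) True E_sym[of q c] by blast
      have "?Q \<inter> N q \<subseteq> (?Q - ?C) - {q}"
      proof
        fix c assume c: "c \<in> ?Q \<inter> N q"
        then have "E q c" by simp
        then have "c \<notin> ?C" "c \<noteq> q" using notC[of c] E_irrefl by metis+
        then show "c \<in> (?Q - ?C) - {q}" using c by blast
      qed
      then have "?Q \<inter> N q = {}" unfolding q by blast
      then show False using card_Y_nb[OF u z qQ(1)] by simp
    qed
    ultimately show ?thesis by simp
  next
    case False
    let ?C = "{w, s, y, t, v, v'}"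
    have c6: "card ?C = 6" using ne y(3) t(3) yt v(3) v'(3) False by simp
    have CQ: "?C \<subseteq> ?Q" using w s y(1) t(1) v(1) v'(1) by simp
    have "6 \<le> card ?Q" using card_mono[OF finite_Y CQ] c6 by simp
    then have "card ?Q = 6" using card_Y[OF k u z] by linarith
    then have Q: "?Q = ?C" using card_subset_eq[OF finite_Y CQ] c6 by simp
    \<comment> \<open>With six vertices \<open>v\<close> and \<open>v'\<close> are adjacent. Both
      \<open>b1\<close> and the second common neighbour \<open>p'\<close> of \<open>u\<close> and
      \<open>v\<close> are adjacent to \<open>v'\<close>, hence to each other, so an edge
      \<open>p b1\<close> would make \<open>u, p, b1, p'\<close> pairwise adjacent.\<close>
    have "\<not> E p b1"
    proof
      assume E: "E p b1"
      obtain q where q: "q \<in> ?Q" "E v q" "q \<noteq> y" using Y_other[OF u z v(1) y(1) E_sym[OF v(2)]] by blast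
      have "E q v" using q(2) by (rule E_sym)
      then have "q \<noteq> w" "q \<noteq> s" "q \<noteq> v" using nv E_irrefl by blast+
      moreover have "q \<noteq> t" using nt[OF v(1)] ne False \<open>E q v\<close> by blast
      ultimately have "q = v'" using q(1,3) unfolding Q by blast
      then have vv': "E v v'" using q(2) by simp
      have "p \<in> N u \<inter> N v" using Dy E_sym[OF pv] by simp
      then obtain p' where p': "p' \<in> N u \<inter> N v" "N u \<inter> N v = {p, p'}" "E p p'"
        using common_pair[of u v p] u vm by metis
      note Dv = pairD[OF p'(2)]
      have "\<not> E p v'"
        by (rule Y_far[OF u z y(1) v(1) v'(1) _ _ E_sym[OF v(2)] vv'])
          (use ne ny[OF v'(1)] False Dy in simp_all)
      then have p'v': "E p' v'" using Y_shared[OF u z v(1) v'(1) vv' p'(2)] by blast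
      have "\<not> E b1 v"
        by (rule Y_far[OF u z t(1) v'(1) v(1) _ _ E_sym[OF v'(2)] E_sym[OF vv']])
          (use ne nt[OF v(1)] False Dt in simp_all)
      then have "b1 \<noteq> p'" using Dv by blast
      then have "E b1 p'"
        using M_adj[of u v' b1 p'] u vm' Dt Dv E_sym[OF bv] E_sym[OF p'v'] by blast
      then show False using no_K4[of u p b1 p'] u Dy Dt Dv E p'(3) by blast
    qed
    then show ?thesis using \<open>card ?Q = 6\<close> by simp
  qed
qed

end

context small_terwilliger
begin

lemma lay_2_pair_at:
  assumes "u \<in> X" "w \<in> lay u 2" "a \<in> N u" "E a w"
  obtains b where "N u \<inter> N w = {a, b}" "b \<noteq> a" "E a b"
proof -
  note wm = lay_2_mem[OF assms(1,2)]
  have "a \<in> N u \<inter> N w" using assms(3) E_sym[OF assms(4)] by simp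
  then show ?thesis using common_pair[OF assms(1) wm(1) _ wm(3)] wm(2) that by metis
qed

text \<open>Going on from \<open>w\<close> to the next vertex \<open>t\<close> of the cycle moves
  the edge \<open>a b\<close> of \<open>N u\<close> to \<open>b b1\<close>: in \<open>Y_nb\<close>
  the neighbour \<open>s\<close> is the one attached to \<open>a\<close>, so \<open>t\<close> is
  attached to \<open>b\<close>.\<close>

lemma Y_turn:
  assumes u: "u \<in> X" and z: "z \<in> lay u 3" and w: "w \<in> Y u z" and s: "s \<in> Y u z" and ws: "E w s"
    and a: "E a s" "N u \<inter> N w = {a, b}" "a \<noteq> b"
  obtains t b1 where "t \<in> Y u z" "Y u z \<inter> N w = {s, t}" "s \<noteq> t" "E w t" "E b t" "\<not> E a t"
    "N u \<inter> N t = {b, b1}" "E b b1" "b1 \<noteq> b" "b1 \<noteq> a"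
proof -
  note sm = Y_mem[OF u z s]
  obtain s' t where st: "s' \<noteq> t" "s' \<in> Y u z" "t \<in> Y u z" "E w s'" "E w t" "Y u z \<inter> N w = {s', t}"
    "N w \<inter> N z \<inter> N a = {s'}" "N w \<inter> N z \<inter> N b = {t}"
    using Y_nb[OF u z w a(2,3)] by metis
  have "s \<in> N w \<inter> N z \<inter> N a" using sm ws a(1) by simp
  then have "s = s'" using st(7) by simp
  have tm: "t \<in> X" "E z t" "t \<in> lay u 2" using Y_mem[OF u z st(3)] by simp_all
  have "t \<in> N w \<inter> N z \<inter> N b" using st(8) by simp
  then have bt: "E b t" by simp
  have nat: "\<not> E a t"
  proof
    assume "E a t"
    then have "t \<in> N w \<inter> N z \<inter> N a" using tm st(5) by simp
    then show False using st(1,7) by simp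
  qed
  have "b \<in> N u" using pairD[OF a(2)] by simp
  then obtain b1 where b1: "N u \<inter> N t = {b, b1}" "b1 \<noteq> b" "E b b1"
    using lay_2_pair_at[OF u tm(3) _ bt] by metis
  have "b1 \<noteq> a" using pairD[OF b1(1)] nat by blast
  then show ?thesis using that[of t b1] st \<open>s = s'\<close> bt nat b1 by blast
qed

text \<open>If the continuations agreed, the nonadjacent vertices \<open>t\<close>,
  \<open>t'\<close> would have the three common neighbours \<open>w, b, c\<close>. They are
  distinct, as otherwise \<open>z\<close> and \<open>z'\<close> would have the three common
  neighbours \<open>w, s, t\<close>.\<close>

lemma turn_distinct:
  assumes "u \<in> X" "z \<in> lay u 3" "z' \<in> lay u 3" "z \<noteq> z'"
    and w: "w \<in> Y u z" "w \<in> Y u z'" and s: "s \<in> Y u z" "s \<in> Y u z'" "E w s"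
    and t: "t \<in> Y u z" "E w t" "s \<noteq> t" and t': "t' \<in> Y u z'" "E w t'" "s \<noteq> t'"
    and b: "N u \<inter> N t = {b, c}" "N u \<inter> N t' = {b, c'}" "E b w" "c \<noteq> b"
  shows "c \<noteq> c'"
proof
  assume "c = c'"
  note zm = lay_3D(1)[OF assms(1,2)] lay_3D(1)[OF assms(1,3)]
  note wm = Y_mem[OF assms(1,2) w(1)] Y_mem[OF assms(1,3) w(2)]
  note sm = Y_mem[OF assms(1,2) s(1)] Y_mem[OF assms(1,3) s(2)]
  note tm = Y_mem[OF assms(1,2) t(1)] and tm' = Y_mem[OF assms(1,3) t'(1)]
  note Dt = pairD[OF b(1)] and Dt' = pairD[OF b(2)]
  have tw: "E t w" "E t' w" "E w b" using E_sym t(2) t'(2) b(3) by blast+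
  have nz: "\<not> E z z'" using no_K4[of w s z z'] zm wm sm s(3) by blast
  have ne: "w \<noteq> s" "w \<noteq> t" using s(3) t(2) E_irrefl by metis+
  have "t \<noteq> t'"
  proof
    assume "t = t'"
    then show False using M3[of z z' w s t] zm assms(4) nz wm sm tm tm' ne t(3) by blast
  qed
  moreover have "\<not> E t t'" using no_K4[of w b t t'] wm Dt Dt' tm tm' t(2) t'(2) tw by blast
  moreover have "w \<noteq> b" "w \<noteq> c" using wm(5) Dt by blast+
  moreover have "E t c" "E t' c" using Dt Dt' \<open>c = c'\<close> by simp_all
  ultimately show False
    using M3[of t t' w b c] tm(1) tm'(1) wm(1) tw Dt Dt' b(4) by blast
qed

text \<open>In the Petersen graph \<open>N u\<close>, the vertices \<open>p'\<close> and
  \<open>b\<close> have a common neighbour. It is not \<open>a\<close>, which would give a triangle,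
  and not \<open>b1\<close>, which would give the quadrangle \<open>b1, p, a1, p'\<close>; so it is
  \<open>b1'\<close>.\<close>

lemma petersen_matching:
  assumes k: "k = 10" and u: "u \<in> X"
    and N: "a \<in> N u" "b \<in> N u" "a1 \<in> N u" "b1 \<in> N u" "b1' \<in> N u" "p \<in> N u" "p' \<in> N u"
    and e: "E a b" "E a a1" "E b b1" "E b b1'" "E a1 p" "E a1 p'"
    and ne: "b1 \<noteq> b1'" "p \<noteq> p'" "b1 \<noteq> a" "b1' \<noteq> a" "p' \<noteq> a" "a1 \<noteq> b"
    and pb: "E p b1"
  shows "E p' b1'"
proof -
  have D: "a \<in> X" "b \<in> X" "a1 \<in> X" "b1 \<in> X" "b1' \<in> X" "p \<in> X" "p' \<in> X"
    "E u a" "E u b" "E u a1" "E u b1" "E u b1'" "E u p" "E u p'" using N by simp_all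
  note R = D(8-14)[THEN E_sym] and e' = e[THEN E_sym]
  have "card (N u \<inter> N b) = 3" using card_NN[OF u D(2,9)] kl k by simp
  moreover have sub: "{a, b1, b1'} \<subseteq> N u \<inter> N b" using D e e' by simp
  moreover have "card {a, b1, b1'} = 3" using ne by simp
  ultimately have nb: "N u \<inter> N b = {a, b1, b1'}" using card_subset_eq[OF _ sub] by simp
  have a1b: "\<not> E a1 b" using no_K4[of u a a1 b] u D e by blast
  have nap: "\<not> E a p'" using no_K4[of u a a1 p'] u D e by blast
  have "p' \<noteq> b" using a1b e by blast
  have ub: "u \<noteq> b" "u \<noteq> a1" "u \<noteq> p" "u \<noteq> p'" using D E_irrefl by metis+
  have npb: "\<not> E p' b"
    using M3[of a p' u a1 b] u D R e e' ne ub nap by blast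
  obtain q where q: "q \<in> N u" "E q p'" "E q b" using local_common[OF u N(7,2) \<open>p' \<noteq> b\<close> npb] by metis
  have "q \<in> N u \<inter> N b" using q E_sym by simp
  then have "q = a \<or> q = b1 \<or> q = b1'" unfolding nb by simp
  moreover have "q \<noteq> a" using nap q by blast
  moreover have "q \<noteq> b1"
  proof
    assume q1: "q = b1"
    have "b1 \<noteq> a1" using a1b e' by blast
    moreover have "\<not> E b1 a1" using no_K4[of u a1 p b1] u D e pb E_sym by blast
    moreover have "E b1 p'" using q q1 by simp
    ultimately show False using M3[of b1 a1 u p p'] u D R e ne ub pb[THEN E_sym] by blast
  qed
  ultimately show ?thesis using q E_sym by blast
qed

text \<open>Both cycles run through the edge \<open>w s\<close>. By \<open>turn_distinct\<close>
  they continue differently at both ends, and by \<open>petersen_matching\<close> the criterion of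
  \<open>pentagon_iff\<close> then holds for both or for neither.\<close>

lemma edge_type:
  assumes k: "k = 10" and u: "u \<in> X" and w: "w \<in> lay u 2" and s: "s \<in> lay u 2" and ws: "E w s"
    and z: "z \<in> lay u 3" "E z w" "E z s" and z': "z' \<in> lay u 3" "E z' w" "E z' s"
  shows "card (Y u z) = card (Y u z')"
proof (cases "z = z'")
  case False
  obtain a where a: "a \<in> N u" "E a w" "E a s" using pentagon_center[OF u w s ws] .
  obtain b where b: "N u \<inter> N w = {a, b}" "b \<noteq> a" "E a b" using lay_2_pair_at[OF u w a(1,2)] .
  obtain a1 where a1: "N u \<inter> N s = {a, a1}" "a1 \<noteq> a" "E a a1" using lay_2_pair_at[OF u s a(1,3)] .
  have m: "w \<in> Y u z" "s \<in> Y u z" "w \<in> Y u z'" "s \<in> Y u z'" using mem_Y[OF u] w s z z' by simp_all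
  have sw: "E s w" using ws by (rule E_sym)
  note ab = b(2)[symmetric] and aa1 = a1(2)[symmetric]
  obtain t b1 where t: "t \<in> Y u z" "Y u z \<inter> N w = {s, t}" "s \<noteq> t" "E w t" "E b t" "\<not> E a t"
    "N u \<inter> N t = {b, b1}" "E b b1" "b1 \<noteq> b" "b1 \<noteq> a"
    using Y_turn[OF u z(1) m(1,2) ws a(3) b(1) ab] .
  obtain y p where y: "y \<in> Y u z" "Y u z \<inter> N s = {w, y}" "w \<noteq> y" "E s y" "E a1 y" "\<not> E a y"
    "N u \<inter> N y = {a1, p}" "E a1 p" "p \<noteq> a1" "p \<noteq> a"
    using Y_turn[OF u z(1) m(2,1) sw a(2) a1(1) aa1] .
  obtain t' b1' where t': "t' \<in> Y u z'" "Y u z' \<inter> N w = {s, t'}" "s \<noteq> t'" "E w t'" "E b t'" "\<not> E a t'"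
    "N u \<inter> N t' = {b, b1'}" "E b b1'" "b1' \<noteq> b" "b1' \<noteq> a"
    using Y_turn[OF u z'(1) m(3,4) ws a(3) b(1) ab] .
  obtain y' p' where y': "y' \<in> Y u z'" "Y u z' \<inter> N s = {w, y'}" "w \<noteq> y'" "E s y'" "E a1 y'" "\<not> E a y'"
    "N u \<inter> N y' = {a1, p'}" "E a1 p'" "p' \<noteq> a1" "p' \<noteq> a"
    using Y_turn[OF u z'(1) m(4,3) sw a(2) a1(1) aa1] .
  note Dw = pairD[OF b(1)] and Ds = pairD[OF a1(1)] and Dt = pairD[OF t(7)] and Dt' = pairD[OF t'(7)]
    and Dy = pairD[OF y(7)] and Dy' = pairD[OF y'(7)]
  have bb: "b1 \<noteq> b1'"
    by (rule turn_distinct[OF u z(1) z'(1) False m(1,3) m(2,4) ws t(1,4,3) t'(1,4,3) t(7) t'(7) _ t(9)])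
      (use Dw in simp)
  have pp: "p \<noteq> p'"
    by (rule turn_distinct[OF u z(1) z'(1) False m(2,4) m(1,3) sw y(1,4,3) y'(1,4,3) y(7) y'(7) _ y(9)])
      (use Ds in simp)
  have "a1 \<noteq> b"
  proof
    assume "a1 = b"
    then show False
      using no_K4[of w s a b] lay_2_mem(1)[OF u w] lay_2_mem(1)[OF u s] Dw Ds ws b(3) by blast
  qed
  have nb: "a \<in> N u" "b \<in> N u" "a1 \<in> N u" "b1 \<in> N u" "b1' \<in> N u" "p \<in> N u" "p' \<in> N u"
    using Dw Ds Dt Dt' Dy Dy' by simp_all
  have "E p b1 \<longleftrightarrow> E p' b1'"
  proof
    show "E p b1 \<Longrightarrow> E p' b1'"
      by (rule petersen_matching[OF k u nb b(3) a1(3) t(8) t'(8) y(8) y'(8) bb pp t(10) t'(10) y'(10) \<open>a1 \<noteq> b\<close>])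
    show "E p' b1' \<Longrightarrow> E p b1"
      by (rule petersen_matching[OF k u nb(1-3,5,4,7,6) b(3) a1(3) t'(8) t(8) y'(8) y(8)
            bb[symmetric] pp[symmetric] t'(10) t(10) y(10) \<open>a1 \<noteq> b\<close>])
  qed
  moreover have "card (Y u z) = 5 \<longleftrightarrow> E p b1"
    by (rule pentagon_iff[OF k u z(1) m(1,2) ws b(1,3) a1(1,3) t(8) y(8) t(7) y(7) t(1-3) y(1-3)])
  moreover have "card (Y u z') = 5 \<longleftrightarrow> E p' b1'"
    by (rule pentagon_iff[OF k u z'(1) m(3,4) ws b(1,3) a1(1,3) t'(8) y'(8) t'(7) y'(7) t'(1-3) y'(1-3)])
  ultimately show ?thesis using card_Y[OF k u z(1)] card_Y[OF k u z'(1)] by linarith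
qed simp

text \<open>Let \<open>s\<close> be the neighbour of \<open>w\<close> attached to \<open>a\<close>
  on the cycle of \<open>z\<close>, and \<open>t'\<close> the one attached to \<open>b\<close> on
  the cycle of \<open>z'\<close>. Their common neighbour \<open>q\<close> in the local graph of
  \<open>w\<close> is in the third layer, so \<open>edge_type\<close> compares \<open>z\<close> with
  \<open>q\<close> along \<open>w s\<close> and \<open>q\<close> with \<open>z'\<close> along
  \<open>w t'\<close>.\<close>

lemma vertex_type:
  assumes k: "k = 10" and u: "u \<in> X" and w: "w \<in> lay u 2"
    and z: "z \<in> lay u 3" "E z w" and z': "z' \<in> lay u 3" "E z' w"
  shows "card (Y u z) = card (Y u z')"
proof -
  note wm = lay_2_mem[OF u w]
  obtain a b where ab: "N u \<inter> N w = {a, b}" "a \<noteq> b" "E a b" using lay_2_pair[OF u w] .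
  note D = pairD[OF ab(1)]
  have m: "w \<in> Y u z" "w \<in> Y u z'" using mem_Y[OF u] w z z' by simp_all
  obtain s t where st: "s \<in> Y u z" "N w \<inter> N z \<inter> N a = {s}"
    using Y_nb[OF u z(1) m(1) ab(1,2)] by metis
  obtain t' where t': "t' \<in> Y u z'" "N w \<inter> N z' \<inter> N b = {t'}"
    using Y_nb[OF u z'(1) m(2) ab(1,2)] by metis
  have "s \<in> N w \<inter> N z \<inter> N a" "t' \<in> N w \<inter> N z' \<inter> N b" using st(2) t'(2) by simp_all
  then have sD: "s \<in> X" "E w s" "E z s" "E a s" and tD: "t' \<in> X" "E w t'" "E z' t'" "E b t'" by simp_all
  note sY = Y_mem[OF u z(1) st(1)] and tY = Y_mem[OF u z'(1) t'(1)]
  have nat: "\<not> E a t'" using no_K4[of w a b t'] wm D ab tD by blast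
  have "s \<noteq> t'" using nat sD by blast
  have "\<not> E s t'"
  proof
    assume "E s t'"
    moreover have "a \<noteq> t'" using D tY by blast
    moreover have "w \<noteq> s" "w \<noteq> b" "b \<noteq> s" using sD D sY wm E_irrefl by metis+
    moreover have "E t' s" "E t' b" "E t' w" using E_sym tD \<open>E s t'\<close> by blast+
    ultimately show False using M3[of a t' w b s] nat D tD sD ab wm by blast
  qed
  then obtain q where q: "q \<in> N w" "E q s" "E q t'"
    using local_common[of w s t'] wm(1) sD tD \<open>s \<noteq> t'\<close> by (metis mem_nb)
  have qX: "q \<in> X" "E w q" "E q w" using q(1) E_sym by simp_all
  have "\<not> E q a" using no_K4[of w a s q] wm D sD qX q E_sym by blast
  moreover have "\<not> E q b" using no_K4[of w b t' q] wm D tD qX q E_sym by blast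
  ultimately have q3: "q \<in> lay u 3" using lay_2_nb[OF u w ab(1) q(1)] by blast
  have "card (Y u z) = card (Y u q)"
    by (rule edge_type[OF k u w sY(2) sD(2) z sD(3) q3 qX(3) q(2)])
  also have "\<dots> = card (Y u z')"
    by (rule edge_type[OF k u w tY(2) tD(2) q3 qX(3) q(3) z' tD(3)])
  finally show ?thesis .
qed

definition same_type where
  "same_type u w w' \<longleftrightarrow> (\<forall>z\<in>lay u 3. \<forall>z'\<in>lay u 3. E z w \<longrightarrow> E z' w' \<longrightarrow> card (Y u z) = card (Y u z'))"

text \<open>Transitivity is not automatic: the middle vertex must have a neighbour in the third
  layer, which \<open>card_b2\<close> provides.\<close>

lemma same_type_trans:
  assumes "k = 10" "u \<in> X" "v \<in> lay u 2" "same_type u w v" "same_type u v w'"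
  shows "same_type u w w'"
proof -
  have "card (N v \<inter> lay u 3) = 4" using card_b2[OF assms(2,3)] assms(1) kl by simp
  then have "N v \<inter> lay u 3 \<noteq> {}" by auto
  then obtain z where "z \<in> N v \<inter> lay u 3" by blast
  then have "z \<in> lay u 3" "E z v" using E_sym by simp_all
  then show ?thesis using assms(4,5) unfolding same_type_def by metis
qed

text \<open>Of the three common neighbours of \<open>w\<close> and \<open>s\<close>, one other than
  \<open>a\<close> is in the third layer; \<open>vertex_type\<close> is applied through it at both
  ends.\<close>

lemma same_type_adj:
  assumes k: "k = 10" and u: "u \<in> X" and w: "w \<in> lay u 2" and s: "s \<in> lay u 2" and ws: "E w s"
  shows "same_type u w s"
proof -
  note wm = lay_2_mem[OF u w] and sm = lay_2_mem[OF u s]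
  obtain a where a: "a \<in> N u" "E a w" "E a s" using pentagon_center[OF u w s ws] .
  have aD: "a \<in> X" "E u a" "E w a" "E s a" using a E_sym by simp_all
  obtain b where b: "N u \<inter> N w = {a, b}" "b \<noteq> a" "E a b" using lay_2_pair_at[OF u w a(1,2)] .
  note D = pairD[OF b(1)]
  have "card (N w \<inter> N s) = 3" using card_NN[OF wm(1) sm(1) ws] k kl by simp
  then have "\<not> N w \<inter> N s \<subseteq> {a}" using card_mono[of "{a}" "N w \<inter> N s"] by fastforce
  then obtain z where z: "z \<in> N w \<inter> N s" "z \<noteq> a" by blast
  then have zD: "z \<in> X" "E w z" "E s z" "E z w" "E z s" using E_sym by simp_all
  have nza: "\<not> E a z" using no_K4[of w s a z] wm sm aD zD ws by blast
  moreover have "\<not> E z b"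
  proof
    assume "E z b"
    moreover have "w \<noteq> s" "w \<noteq> b" "s \<noteq> b" using ws E_irrefl wm sm D by metis+
    ultimately show False using M3[of a z w s b] aD zD wm sm D a nza z b(3) by blast
  qed
  ultimately have z3: "z \<in> lay u 3" using lay_2_nb[OF u w b(1), of z] z E_sym by blast
  show ?thesis
    unfolding same_type_def
  proof (intro ballI impI)
    fix p q assume pq: "p \<in> lay u 3" "q \<in> lay u 3" "E p w" "E q s"
    have "card (Y u p) = card (Y u z)" by (rule vertex_type[OF k u w pq(1,3) z3 zD(4)])
    also have "\<dots> = card (Y u q)" by (rule vertex_type[OF k u s z3 zD(5) pq(2,4)])
    finally show "card (Y u p) = card (Y u q)" .
  qed
qed

text \<open>In the Petersen graph \<open>N a\<close> the vertices in question are those at distance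
  2 from \<open>u\<close>, and they induce a connected graph. If the common neighbour
  \<open>r\<close> of \<open>w\<close> and \<open>w'\<close> is adjacent to \<open>u\<close>, the
  path has to go through another neighbour \<open>y\<close> of \<open>w\<close>.\<close>

lemma same_type_local:
  assumes k: "k = 10" and u: "u \<in> X" and a: "a \<in> N u"
    and w: "w \<in> lay u 2" "E a w" and w': "w' \<in> lay u 2" "E a w'"
  shows "same_type u w w'"
proof -
  note wm = lay_2_mem[OF u w(1)] and wm' = lay_2_mem[OF u w'(1)]
  have aX: "a \<in> X" "E u a" using a by simp_all
  have adj: "same_type u p q" if "p \<in> lay u 2" "q \<in> lay u 2" "E p q" for p q
    by (rule same_type_adj[OF k u that])
  have tr: "same_type u p r" if "q \<in> lay u 2" "same_type u p q" "same_type u q r" for p q r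
    by (rule same_type_trans[OF k u that])
  have lay: "r \<in> lay u 2" if "r \<in> N a" "E r p" "p \<in> lay u 2" "\<not> E u r" for r p
  proof (rule lay_2I[OF u _ _ that(4) a])
    show "r \<in> X" "E a r" using that(1) by simp_all
    show "r \<noteq> u" using that(2) lay_2_mem[OF u that(3)] by blast
  qed
  consider "w = w'" | "E w w'" | "w \<noteq> w'" "\<not> E w w'" by blast
  then show ?thesis
  proof cases
    case 1
    then show ?thesis using vertex_type[OF k u w(1)] unfolding same_type_def by blast
  next
    case 2
    then show ?thesis using adj w w' by blast
  next
    case 3
    have N: "w \<in> N a" "w' \<in> N a" using wm wm' w w' by simp_all
    obtain r where r: "r \<in> N a" "E r w" "E r w'" using local_common[OF aX(1) N 3] by metis
    have rX: "r \<in> X" "E a r" "E w r" "E w' r" using r E_sym by simp_all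
    show ?thesis
    proof (cases "E u r")
      case False
      then have r2: "r \<in> lay u 2" using lay[OF r(1,2) w(1)] by blast
      then show ?thesis using tr[OF r2 adj[OF w(1) r2 rX(3)] adj[OF r2 w'(1) r(3)]] by blast
    next
      case True
      have "card (N a \<inter> N w) = 3" using card_NN[OF aX(1) wm(1) w(2)] k kl by simp
      then have "\<not> N a \<inter> N w \<subseteq> {r}" using card_mono[of "{r}" "N a \<inter> N w"] by fastforce
      then obtain y where y: "y \<in> N a \<inter> N w" "y \<noteq> r" by blast
      have yX: "y \<in> X" "E a y" "E w y" "E y w" using y E_sym by simp_all
      have nyr: "\<not> E y r" using no_K4[of a w r y] aX wm rX w yX E_sym by blast
      \<comment> \<open>\<open>a\<close> and \<open>r\<close> exhaust the two common neighbours of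
        \<open>u\<close> and \<open>q\<close>.\<close>
      have pw: "p = a \<or> p = r" if "q \<in> lay u 2" "E a q" "E r q" "p \<in> X" "E u p" "E p q" for p q
      proof -
        note pq = that
        obtain b where b: "N u \<inter> N q = {a, b}" using lay_2_pair_at[OF u pq(1) a pq(2)] by metis
        have "r = a \<or> r = b" using pair_cases[OF b rX(1) True E_sym[OF that(3)]] .
        moreover have "r \<noteq> a" using rX(2) E_irrefl by blast
        moreover have "p = a \<or> p = b" using pair_cases[OF b that(4,5) E_sym[OF that(6)]] .
        ultimately show ?thesis by blast
      qed
      have "\<not> E u y"
        using pw[OF w(1,2) r(2) yX(1) _ yX(4)] y(2) yX(2) E_irrefl by blast
      then have y2: "y \<in> lay u 2" using lay[of y w] yX w(1) by simp
      have wy: "same_type u w y" by (rule adj[OF w(1) y2 yX(3)])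
      have yw': "y \<noteq> w'" using yX(3) 3 by blast
      show ?thesis
      proof (cases "E y w'")
        case True
        then show ?thesis using tr[OF y2 wy adj[OF y2 w'(1)]] by blast
      next
        case False
        obtain q where q: "q \<in> N a" "E q y" "E q w'"
          using local_common[OF aX(1) _ N(2) yw' False] yX by (metis mem_nb)
        have qX: "q \<in> X" "E a q" "E y q" using q E_sym by simp_all
        have "\<not> E u q"
        proof
          assume "E u q"
          then have "q = a \<or> q = r" using pw[OF w'(1,2) r(3) qX(1) _ q(3)] by blast
          then show False using qX nyr E_irrefl by blast
        qed
        then have q2: "q \<in> lay u 2" using lay[OF q(1,2) y2] by blast
        have "same_type u y w'" by (rule tr[OF q2 adj[OF y2 q2 qX(3)] adj[OF q2 w'(1) q(3)]])
        then show ?thesis using tr[OF y2 wy] by blast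
      qed
    qed
  qed
qed

text \<open>Adjacent vertices of \<open>N u\<close> have a common neighbour in the second layer
  (\<open>bridge\<close>), so the type spreads along paths of \<open>N u\<close>, which has diameter
  2.\<close>

lemma same_type_all:
  assumes k: "k = 10" and u: "u \<in> X" and w: "w \<in> lay u 2" and w': "w' \<in> lay u 2"
  shows "same_type u w w'"
proof -
  have tr: "same_type u p r" if "q \<in> lay u 2" "same_type u p q" "same_type u q r" for p q r
    by (rule same_type_trans[OF k u that])
  note loc = same_type_local[OF k u]
  have bridge: "\<exists>v\<in>lay u 2. E a v \<and> E b v" if ab: "a \<in> N u" "b \<in> N u" "E a b" for a b
  proof -
    have D: "a \<in> X" "b \<in> X" "E u a" "E u b" using ab by simp_all
    have "card (N a \<inter> N b) = 3" using card_NN[OF D(1,2) ab(3)] k kl by simp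
    then have "\<not> N a \<inter> N b \<subseteq> {u}" using card_mono[of "{u}" "N a \<inter> N b"] by fastforce
    then obtain v where v: "v \<in> N a \<inter> N b" "v \<noteq> u" by blast
    then have vD: "v \<in> X" "E a v" "E b v" by simp_all
    have "\<not> E u v" using no_K4[of u a b v] u D ab(3) vD by blast
    then have "v \<in> lay u 2" using lay_2I[OF u vD(1) v(2) _ ab(1) vD(2)] by blast
    then show ?thesis using vD by blast
  qed
  obtain a b where ab: "N u \<inter> N w = {a, b}" using lay_2_pair[OF u w] by metis
  obtain a' b' where ab': "N u \<inter> N w' = {a', b'}" using lay_2_pair[OF u w'] by metis
  have a: "a \<in> N u" "E a w" and a': "a' \<in> N u" "E a' w'" using pairD[OF ab] pairD[OF ab'] by simp_all
  have step: "same_type u p q"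
    if "E c d" "c \<in> N u" "d \<in> N u" "p \<in> lay u 2" "q \<in> lay u 2" "E c p" "E d q" for c d p q
  proof -
    note cd = that
    obtain v where v: "v \<in> lay u 2" "E c v" "E d v" using bridge[OF cd(2,3,1)] by blast
    show ?thesis
      by (rule tr[OF v(1) loc[OF that(2,4,6) v(1,2)] loc[OF that(3) v(1,3) that(5,7)]])
  qed
  consider "a = a'" | "E a a'" | "a \<noteq> a'" "\<not> E a a'" by blast
  then show ?thesis
  proof cases
    case 1
    then show ?thesis using loc[OF a(1) w a(2) w'] a' by blast
  next
    case 2
    then show ?thesis using step[OF 2 a(1) a'(1) w w' a(2) a'(2)] by blast
  next
    case 3
    obtain e where e: "e \<in> N u" "E e a" "E e a'" using local_common[OF u a(1) a'(1) 3] by metis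
    obtain v where v: "v \<in> lay u 2" "E a v" "E e v" using bridge[OF a(1) e(1) E_sym[OF e(2)]] by blast
    have "same_type u v w'" by (rule step[OF e(3,1) a'(1) v(1) w' v(3) a'(2)])
    then show ?thesis using tr[OF v(1) loc[OF a(1) w a(2) v(1,2)]] by blast
  qed
qed

lemma card_Y_const:
  assumes "k = 10" "u \<in> X" "z \<in> lay u 3" "z' \<in> lay u 3"
  shows "card (Y u z) = card (Y u z')"
proof -
  obtain w where "w \<in> Y u z" using Y_nonempty[OF assms(2,3)] by blast
  then have w: "w \<in> lay u 2" "E z w" using mem_Y[OF assms(2)] by simp_all
  obtain w' where "w' \<in> Y u z'" using Y_nonempty[OF assms(2,4)] by blast
  then have w': "w' \<in> lay u 2" "E z' w'" using mem_Y[OF assms(2)] by simp_all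
  show ?thesis
    using same_type_all[OF assms(1,2) w(1) w'(1)] w w' assms(3,4) unfolding same_type_def by blast
qed

end

section \<open>Intersection arrays\<close>

context terwilliger_graph
begin

text \<open>Intersection numbers as seen from one vertex, since different vertices might have
  different arrays. Both clauses for \<open>i\<close> concern the edges between the same two layers,
  so \<open>cs ! i\<close> is \<open>c\<close> with subscript \<open>i + 1\<close>.\<close>

definition array_at :: "'a \<Rightarrow> nat list \<Rightarrow> nat list \<Rightarrow> bool" where
  "array_at u bs cs \<longleftrightarrow> length bs = length cs \<and>
     lay u (length cs) \<noteq> {} \<and> lay u (Suc (length cs)) = {} \<and>
     (\<forall>i < length cs. (\<forall>w\<in>lay u (Suc i). card (N w \<inter> lay u i) = cs ! i) \<and>
                      (\<forall>w\<in>lay u i. card (N w \<inter> lay u (Suc i)) = bs ! i))"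

lemma card_lay_step:
  assumes "u \<in> X" "\<forall>w\<in>lay u (Suc i). card (N w \<inter> lay u i) = c"
    "\<forall>w\<in>lay u i. card (N w \<inter> lay u (Suc i)) = b"
  shows "card (lay u i) * b = card (lay u (Suc i)) * c"
proof -
  have "(\<Sum>w\<in>lay u i. card {z \<in> lay u (Suc i). E w z}) = (\<Sum>z\<in>lay u (Suc i). card {w \<in> lay u i. E w z})"
    by (rule sum_card_swap) (simp_all add: finite_lay assms(1))
  moreover have "{z \<in> lay u (Suc i). E w z} = N w \<inter> lay u (Suc i)" for w
    using lay_sub[OF assms(1), of "Suc i"] by auto
  moreover have "{w \<in> lay u i. E w z} = N z \<inter> lay u i" for z
    using lay_sub[OF assms(1), of i] E_commute by auto
  ultimately show ?thesis using assms(2,3) by simp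
qed

lemma lay_empty_mono: "i \<le> j \<Longrightarrow> lay u i = {} \<Longrightarrow> lay u j = {}"
proof (induction j rule: dec_induct)
  case (step j)
  show ?case
  proof (rule ccontr)
    assume "lay u (Suc j) \<noteq> {}"
    then obtain w where "w \<in> lay u (Suc j)" by blast
    then show False using step lay_pred by blast
  qed
qed simp

lemma card_array:
  assumes u: "u \<in> X" and arr: "array_at u bs cs" and conn: "\<And>w. w \<in> X \<Longrightarrow> \<exists>i. w \<in> lay u i"
  shows "card X = (\<Sum>i\<le>length cs. card (lay u i))"
proof -
  have "X = (\<Union>i\<in>{..length cs}. lay u i)"
  proof
    show "(\<Union>i\<in>{..length cs}. lay u i) \<subseteq> X" using lay_sub[OF u] by blast
    show "X \<subseteq> (\<Union>i\<in>{..length cs}. lay u i)"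
    proof
      fix w assume "w \<in> X"
      then obtain i where i: "w \<in> lay u i" using conn by blast
      have "i \<le> length cs"
      proof (rule ccontr)
        assume "\<not> i \<le> length cs"
        then have "lay u i = {}" using arr lay_empty_mono[of "Suc (length cs)" i u] unfolding array_at_def by simp
        then show False using i by simp
      qed
      then show "w \<in> (\<Union>i\<in>{..length cs}. lay u i)" using i by blast
    qed
  qed
  moreover have "card (\<Union>i\<in>{..length cs}. lay u i) = (\<Sum>i\<le>length cs. card (lay u i))"
    by (rule card_UN_disjoint) (use finite_lay[OF u] lay_disjoint in blast)+
  ultimately show ?thesis by simp
qed

end

context small_terwilliger
begin

lemma first_numbers:
  assumes u: "u \<in> X"
  shows "w \<in> lay u 0 \<Longrightarrow> card (N w \<inter> lay u (Suc 0)) = k"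
    "w \<in> lay u (Suc 0) \<Longrightarrow> card (N w \<inter> lay u 0) = 1"
    "w \<in> lay u (Suc 0) \<Longrightarrow> card (N w \<inter> lay u 2) = k - 1 - l"
    "w \<in> lay u 2 \<Longrightarrow> card (N w \<inter> lay u (Suc 0)) = 2"
proof -
  show "w \<in> lay u 0 \<Longrightarrow> card (N w \<inter> lay u (Suc 0)) = k"
    using card_N[OF u] by (simp add: lay_1'[OF u])
  show "card (N w \<inter> lay u 0) = 1" if "w \<in> lay u (Suc 0)"
  proof -
    have "N w \<inter> {u} = {u}" using that E_sym u by (simp add: lay_1'[OF u])
    then show ?thesis by simp
  qed
  show "card (N w \<inter> lay u 2) = k - 1 - l" if "w \<in> lay u (Suc 0)"
  proof -
    have w: "w \<in> X" "E u w" "E w u" using that E_sym by (simp_all add: lay_1'[OF u])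
    have "N w \<inter> lay u 2 = N w - insert u (N u \<inter> N w)"
    proof
      show "N w \<inter> lay u 2 \<subseteq> N w - insert u (N u \<inter> N w)" using lay_2_mem[OF u] by auto
      show "N w - insert u (N u \<inter> N w) \<subseteq> N w \<inter> lay u 2"
      proof
        fix x assume "x \<in> N w - insert u (N u \<inter> N w)"
        then have x: "x \<in> X" "E w x" "x \<noteq> u" "\<not> E u x" by auto
        then have "x \<in> lay u 2" using lay_2I[OF u x(1,3,4), of w] w by simp
        then show "x \<in> N w \<inter> lay u 2" using x by simp
      qed
    qed
    moreover have "card (N w - insert u (N u \<inter> N w)) = card (N w) - card (insert u (N u \<inter> N w))"
      by (rule card_Diff_subset) (use w u in auto)
    moreover have "card (insert u (N u \<inter> N w)) = l + 1"
      using card_NN[OF u w(1,2)] E_irrefl by simp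
    ultimately show ?thesis using card_N[OF w(1)] by simp
  qed
  show "card (N w \<inter> lay u (Suc 0)) = 2" if "w \<in> lay u 2"
  proof -
    obtain a b where "N u \<inter> N w = {a, b}" "a \<noteq> b" using lay_2_pair[OF u \<open>w \<in> lay u 2\<close>] by metis
    then show ?thesis by (simp add: lay_1'[OF u] Int_commute)
  qed
qed

lemma lay_nonempty:
  assumes u: "u \<in> X"
  shows "lay u 2 \<noteq> {}" "lay u 3 \<noteq> {}"
proof -
  have "N u \<noteq> {}" using card_N[OF u] kl by auto
  then obtain w where "w \<in> lay u (Suc 0)" unfolding lay_1'[OF u, symmetric] by blast
  then have "card (N w \<inter> lay u 2) \<noteq> 0" using first_numbers(3)[OF u] kl by auto
  then show "lay u 2 \<noteq> {}" by auto
  then obtain w where "w \<in> lay u 2" by blast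
  then have "card (N w \<inter> lay u 3) \<noteq> 0" using card_b2[OF u] kl by auto
  then show "lay u 3 \<noteq> {}" by auto
qed

lemma array_at_3:
  "array_at u [b0, b1, b2] [c1, c2, c3] \<longleftrightarrow> lay u 3 \<noteq> {} \<and> lay u 4 = {} \<and>
    (\<forall>w\<in>lay u 0. card (N w \<inter> lay u (Suc 0)) = b0) \<and> (\<forall>w\<in>lay u (Suc 0). card (N w \<inter> lay u 0) = c1) \<and>
    (\<forall>w\<in>lay u (Suc 0). card (N w \<inter> lay u 2) = b1) \<and> (\<forall>w\<in>lay u 2. card (N w \<inter> lay u (Suc 0)) = c2) \<and>
    (\<forall>w\<in>lay u 2. card (N w \<inter> lay u 3) = b2) \<and> (\<forall>w\<in>lay u 3. card (N w \<inter> lay u 2) = c3)"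
  unfolding array_at_def by (simp add: numeral_eq_Suc All_less_Suc del: lay_0) blast

lemma array_at_4:
  "array_at u [b0, b1, b2, b3] [c1, c2, c3, c4] \<longleftrightarrow> lay u 4 \<noteq> {} \<and> lay u 5 = {} \<and>
    (\<forall>w\<in>lay u 0. card (N w \<inter> lay u (Suc 0)) = b0) \<and> (\<forall>w\<in>lay u (Suc 0). card (N w \<inter> lay u 0) = c1) \<and>
    (\<forall>w\<in>lay u (Suc 0). card (N w \<inter> lay u 2) = b1) \<and> (\<forall>w\<in>lay u 2. card (N w \<inter> lay u (Suc 0)) = c2) \<and>
    (\<forall>w\<in>lay u 2. card (N w \<inter> lay u 3) = b2) \<and> (\<forall>w\<in>lay u 3. card (N w \<inter> lay u 2) = c3) \<and>
    (\<forall>w\<in>lay u 3. card (N w \<inter> lay u 4) = b3) \<and> (\<forall>w\<in>lay u 4. card (N w \<inter> lay u 3) = c4)"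
  unfolding array_at_def by (simp add: numeral_eq_Suc All_less_Suc del: lay_0) blast

lemma array_3:
  assumes u: "u \<in> X" and "\<And>z. z \<in> lay u 3 \<Longrightarrow> card (Y u z) = c" "lay u 4 = {}"
  shows "array_at u [k, k - 1 - l, k - 2 * l] [1, 2, c]"
proof -
  have "card (N z \<inter> lay u 2) = c" if "z \<in> lay u 3" for z
    using assms(2)[OF that] by (simp add: Y_def)
  then show ?thesis
    unfolding array_at_3 using first_numbers[OF u] card_b2[OF u] lay_nonempty(2)[OF u] assms(3) by blast
qed

lemma icosahedron_array:
  assumes k: "k = 5" and u: "u \<in> X"
  shows "array_at u [5, 2, 1] [1, 2, 5]"
proof -
  have l: "l = 2" using kl k by simp
  have "card (Y u z) = 5" if "z \<in> lay u 3" for z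
    using icosahedron_Y[OF k u that] card_N lay_3D(1)[OF u that] k by simp
  moreover have "lay u 4 = {}"
  proof (rule ccontr)
    assume "lay u 4 \<noteq> {}"
    then obtain x where x: "x \<in> lay u (Suc 3)" by auto
    then obtain z where z: "z \<in> lay u 3" "E z x" by (rule lay_pred)
    have "x \<in> X" using x lay_sub[OF u] by blast
    then have "x \<in> Y u z" using z icosahedron_Y[OF k u z(1)] by simp
    then have "x \<in> lay u 2" using mem_Y[OF u] by blast
    then show False using lay_disjoint[OF x] by fastforce
  qed
  ultimately show ?thesis using array_3[OF u] k l by simp
qed

lemma lay_3_nb:
  assumes "u \<in> X" "z \<in> lay u 3" "x \<in> N z"
  shows "x \<in> lay u 2 \<or> x \<in> lay u 3 \<or> x \<in> lay u 4"
proof -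
  obtain j where j: "x \<in> lay u j" "j \<le> Suc 3" "3 \<le> Suc j"
    using lay_step[OF assms(2) lay_3D(1)[OF assms(1,2)], of x] assms(3) by auto
  then have "j = 2 \<or> j = 3 \<or> j = 4" by linarith
  then show ?thesis using j(1) by blast
qed

lemma Y_nb_lay:
  assumes "u \<in> X" "w \<in> Y u z" "x \<in> N w"
  shows "x \<notin> lay u 4"
proof
  assume x: "x \<in> lay u 4"
  have "w \<in> lay u 2" using assms mem_Y by blast
  then obtain j where j: "x \<in> lay u j" "j \<le> Suc 2"
    using lay_step[of w u 2 x] assms(1,3) lay_sub by (metis mem_nb subsetD)
  then show False using lay_disjoint[OF x j(1)] by simp
qed

text \<open>By \<open>pentagon_outer\<close> each remaining neighbour of \<open>z\<close> is
  adjacent to a vertex of the second layer, so there is no fourth layer.\<close>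

lemma Doro_array:
  assumes k: "k = 10" and u: "u \<in> X" and c5: "\<And>z. z \<in> lay u 3 \<Longrightarrow> card (Y u z) = 5"
  shows "array_at u [10, 6, 4] [1, 2, 5]"
proof -
  have l: "l = 3" using kl k by simp
  have "lay u 4 = {}"
  proof (rule ccontr)
    assume "lay u 4 \<noteq> {}"
    then obtain x where x: "x \<in> lay u (Suc 3)" by auto
    then obtain z where z: "z \<in> lay u 3" "E z x" by (rule lay_pred)
    have "x \<in> X" using x lay_sub[OF u] by blast
    have "x \<notin> Y u z" using mem_Y[OF u] lay_disjoint[OF x] by fastforce
    then have "card (Y u z \<inter> N x) = 1"
      using pentagon_outer[OF k lay_3D(1)[OF u z(1)] _ Y_nonempty[OF u z(1)] card_Y_nb[OF u z(1)] c5[OF z(1)]]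
        z \<open>x \<in> X\<close> by (simp add: Y_def)
    then obtain w where w: "w \<in> Y u z" "E x w" by (metis Int_iff card_1_singletonE insertI1 mem_nb)
    then show False using Y_nb_lay[OF u w(1), of x] x E_sym \<open>x \<in> X\<close> by simp
  qed
  then show ?thesis using array_3[OF u c5] k l by simp
qed

lemma hexagon_center:
  assumes k: "k = 10" and u: "u \<in> X" and c6: "\<And>z. z \<in> lay u 3 \<Longrightarrow> card (Y u z) = 6" and z: "z \<in> lay u 3"
  obtains r where "r \<in> N z - Y u z" "Y u z \<inter> N r = {}" "N z \<inter> N r = N z - Y u z - {r}"
    "\<And>q. q \<in> N z - Y u z - {r} \<Longrightarrow> card (Y u z \<inter> N q) = 2" "N z - Y u z - {r} \<subseteq> lay u 3"
proof -
  have "Y u z \<subseteq> N z" by (simp add: Y_def)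
  then obtain r where r: "r \<in> N z - Y u z" "Y u z \<inter> N r = {}" "N z \<inter> N r = N z - Y u z - {r}"
    "\<And>q. q \<in> N z - Y u z - {r} \<Longrightarrow> card (Y u z \<inter> N q) = 2"
    using hexagon_outer[OF k lay_3D(1)[OF u z] _ Y_nonempty[OF u z] card_Y_nb[OF u z] c6[OF z]] by metis
  have "N z - Y u z - {r} \<subseteq> lay u 3"
  proof
    fix q assume q: "q \<in> N z - Y u z - {r}"
    then have "card (Y u z \<inter> N q) = 2" by (rule r(4))
    then have "Y u z \<inter> N q \<noteq> {}" by auto
    then obtain w where w: "w \<in> Y u z" "E q w" by auto
    then have "q \<in> N w" using q E_sym by simp
    then have "q \<notin> lay u 4" using Y_nb_lay[OF u w(1)] by blast
    moreover have "q \<notin> lay u 2" using q mem_Y[OF u, of q z] by auto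
    ultimately show "q \<in> lay u 3" using lay_3_nb[OF u z, of q] q by blast
  qed
  then show ?thesis using that[OF r] by blast
qed

text \<open>Let \<open>r\<close> be the vertex of \<open>N z\<close> without neighbours on the
  hexagon. Were it in the third layer, then
  \<open>Y u r \<inter> N z = Y u z \<inter> N r = {}\<close> would give \<open>z\<close> the same
  role for \<open>r\<close>. A common neighbour \<open>q\<close> of both, with its own exceptional
  vertex \<open>s\<close>, would then make \<open>q, s, z, r\<close> pairwise adjacent.\<close>

lemma hexagon_antipode:
  assumes k: "k = 10" and u: "u \<in> X" and c6: "\<And>z. z \<in> lay u 3 \<Longrightarrow> card (Y u z) = 6" and z: "z \<in> lay u 3"
  obtains r where "N z \<inter> lay u 4 = {r}" "N z \<inter> N r \<subseteq> lay u 3"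
proof -
  obtain r where r: "r \<in> N z - Y u z" "Y u z \<inter> N r = {}" "N z \<inter> N r = N z - Y u z - {r}"
    "\<And>q. q \<in> N z - Y u z - {r} \<Longrightarrow> card (Y u z \<inter> N q) = 2" "N z - Y u z - {r} \<subseteq> lay u 3"
    using hexagon_center[OF k u c6 z] by metis
  have notY: "p \<notin> Y u q" if "p \<in> lay u 3" for p q
    using mem_Y[OF u, of p q] lay_disjoint[OF that] by fastforce
  have Ycomm: "Y u p \<inter> N q = Y u q \<inter> N p" for p q by (auto simp: Y_def)
  have zX: "z \<in> X" using lay_3D[OF u z] by simp
  have rX: "r \<in> X" "E z r" "E r z" using r(1) E_sym by simp_all
  have "r \<notin> lay u 3"
  proof
    assume r3: "r \<in> lay u 3"
    obtain r' where r': "Y u r \<inter> N r' = {}" "N r \<inter> N r' = N r - Y u r - {r'}"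
      "\<And>q. q \<in> N r - Y u r - {r'} \<Longrightarrow> card (Y u r \<inter> N q) = 2"
      using hexagon_center[OF k u c6 r3] by metis
    have zr: "z \<in> N r - Y u r" using zX rX notY[OF z] by simp
    have "Y u r \<inter> N z = {}" using r(2) Ycomm by metis
    then have "z = r'" using r'(3)[of z] zr by auto
    have "card (N z \<inter> N r) = 3" using card_NN[OF zX rX(1,2)] k kl by simp
    then have "N z \<inter> N r \<noteq> {}" by (metis card.empty zero_neq_numeral)
    then obtain q where q: "q \<in> N z \<inter> N r" by blast
    have q1: "q \<in> N z - Y u z - {r}" using q r(3) by blast
    have q2: "q \<in> N r - Y u r - {r'}" using q r'(2) \<open>z = r'\<close> by blast
    have q3: "q \<in> lay u 3" using q1 r(5) by blast
    have qX: "q \<in> X" "E q z" "E q r" using q E_sym by simp_all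
    obtain s where s: "s \<in> N q - Y u q" "Y u q \<inter> N s = {}" "N q \<inter> N s = N q - Y u q - {s}"
      using hexagon_center[OF k u c6 q3] by metis
    have "card (Y u q \<inter> N z) = 2" "card (Y u q \<inter> N r) = 2"
      using r(4)[OF q1] r'(3)[OF q2] Ycomm by metis+
    then have "z \<noteq> s" "r \<noteq> s" using s(2) by auto
    then have "z \<in> N q \<inter> N s" "r \<in> N q \<inter> N s"
      unfolding s(3) using zX rX qX notY[OF z] notY[OF r3] by simp_all
    then show False using no_K4[of q s z r] qX zX rX s(1) by simp
  qed
  moreover have "r \<notin> lay u 2" using r(1) mem_Y[OF u, of r z] rX by blast
  ultimately have r4: "r \<in> lay u 4" using lay_3_nb[OF u z, of r] r(1) by blast
  have "N z \<inter> lay u 4 = {r}"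
  proof
    show "N z \<inter> lay u 4 \<subseteq> {r}"
    proof
      fix q assume q: "q \<in> N z \<inter> lay u 4"
      then have "q \<notin> lay u 3" "q \<notin> lay u 2" using lay_disjoint[of q u 4] by fastforce+
      then show "q \<in> {r}" using q r(5) mem_Y[OF u, of q z] by blast
    qed
    show "{r} \<subseteq> N z \<inter> lay u 4" using r(1) r4 by simp
  qed
  then show ?thesis using that r(3,5) by simp
qed

text \<open>By \<open>hexagon_antipode\<close>, the third-layer neighbours of a fourth-layer vertex
  are closed under adjacency in its local graph. So they are all its neighbours, and no fifth layer
  exists.\<close>

lemma Conway_Smith_array:
  assumes k: "k = 10" and u: "u \<in> X" and c6: "\<And>z. z \<in> lay u 3 \<Longrightarrow> card (Y u z) = 6"
  shows "array_at u [10, 6, 4, 1] [1, 2, 6, 10]"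
proof -
  have l: "l = 3" using kl k by simp
  have b3: "card (N z \<inter> lay u 4) = 1" if "z \<in> lay u 3" for z
  proof -
    note z = that
    obtain r where "N z \<inter> lay u 4 = {r}" using hexagon_antipode[OF k u c6 z] by metis
    then show ?thesis by simp
  qed
  have N4: "N r \<inter> lay u 3 = N r" if r: "r \<in> lay u 4" for r
  proof (rule local_closed)
    show "r \<in> X" using r lay_sub[OF u] by blast
    show "N r \<inter> lay u 3 \<subseteq> N r" by simp
    have "r \<in> lay u (Suc 3)" using r by simp
    then obtain z where z: "z \<in> lay u 3" "E z r" by (rule lay_pred)
    then have "z \<in> N r \<inter> lay u 3" using E_sym lay_3D[OF u] by simp
    then show "N r \<inter> lay u 3 \<noteq> {}" by blast
    fix w assume w: "w \<in> N r \<inter> lay u 3"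
    then obtain r' where r': "N w \<inter> lay u 4 = {r'}" "N w \<inter> N r' \<subseteq> lay u 3"
      using hexagon_antipode[OF k u c6, of w] by blast
    have "r \<in> N w \<inter> lay u 4" using w r \<open>r \<in> X\<close> E_sym by simp
    then have "r = r'" using r'(1) by simp
    then show "N r \<inter> N w \<subseteq> N r \<inter> lay u 3" using r'(2) by blast
  qed
  have c4: "card (N r \<inter> lay u 3) = 10" if "r \<in> lay u 4" for r
    using N4[OF that] card_N[of r] k lay_sub[OF u] that by auto
  have c3: "card (N z \<inter> lay u 2) = 6" if "z \<in> lay u 3" for z
    using c6[OF that] by (simp add: Y_def)
  have "lay u 5 = {}"
  proof (rule ccontr)
    assume "lay u 5 \<noteq> {}"
    then obtain x where x: "x \<in> lay u (Suc 4)" by auto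
    then obtain r where r: "r \<in> lay u 4" "E r x" by (rule lay_pred)
    have "x \<in> X" using x lay_sub[OF u] by blast
    then have "x \<in> N r \<inter> lay u 3" unfolding N4[OF r(1)] using r(2) by simp
    then show False using lay_disjoint[OF x, of 3] by simp
  qed
  moreover have "lay u 4 \<noteq> {}" using b3 lay_nonempty(2)[OF u] by (metis One_nat_def all_not_in_conv card.empty inf_bot_right zero_neq_one)
  moreover have "card (N w \<inter> lay u (Suc 0)) = 10" if "w \<in> lay u 0" for w
    using first_numbers(1)[OF u that] k by simp
  moreover have "card (N w \<inter> lay u 2) = 6" if "w \<in> lay u (Suc 0)" for w
    using first_numbers(3)[OF u that] k l by simp
  moreover have "card (N w \<inter> lay u 3) = 4" if "w \<in> lay u 2" for w
    using card_b2[OF u that] k l by simp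
  ultimately show ?thesis
    unfolding array_at_4 using first_numbers(2,4)[OF u] b3 c3 c4 by blast
qed

lemma petersen_arrays:
  assumes k: "k = 10" and u: "u \<in> X"
  shows "array_at u [10, 6, 4] [1, 2, 5] \<or> array_at u [10, 6, 4, 1] [1, 2, 6, 10]"
proof -
  obtain z where z: "z \<in> lay u 3" using lay_nonempty(2)[OF u] by blast
  have "card (Y u z') = card (Y u z)" if "z' \<in> lay u 3" for z'
    using card_Y_const[OF k u that z] .
  then show ?thesis
    using card_Y[OF k u z] Doro_array[OF k u] Conway_Smith_array[OF k u] by metis
qed

text \<open>The layers have sizes 1, 10, 30, 24.\<close>

lemma card_Doro:
  assumes "u \<in> X" "array_at u [10, 6, 4] [1, 2, 5]" "\<And>w. w \<in> X \<Longrightarrow> \<exists>i. w \<in> lay u i"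
  shows "card X = 65"
proof -
  have st: "card (lay u i) * [10, 6, 4] ! i = card (lay u (Suc i)) * [1, 2, 5] ! i" if "i < 3" for i
    by (rule card_lay_step[OF assms(1)]) (use assms(2) that in \<open>simp_all add: array_at_def\<close>)
  have "card (lay u (Suc 0)) = 10" using st[of 0] by simp
  moreover have "card (lay u 2) = 30" using st[of 1] calculation by (simp add: numeral_2_eq_2)
  moreover have "card (lay u 3) = 24" using st[of 2] calculation by simp
  ultimately show ?thesis
    using card_array[OF assms] by (simp add: numeral_eq_Suc)
qed

text \<open>The layers have sizes 1, 10, 30, 20, 2.\<close>

lemma card_Conway_Smith:
  assumes "u \<in> X" "array_at u [10, 6, 4, 1] [1, 2, 6, 10]" "\<And>w. w \<in> X \<Longrightarrow> \<exists>i. w \<in> lay u i"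
  shows "card X = 63"
proof -
  have st: "card (lay u i) * [10, 6, 4, 1] ! i = card (lay u (Suc i)) * [1, 2, 6, 10] ! i" if "i < 4" for i
    by (rule card_lay_step[OF assms(1)]) (use assms(2) that in \<open>simp_all add: array_at_def\<close>)
  have "card (lay u (Suc 0)) = 10" using st[of 0] by simp
  moreover have "card (lay u 2) = 30" using st[of 1] calculation by (simp add: numeral_2_eq_2)
  moreover have "card (lay u 3) = 20" using st[of 2] calculation by simp
  moreover have "card (lay u 4) = 2" using st[of 3] calculation by simp
  ultimately show ?thesis
    using card_array[OF assms] by (simp add: numeral_eq_Suc)
qed

lemma arrays:
  assumes conn: "\<And>u w. u \<in> X \<Longrightarrow> w \<in> X \<Longrightarrow> \<exists>i. w \<in> lay u i"
  shows "(\<forall>u\<in>X. array_at u [5, 2, 1] [1, 2, 5]) \<or> (\<forall>u\<in>X. array_at u [10, 6, 4] [1, 2, 5]) \<or>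
    (\<forall>u\<in>X. array_at u [10, 6, 4, 1] [1, 2, 6, 10])"
proof (cases "k = 5")
  case True
  then show ?thesis using icosahedron_array by blast
next
  case False
  then have k: "k = 10" using kl by simp
  show ?thesis
  proof (cases "card X = 65")
    case True
    then have "\<not> array_at u [10, 6, 4, 1] [1, 2, 6, 10]" if "u \<in> X" for u
      using card_Conway_Smith[OF that _ conn[OF that]] by auto
    then show ?thesis using petersen_arrays[OF k] by blast
  next
    case False
    then have "\<not> array_at u [10, 6, 4] [1, 2, 5]" if "u \<in> X" for u
      using card_Doro[OF that _ conn[OF that]] by auto
    then show ?thesis using petersen_arrays[OF k] by blast
  qed
qed

end

section \<open>The Koolen--Park equality\<close>

context sgraph
begin

text \<open>
  Every vertex of \<open>D\<close> meeting \<open>n\<close> of the closed neighbourhoods of \<open>S\<close> satisfies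
  \<open>2 * n - n * (n - 1) \<le> 2\<close>; summing over \<open>D\<close> gives the second Bonferroni inequality.
\<close>

lemma coclique_bonferroni_equality:
  assumes D: "finite D" "\<And>s. s \<in> D \<Longrightarrow> card {w \<in> D. w = s \<or> E s w} = p"
    and S: "S \<subseteq> D" "card S = c" "\<And>s t. s \<in> S \<Longrightarrow> t \<in> S \<Longrightarrow> \<not> E s t"
    and q: "\<And>s t. s \<in> S \<Longrightarrow> t \<in> S \<Longrightarrow> s \<noteq> t \<Longrightarrow> card {w \<in> D. E s w \<and> E t w} \<le> q"
    and eq: "2 * card D + c * (c - 1) * q = 2 * c * p"
    and st: "s \<in> S" "t \<in> S" "s \<noteq> t"
  shows "card {w \<in> D. E s w \<and> E t w} = q"
proof -
  have finS: "finite S" using S(1) D(1) by (rule finite_subset)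
  define P where "P = (SIGMA s:S. S - {s})"
  have P: "finite P" "card P = c * (c - 1)"
    unfolding P_def using finS S(2) by (simp_all add: card_SigmaI)
  define n where "n w = card {s \<in> S. w = s \<or> E s w}" for w
  define f where "f x = card {w \<in> D. E (fst x) w \<and> E (snd x) w}" for x
  have s1: "(\<Sum>w\<in>D. n w) = c * p"
  proof -
    have "(\<Sum>w\<in>D. n w) = (\<Sum>s\<in>S. card {w \<in> D. w = s \<or> E s w})"
      unfolding n_def by (rule sum_card_swap[OF D(1) finS])
    also have "\<dots> = (\<Sum>s\<in>S. p)" using D(2) S(1) by (intro sum.cong) auto
    finally show ?thesis using S(2) by simp
  qed
  have s2: "(\<Sum>w\<in>D. n w * (n w - 1)) = (\<Sum>x\<in>P. f x)"
  proof -
    have "(\<Sum>w\<in>D. n w * (n w - 1))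
        = (\<Sum>w\<in>D. card {x \<in> P. (w = fst x \<or> E (fst x) w) \<and> (w = snd x \<or> E (snd x) w)})"
    proof (rule sum.cong[OF refl])
      fix w
      let ?A = "{s \<in> S. w = s \<or> E s w}"
      have "{x \<in> P. (w = fst x \<or> E (fst x) w) \<and> (w = snd x \<or> E (snd x) w)} = (SIGMA s:?A. ?A - {s})"
        unfolding P_def by auto
      then show "n w * (n w - 1)
          = card {x \<in> P. (w = fst x \<or> E (fst x) w) \<and> (w = snd x \<or> E (snd x) w)}"
        unfolding n_def using finS by (simp add: card_SigmaI)
    qed
    also have "\<dots> = (\<Sum>x\<in>P. card {w \<in> D. (w = fst x \<or> E (fst x) w) \<and> (w = snd x \<or> E (snd x) w)})"
      by (rule sum_card_swap[OF D(1) P(1)])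
    also have "\<dots> = (\<Sum>x\<in>P. f x)"
    proof (rule sum.cong[OF refl])
      fix x assume "x \<in> P"
      then have x: "fst x \<in> S" "snd x \<in> S" "fst x \<noteq> snd x" unfolding P_def by auto
      then have "\<not> E (fst x) (snd x)" "\<not> E (snd x) (fst x)" using S(3) by blast+
      then have "{w \<in> D. (w = fst x \<or> E (fst x) w) \<and> (w = snd x \<or> E (snd x) w)}
          = {w \<in> D. E (fst x) w \<and> E (snd x) w}" using x(3) by auto
      then show "card {w \<in> D. (w = fst x \<or> E (fst x) w) \<and> (w = snd x \<or> E (snd x) w)} = f x"
        by (simp add: f_def)
    qed
    finally show ?thesis .
  qed
  \<comment> \<open>This is \<open>(n - 1) * (n - 2) \<ge> 0\<close> for
    \<open>n = n w\<close>.\<close>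
  have "2 * n w \<le> n w * (n w - 1) + 2" for w
  proof (cases "n w \<le> 2")
    case True
    then have "n w = 0 \<or> n w = 1 \<or> n w = 2" by linarith
    then show ?thesis by (elim disjE) simp_all
  next
    case False
    then have "n w * 2 \<le> n w * (n w - 1)" by (intro mult_le_mono2) simp
    then show ?thesis by linarith
  qed
  then have "(\<Sum>w\<in>D. 2 * n w) \<le> (\<Sum>w\<in>D. n w * (n w - 1) + 2)" by (rule sum_mono)
  also have "\<dots> = (\<Sum>x\<in>P. f x) + 2 * card D" by (simp only: sum.distrib s2 sum_constant) simp
  finally have "2 * c * p \<le> (\<Sum>x\<in>P. f x) + 2 * card D"
    by (simp add: s1 flip: sum_distrib_left)
  then have "(\<Sum>x\<in>P. q) \<le> (\<Sum>x\<in>P. f x)" using eq P(2) by simp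
  moreover have le: "f x \<le> q" if "x \<in> P" for x
  proof -
    have "fst x \<in> S" "snd x \<in> S" "fst x \<noteq> snd x" using that unfolding P_def by auto
    then show ?thesis unfolding f_def by (rule q)
  qed
  then have "(\<Sum>x\<in>P. f x) \<le> (\<Sum>x\<in>P. q)" by (rule sum_mono)
  ultimately have "(\<Sum>x\<in>P. f x) = (\<Sum>x\<in>P. q)" by simp
  moreover have "(s, t) \<in> P" using st unfolding P_def by simp
  ultimately have "f (s, t) = q" using sum_mono_inv[of f P "\<lambda>_. q" "(s, t)"] le P(1) by blast
  then show ?thesis by (simp add: f_def)
qed

end

text \<open>The maximum is attained at some \<open>c'\<close>; multiplying by
  \<open>2 * (c' choose 2) = c' * (c' - 1)\<close> removes the division.\<close>

lemma max_equality:
  fixes m k l c :: nat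
  assumes "2 \<le> c" "1 < m"
    and "real m - 1 = Max ((\<lambda>c'. (real c' * (real l + 1) - real k) / real (c' choose 2)) ` {2..c})"
  obtains c' where "2 \<le> c'" "c' \<le> c" "2 * k + c' * (c' - 1) * (m - 1) = 2 * c' * (l + 1)"
proof -
  let ?f = "\<lambda>c'. (real c' * (real l + 1) - real k) / real (c' choose 2)"
  have "Max (?f ` {2..c}) \<in> ?f ` {2..c}" using assms(1) by (intro Max_in) auto
  then obtain c' where c': "2 \<le> c'" "c' \<le> c" "real m - 1 = ?f c'" using assms(3) by auto
  have "even (c' * (c' - 1))" by (cases c') simp_all
  then have ch: "2 * (c' choose 2) = c' * (c' - 1)" by (simp add: choose_two)
  then have "0 < c' choose 2" using c'(1) by (metis mult_is_0 diff_is_0_eq not_gr0 not_numeral_le_zero numeral_2_eq_2 Suc_1 not_less_eq_eq)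
  then have "(real m - 1) * real (c' choose 2) = real c' * (real l + 1) - real k"
    using c'(3) by (simp add: field_simps)
  moreover obtain m0 where "m = Suc m0" using assms(2) by (cases m) simp_all
  ultimately have "real (2 * (c' choose 2) * (m - 1) + 2 * k) = real (2 * c' * (l + 1))"
    by (simp add: algebra_simps)
  then have "c' * (c' - 1) * (m - 1) + 2 * k = 2 * c' * (l + 1)" unfolding ch of_nat_eq_iff .
  then show ?thesis using that c'(1,2) by simp
qed

section \<open>From digraphs and walk distances to symmetric relations and layers\<close>

sublocale graph \<subseteq> adj: sgraph_on "\<lambda>x y. x \<rightarrow>\<^bsub>G\<^esub> y" "verts G"
proof
  show "y \<rightarrow>\<^bsub>G\<^esub> x" if "x \<rightarrow>\<^bsub>G\<^esub> y" for x y using sym_arcs that unfolding symmetric_def by (rule symD)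
  show "\<not> x \<rightarrow>\<^bsub>G\<^esub> x" for x using adj_not_same by blast
qed

context graph
begin

lemma neighbours_nb: "neighbours G u = adj.nb (verts G) u"
  by (auto simp: neighbours_def)

lemma mem_ball_iff:
  assumes "u \<in> verts G"
  shows "w \<in> adj.ball u i \<longleftrightarrow> (\<exists>p. awalk u p w \<and> length p \<le> i)"
proof (induction i arbitrary: w)
  case 0
  then show ?case using assms by (auto simp: awalk_Nil_iff)
next
  case (Suc i)
  show ?case
  proof
    assume "w \<in> adj.ball u (Suc i)"
    then consider "w \<in> adj.ball u i" | v where "v \<in> adj.ball u i" "v \<rightarrow>\<^bsub>G\<^esub> w" by auto
    then show "\<exists>p. awalk u p w \<and> length p \<le> Suc i"
    proof cases
      case 1
      then show ?thesis using Suc le_SucI by blast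
    next
      case 2
      then obtain p where p: "awalk u p v" "length p \<le> i" using Suc by blast
      obtain e where e: "e \<in> arcs G" "tail G e = v" "head G e = w"
        using 2(2) by (auto simp: arcs_ends_def arc_to_ends_def)
      then have "awalk v [e] w" using head_in_verts[OF e(1)] by (simp add: awalk_Cons_iff awalk_Nil_iff)
      then have "awalk u (p @ [e]) w" using p(1) by (rule awalk_appendI[rotated])
      then show ?thesis using p(2) by (intro exI[of _ "p @ [e]"]) simp
    qed
  next
    assume "\<exists>p. awalk u p w \<and> length p \<le> Suc i"
    then obtain p where p: "awalk u p w" "length p \<le> Suc i" by blast
    show "w \<in> adj.ball u (Suc i)"
    proof (cases p rule: rev_cases)
      case Nil
      then have "w = u" using p(1) by (simp add: awalk_Nil_iff)
      moreover have "u \<in> adj.ball u (Suc i)" using adj.ball_mono[of 0 "Suc i" u] by auto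
      ultimately show ?thesis by simp
    next
      case (snoc q e)
      then have q: "awalk u q (awlast u q)" "awalk (awlast u q) [e] w" using p(1) by simp_all
      then have e: "e \<in> arcs G" "tail G e = awlast u q" "head G e = w"
        by (simp_all add: awalk_Cons_iff awalk_Nil_iff)
      have "awlast u q \<in> adj.ball u i" using Suc q(1) p(2) snoc by auto
      moreover have "awlast u q \<rightarrow>\<^bsub>G\<^esub> w" using e in_arcs_imp_in_arcs_ends[OF e(1)] by simp
      moreover have "w \<in> verts G" using e by auto
      ultimately show ?thesis using adj.ball_step by blast
    qed
  qed
qed

text \<open>The distance is an infimum of walk lengths, attained by a shortest walk and infinite if
  there is no walk.\<close>

lemma distance_iff:
  "\<mu> (\<lambda>_. 1) u w = ereal (real i) \<longleftrightarrow>
    (\<exists>p. awalk u p w \<and> length p = i) \<and> (\<forall>p. awalk u p w \<longrightarrow> i \<le> length p)"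
proof (cases "\<exists>p. awalk u p w")
  case False
  then have "\<mu> (\<lambda>_. 1) u w = \<infinity>" using shortest_path_inf reachable_awalk by blast
  then show ?thesis using False by auto
next
  case True
  define n where "n = (LEAST n. \<exists>p. awalk u p w \<and> length p = n)"
  obtain p where p: "awalk u p w" "length p = n"
    using LeastI_ex[of "\<lambda>n. \<exists>p. awalk u p w \<and> length p = n"] True unfolding n_def by blast
  have le: "n \<le> length q" if "awalk u q w" for q
    unfolding n_def by (rule Least_le) (use that in blast)
  have cost: "awalk_cost (\<lambda>_. 1) q = real (length q)" for q :: "'b list"
    by (induction q) (simp_all add: awalk_cost_def)
  have "\<mu> (\<lambda>_. 1) u w = ereal (real n)"
  proof (rule antisym)
    show "\<mu> (\<lambda>_. 1) u w \<le> ereal (real n)" using min_cost_le_walk_cost[OF p(1)] p(2) cost by metis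
    show "ereal (real n) \<le> \<mu> (\<lambda>_. 1) u w"
      unfolding \<mu>_def by (rule INF_greatest) (use le cost in simp)
  qed
  then show ?thesis using p le by (auto intro: antisym)
qed

lemma sphere_lay:
  assumes "u \<in> verts G"
  shows "sphere G i u = adj.lay u i"
proof -
  have "w \<in> adj.lay u i \<longleftrightarrow> w \<in> adj.ball u i \<and> (\<forall>j<i. w \<notin> adj.ball u j)" for w
  proof
    show "w \<in> adj.lay u i \<Longrightarrow> w \<in> adj.ball u i \<and> (\<forall>j<i. w \<notin> adj.ball u j)"
      using adj.lay_ball adj.lay_not_ball by blast
    show "w \<in> adj.ball u i \<and> (\<forall>j<i. w \<notin> adj.ball u j) \<Longrightarrow> w \<in> adj.lay u i"
      by (cases i) (auto simp: adj.lay_Suc)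
  qed
  moreover have "w \<in> adj.ball u i \<and> (\<forall>j<i. w \<notin> adj.ball u j)
      \<longleftrightarrow> (\<exists>p. awalk u p w \<and> length p = i) \<and> (\<forall>p. awalk u p w \<longrightarrow> i \<le> length p)" for w
    unfolding mem_ball_iff[OF assms]
  proof safe
    fix p assume p: "awalk u p w" "length p \<le> i" and no: "\<forall>j<i. \<nexists>p. awalk u p w \<and> length p \<le> j"
    then have "i \<le> length q" if "awalk u q w" for q using that by (meson le_refl not_le)
    then show "\<exists>p. awalk u p w \<and> length p = i" "i \<le> length q" if "awalk u q w" for q
      using p that by (auto intro: antisym)
  qed auto
  ultimately have "w \<in> sphere G i u \<longleftrightarrow> w \<in> adj.lay u i" for w
    unfolding sphere_def distance_iff[symmetric] using adj.lay_sub[OF assms, of i] by auto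
  then show ?thesis by blast
qed

lemma connected_lay:
  assumes "Digraph_Component.connected G" "u \<in> verts G" "w \<in> verts G"
  shows "\<exists>i. w \<in> adj.lay u i"
proof -
  have "u \<rightarrow>\<^sup>* w" using symmetric_connected_imp_strongly_connected[OF sym_arcs assms(1)] assms(2,3) by blast
  then obtain p where "awalk u p w" using reachable_awalk by blast
  then have "w \<in> adj.ball u (length p)" using mem_ball_iff[OF assms(2)] by blast
  then show ?thesis using adj.ball_lay by blast
qed

end

locale terwilliger_digraph = graph G + terwilliger_graph "\<lambda>x y. x \<rightarrow>\<^bsub>G\<^esub> y" "verts G" k l m
  for G :: "('a, 'b) pre_digraph" and k l m
begin

lemma distance_regular_arrays:
  assumes conn: "Digraph_Component.connected G" and arr: "\<And>u. u \<in> verts G \<Longrightarrow> array_at u bs cs"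
  shows "distance_regular G bs cs"
proof -
  obtain u where u: "u \<in> verts G"
    using symmetric_connected_imp_strongly_connected[OF sym_arcs conn] unfolding strongly_connected_def by blast
  have len: "length bs = length cs" using arr[OF u] by (simp add: array_at_def)
  have "sphere G (length cs) u \<noteq> {}"
    using arr[OF u] sphere_lay[OF u] unfolding array_at_def by simp
  moreover have "\<exists>i\<le>length cs. w \<in> sphere G i v" if vw: "v \<in> verts G" "w \<in> verts G" for v w
  proof -
    obtain i where i: "w \<in> adj.lay v i" using connected_lay[OF conn vw] by blast
    have "i \<le> length cs"
    proof (rule ccontr)
      assume "\<not> i \<le> length cs"
      then have "adj.lay v i = {}"
        using arr[OF vw(1)] lay_empty_mono[of "Suc (length cs)" i v] unfolding array_at_def by simp
      then show False using i by simp
    qed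
    then show ?thesis using i sphere_lay[OF vw(1)] by blast
  qed
  ultimately have diam: "has_diameter G (length cs)" unfolding has_diameter_def using u by blast
  have "(1 \<le> i \<and> i \<le> length cs \<longrightarrow> card (neighbours G w \<inter> sphere G (i - 1) v) = cs ! (i - 1)) \<and>
        (i < length bs \<longrightarrow> card (neighbours G w \<inter> sphere G (i + 1) v) = bs ! i)"
    if v: "v \<in> verts G" and w: "w \<in> sphere G i v" for i v w
  proof (intro conjI impI)
    note a = arr[OF v, unfolded array_at_def]
    assume i: "1 \<le> i \<and> i \<le> length cs"
    then have "w \<in> adj.lay v (Suc (i - 1))" using w sphere_lay[OF v] by simp
    moreover have "i - 1 < length cs" using i by linarith
    ultimately have "card (N w \<inter> adj.lay v (i - 1)) = cs ! (i - 1)" using a by blast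
    then show "card (neighbours G w \<inter> sphere G (i - 1) v) = cs ! (i - 1)"
      unfolding sphere_lay[OF v] neighbours_nb .
  next
    note a = arr[OF v, unfolded array_at_def]
    assume i: "i < length bs"
    have "w \<in> adj.lay v i" using w sphere_lay[OF v] by simp
    then have "card (N w \<inter> adj.lay v (Suc i)) = bs ! i" using a i len by simp
    then show "card (neighbours G w \<inter> sphere G (i + 1) v) = bs ! i"
      unfolding sphere_lay[OF v] neighbours_nb by simp
  qed
  then show ?thesis
    unfolding distance_regular_def using graph_axioms conn len diam by blast
qed

end

theorem theorem4p2:
  fixes G :: "('a, 'b) pre_digraph" and v k l m c :: nat
  assumes "graph G" and "Digraph_Component.connected G"
    and "amply_regular G v k l m" and "m > 1"
    and "c \<ge> 2" and "local_coclique_property G c"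
    and c_maximal: "\<And>c'. local_coclique_property G c' \<Longrightarrow> c' \<le> c"
    and mu_bound_equality:
      "real m - 1 =
         Max ((\<lambda>c'. (real c' * (real l + 1) - real k) / real (c' choose 2)) ` {2..c})"
  shows "m = 2 \<and> (is_icosahedron G \<or> is_Doro_graph G \<or> is_Conway_Smith_graph G)"
proof -
  interpret graph G by fact
  let ?E = "\<lambda>x y. x \<rightarrow>\<^bsub>G\<^esub> y" and ?V = "verts G"
  let ?N = "adj.nb ?V"
  note amply = assms(3)[unfolded amply_regular_def neighbours_nb]
  have k: "card (?N u) = k" if "u \<in> ?V" for u using amply that by blast
  have l: "card (?N u \<inter> ?N w) = l" if "u \<in> ?V" "w \<in> ?N u" for u w using amply that by blast
  have m: "card (?N u \<inter> ?N w) = m"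
    if "u \<in> ?V" "w \<in> ?V" "w \<noteq> u" "\<not> ?E u w" "?N u \<inter> ?N w \<noteq> {}" for u w
    using amply that sphere_lay[OF that(1), of 2] adj.lay_2[OF that(1), of w] by blast
  have sphere_1: "sphere G 1 u = ?N u" if "u \<in> ?V" for u
    using sphere_lay[OF that] adj.lay_1[OF that] by simp
  have fin: "finite (?N u)" for u by (simp add: adj.finite_nb)
  have closed: "card {w \<in> ?N x. w = s \<or> ?E s w} = l + 1" if "x \<in> ?V" "s \<in> ?N x" for x s
  proof -
    have "{w \<in> ?N x. w = s \<or> ?E s w} = insert s (?N x \<inter> ?N s)" using that by auto
    then show ?thesis using l[OF that] adj.E_irrefl[of s] fin by simp
  qed
  obtain c' where c': "2 \<le> c'" "c' \<le> c" "2 * k + c' * (c' - 1) * (m - 1) = 2 * c' * (l + 1)"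
    using max_equality[OF \<open>2 \<le> c\<close> \<open>1 < m\<close> mu_bound_equality] .
  have local: "card (?N x \<inter> ?N y \<inter> ?N z) = m - 1"
    if x: "x \<in> ?V" and y: "y \<in> ?N x" and z: "z \<in> ?N x" and yz: "y \<noteq> z" "\<not> ?E y z" for x y z
  proof -
    have "\<exists>S. S \<subseteq> sphere G 1 x \<and> coclique G c S \<and> y \<in> S \<and> z \<in> S"
      by (rule assms(6)[unfolded local_coclique_property_def, rule_format])
        (use x y z yz in \<open>simp_all only: sphere_1[OF x] simp_thms\<close>)
    then obtain S where S: "S \<subseteq> ?N x" "coclique G c S" "y \<in> S" "z \<in> S"
      unfolding sphere_1[OF x] by (elim exE conjE)
    have Sc: "finite S" "card S = c" "\<And>s t. s \<in> S \<Longrightarrow> t \<in> S \<Longrightarrow> \<not> ?E s t"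
      using S(2) adj.E_irrefl unfolding coclique_def by metis+
    \<comment> \<open>The maximum may be attained at some \<open>c'\<close> below \<open>c\<close>,
      so the coclique is cut down to \<open>c'\<close> vertices while keeping \<open>y\<close> and
      \<open>z\<close>.\<close>
    have "c' - 2 \<le> card (S - {y, z})" using S Sc c' yz(1) by (simp add: card_Diff_subset)
    then obtain R where R: "R \<subseteq> S - {y, z}" "card R = c' - 2" "finite R"
      by (rule obtain_subset_with_card_n)
    let ?S = "insert y (insert z R)"
    have cS: "card ?S = c'"
    proof -
      have "z \<notin> R" "y \<notin> insert z R" using R(1) yz(1) by blast+
      then show ?thesis using R(2,3) c'(1) by simp
    qed
    have sub: "?S \<subseteq> S" using R(1) S(3,4) by blast
    have set: "{w \<in> ?N x. ?E s w \<and> ?E t w} = ?N x \<inter> ?N s \<inter> ?N t" for s t by auto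
    have "card {w \<in> ?N x. ?E y w \<and> ?E z w} = m - 1"
    proof (rule adj.coclique_bonferroni_equality[OF fin closed[OF x], where S = ?S and c = c'])
      show "?S \<subseteq> ?N x" using sub S(1) by blast
      show "card ?S = c'" by (rule cS)
      show "\<not> ?E s t" if "s \<in> ?S" "t \<in> ?S" for s t using Sc(3) sub that by blast
      show "2 * card (?N x) + c' * (c' - 1) * (m - 1) = 2 * c' * (l + 1)" using c'(3) k[OF x] by simp
      \<comment> \<open>One of the \<open>m\<close> common neighbours of \<open>s\<close> and
        \<open>t\<close> is \<open>x\<close>, which is not in its own neighbourhood.\<close>
      show "card {w \<in> ?N x. ?E s w \<and> ?E t w} \<le> m - 1" if st: "s \<in> ?S" "t \<in> ?S" "s \<noteq> t" for s t
      proof -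
        have "s \<in> ?N x" "t \<in> ?N x" using st sub S(1) by blast+
        then have D: "s \<in> ?V" "t \<in> ?V" "?E s x" "?E t x" using adj.E_sym by simp_all
        have "\<not> ?E s t" using Sc(3) sub st by blast
        moreover have xin: "x \<in> ?N s \<inter> ?N t" using D x by simp
        ultimately have "card (?N s \<inter> ?N t) = m" using m[of s t] D st(3) by blast
        then have "card (?N s \<inter> ?N t - {x}) = m - 1" using xin fin by simp
        moreover have "?N x \<inter> ?N s \<inter> ?N t \<subseteq> ?N s \<inter> ?N t - {x}" using adj.E_irrefl by auto
        ultimately show ?thesis unfolding set using card_mono fin by (metis finite_Diff finite_Int)
      qed
    qed (use yz in auto)
    then show ?thesis unfolding set .
  qed
  have clique: "adj.clique (?N y \<inter> ?N z)" if yz: "y \<in> ?V" "z \<in> ?V" "y \<noteq> z" "\<not> ?E y z" for y z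
    unfolding adj.clique_def
  proof (intro ballI impI)
    fix x w assume x: "x \<in> ?N y \<inter> ?N z" and w: "w \<in> ?N y \<inter> ?N z" and ne: "x \<noteq> w"
    have D: "x \<in> ?V" "y \<in> ?N x" "z \<in> ?N x" using x yz adj.E_sym by simp_all
    have "card (?N y \<inter> ?N z) = m" using m[of y z] yz x by blast
    then have "card (?N y \<inter> ?N z - {x}) = m - 1" using x fin by simp
    moreover have "?N x \<inter> ?N y \<inter> ?N z \<subseteq> ?N y \<inter> ?N z - {x}" using adj.E_irrefl by auto
    \<comment> \<open>By equality of sizes, every common neighbour of \<open>y\<close> and
      \<open>z\<close> other than \<open>x\<close> is adjacent to \<open>x\<close>.\<close>
    ultimately have "?N x \<inter> ?N y \<inter> ?N z = ?N y \<inter> ?N z - {x}"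
      using local[OF D yz(3,4)] fin by (intro card_subset_eq) simp_all
    then have "w \<in> ?N x" using w ne by blast
    then show "?E x w" by simp
  qed
  have terw: "adj.terwilliger ?V k l m"
    unfolding adj.terwilliger_def using k l m clique by (metis finite_verts)
  \<comment> \<open>Otherwise all local graphs are complete, and the coclique property holds
    vacuously for \<open>Suc c\<close>, against the maximality of \<open>c\<close>.\<close>
  have kl: "l + 1 < k"
  proof (rule ccontr)
    assume kl: "\<not> l + 1 < k"
    have "?E y z" if "x \<in> ?V" "y \<in> ?N x" "z \<in> ?N x" "y \<noteq> z" for x y z
    proof -
      have "{w \<in> ?N x. w = y \<or> ?E y w} = ?N x"
        by (rule card_seteq) (use fin closed[OF that(1,2)] k[OF that(1)] kl in auto)
      from subsetD[OF equalityD2[OF this] that(3)] show ?thesis using that(4) by simp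
    qed
    then have "local_coclique_property G (Suc c)"
      unfolding local_coclique_property_def using sphere_1 by metis
    then show False using c_maximal[of "Suc c"] by simp
  qed
  interpret T: terwilliger_digraph G k l m by unfold_locales (rule terw)
  have "2 * int k + int c' * (int c' - 1) * (int m - 1) = 2 * int c' * (int l + 1)"
  proof -
    have "int (2 * k + c' * (c' - 1) * (m - 1)) = int (2 * c' * (l + 1))" using c'(3) by simp
    moreover obtain m0 c0 where "m = Suc m0" "c' = Suc c0"
      using c'(1) \<open>1 < m\<close> by (cases m; cases c') simp_all
    ultimately show ?thesis by (simp add: algebra_simps)
  qed
  then interpret C: coclique_equality ?E ?V k l m "int c'"
    by unfold_locales (use \<open>1 < m\<close> kl in auto)
  obtain x where x: "x \<in> ?V"
    using symmetric_connected_imp_strongly_connected[OF sym_arcs assms(2)]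
    unfolding strongly_connected_def by blast
  have m2: "m = 2" by (rule C.small_parameters(1)[OF x])
  interpret small: small_terwilliger ?E ?V k l
  proof
    show "adj.terwilliger ?V k l 2" using terw m2 by simp
    show "k = 5 \<and> l = 2 \<or> k = 10 \<and> l = 3" by (rule C.small_parameters(2)[OF x])
    show False
      if "a \<in> ?V" "b \<in> ?V" "d \<in> ?V" "e \<in> ?V" "?E a b" "?E a d" "?E a e" "?E b d" "?E b e" "?E d e"
      for a b d e
    proof -
      have "e \<in> ?N a \<inter> ?N b \<inter> ?N d" using that by simp
      moreover have "?N a \<inter> ?N b \<inter> ?N d = {}" using C.small_parameters(3)[OF that(1)] that by simp
      ultimately show False by blast
    qed
  qed
  have "(\<forall>u\<in>?V. T.array_at u [5, 2, 1] [1, 2, 5]) \<or> (\<forall>u\<in>?V. T.array_at u [10, 6, 4] [1, 2, 5]) \<or>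
    (\<forall>u\<in>?V. T.array_at u [10, 6, 4, 1] [1, 2, 6, 10])"
    by (rule small.arrays) (rule connected_lay[OF assms(2)])
  then have "distance_regular G [5, 2, 1] [1, 2, 5] \<or> distance_regular G [10, 6, 4] [1, 2, 5] \<or>
    distance_regular G [10, 6, 4, 1] [1, 2, 6, 10]"
    using T.distance_regular_arrays[OF assms(2)] by blast
  then show ?thesis
    unfolding is_icosahedron_def is_Doro_graph_def is_Conway_Smith_graph_def using m2 by blast
qed

end
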